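(* Let $S\in\mathbb{N}$ and let $a_k(r_{-S},\ldots,r_{S-1})$, $k=-S,\ldots,S$, be real-valued functions of $2S$ real variables, defined in a neighborhood of $(1,\ldots,1)$, analytic (holomorphic) at $(1,\ldots,1)$ and satisfying $a_k(\alpha r_{-S},\ldots,\alpha r_{S-1})=\alpha^{-1}a_k(r_{-S},\ldots,r_{S-1})$ in their domain of definition. Put $\mathring a_k=a_k(1,\ldots,1)$ and assume $\sum_k\mathring a_k=0$, $\sum_k k\mathring a_k=1$. Consider, on meshes $X$, the ODE systems $$\frac{du_j(t)}{dt}+\sum_{k=-S}^S a_k(h_{j-S+1/2},\ldots,h_{j+S-1/2})\,u_{j+k}(t)=0,\quad j\in\mathbb{Z},\qquad (\ast)$$ whose solutions are by definition $N(X)$-periodic in $j$. Let $\mathring\lambda(\phi)=\sum_{k=-S}^S\mathring a_k e^{i\phi k}$, and let $\varkappa$ be such that for some $c\ne0$ there holds $\mathrm{Re}\,\mathring\lambda(\phi)=c\phi^{\varkappa+1}+O(|\phi|^{\varkappa+2})$ as $\phi\to0$. Suppose that (1) $\mathrm{Re}\,\mathring\lambda(\phi)>0$ for all $\phi\in\mathbb{R}$ with $\phi/(2\pi)\notin\mathbb{Z}$; (2) there are a function $\mu_0:\mathbb{N}\to(0,\infty)$ and a local mapping $\Pi$ such that $(\ast)$ is $(\varkappa-1)$-exact in the sense of $\Pi$ on every mesh $X\in\mathcal{F}_{\mu_0}$. Then for each $K>1$ there exists $\mu:\mathbb{N}\to(0,\infty)$ such that for each mesh $X\in\mathcal{F}_\mu$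 and each solution $u$ of $(\ast)$ on $X$ there holds $$\|u(t)\|_{av}\le K\|u(0)\|_{av}\quad\text{for all } t\ge0.$$
   Context: A mesh is a strictly increasing sequence $X=\{x_j\in\mathbb{R},\,j\in\mathbb{Z}\}$ such that for some $N=N(X)\in\mathbb{N}$ there holds $x_{j+N}=x_j+2\pi$ for all $j$. Put $h_{av}=h_{av}(X)=2\pi/N(X)$, $h_{j+1/2}=x_{j+1}-x_j$, $h_{\max}(X)=\max_j h_{j+1/2}$, $h_{\min}(X)=\min_j h_{j+1/2}$. The period $m(X)$ is the minimal $m\in\mathbb{N}$ such that $h_{j+m+1/2}=h_{j+1/2}$ for all $j$. A mesh with $m(X)=1$ is uniform. For $\mu:\mathbb{N}\to(0,\infty)$, $\mathcal{F}_\mu=\{X : h_{\max}(X)-h_{\min}(X)\le\mu(m(X))\,h_{av}(X)\}$. A mesh function on $X$ is an $N(X)$-periodic sequence $f=\{f_j\in\mathbb{C}\}_{j\in\mathbb{Z}}$, with norm $\|f\|_{av}=\bigl(\frac1{N(X)}\sum_{j=0}^{N(X)-1}|f_j|^2\bigr)^{1/2}$. By homogeneity of $a_k$, the coefficients in $(\ast)$ are understood as $a_k(h_{j-S+1/2},\ldots,h_{j+S-1/2})=\frac1{h_{av}}a_k\bigl(\frac{h_{j-S+1/2}}{h_{av}},\ldots,\frac{h_{j+S-1/2}}{h_{av}}\bigr)$. Speaking of $(\ast)$ on a mesh presupposes that these ratios lie in the domain of the $a_k$ for every $j$. A local mapping $\Pi$ takes a mesh $X$ and a function $f\in C^q(\mathbb{R})$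 (for some fixed integer $q\ge0$) to the sequence $(\Pi_Xf)_j=\langle\mu_j^{(X)},f((\,\cdot\,+j)h_{av})\rangle$, $j\in\mathbb{Z}$, where $\mu_j^{(X)}\in(C^q(G))^*$ for some bounded domain $G$, $\mu_j^{(X)}$ is periodic in $j$ with period $m(X)$, is invariant under mesh scaling $\{x_j\}\to\{x_j/k\}$, $k\in\mathbb{N}$, and satisfies $\langle\mu_j^{(X)},1\rangle\ne0$ for all $j$. The truncation error of $(\ast)$ on $f$ in the sense of $\Pi$ is the sequence $(\epsilon_X(f,\Pi))_j=-(\Pi_X f')_j+\sum_{k=-S}^S a_k(h_{j-S+1/2},\ldots,h_{j+S-1/2})(\Pi_Xf)_{j+k}$. The system $(\ast)$ is $q$-exact in the sense of $\Pi$ on $X$ if $\epsilon_X(f,\Pi)=0$ for each polynomial $f$ of degree at most $q$. *)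

theory Defs
  imports
    "HOL-Analysis.Analysis"
    "HOL-Computational_Algebra.Polynomial"
    "HOL-Library.Landau_Symbols"
begin

section \<open>Meshes\<close>

definition is_mesh :: "(int \<Rightarrow> real) \<Rightarrow> bool" where
  "is_mesh X \<longleftrightarrow> strict_mono X \<and> (\<exists>N::nat. \<forall>j. X (j + int N) = X j + 2 * pi)"

text \<open>For a mesh this number exists, is unique and is positive.\<close>

definition mesh_N :: "(int \<Rightarrow> real) \<Rightarrow> nat" where
  "mesh_N X = (THE N. \<forall>j. X (j + int N) = X j + 2 * pi)"

definition h_av :: "(int \<Rightarrow> real) \<Rightarrow> real" where
  "h_av X = 2 * pi / real (mesh_N X)"

text \<open>\<open>h_step X j\<close> is the half-integer indexed step $h_{j+1/2}$.\<close>

definition h_step :: "(int \<Rightarrow> real) \<Rightarrow> int \<Rightarrow> real" where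
  "h_step X j = X (j + 1) - X j"

definition h_max :: "(int \<Rightarrow> real) \<Rightarrow> real" where
  "h_max X = Max (range (h_step X))"

definition h_min :: "(int \<Rightarrow> real) \<Rightarrow> real" where
  "h_min X = Min (range (h_step X))"

definition mesh_period :: "(int \<Rightarrow> real) \<Rightarrow> nat" where
  "mesh_period X = (LEAST m. 1 \<le> m \<and> (\<forall>j. h_step X (j + int m) = h_step X j))"

definition mesh_family :: "(nat \<Rightarrow> real) \<Rightarrow> (int \<Rightarrow> real) set" where
  "mesh_family \<mu> = {X. is_mesh X \<and> h_max X - h_min X \<le> \<mu> (mesh_period X) * h_av X}"

definition mesh_function :: "(int \<Rightarrow> real) \<Rightarrow> (int \<Rightarrow> complex) \<Rightarrow> bool" where
  "mesh_function X f \<longleftrightarrow> (\<forall>j. f (j + int (mesh_N X)) = f j)"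

definition norm_av :: "(int \<Rightarrow> real) \<Rightarrow> (int \<Rightarrow> complex) \<Rightarrow> real" where
  "norm_av X f = sqrt (1 / real (mesh_N X) * (\<Sum>j = 0..<int (mesh_N X). (cmod (f j))\<^sup>2))"

section \<open>Coefficient functions of finitely many real variables\<close>

text \<open>A point of $\mathbb{R}^I$ for a finite index set \<open>I\<close> is an element of
  \<open>I \<rightarrow>\<^sub>E UNIV\<close>, so that it has no content outside \<open>I\<close>. The variables
  $(r_{-S},\ldots,r_{S-1})$ are indexed by \<open>stencil S\<close>.\<close>

definition stencil :: "nat \<Rightarrow> int set" where
  "stencil S = {- int S..<int S}"

definition ones :: "int set \<Rightarrow> int \<Rightarrow> real" where
  "ones I = (\<lambda>i\<in>I. 1)"

definition cube :: "int set \<Rightarrow> (int \<Rightarrow> real) \<Rightarrow> real \<Rightarrow> (int \<Rightarrow> real) set" where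
  "cube I p e = {r \<in> I \<rightarrow>\<^sub>E UNIV. \<forall>i\<in>I. \<bar>r i - p i\<bar> < e}"

text \<open>Real analyticity in several variables: the sum of an (unconditionally convergent)
  power series on a neighbourhood of \<open>p\<close>; multi-indices are the elements of
  \<open>I \<rightarrow>\<^sub>E (UNIV :: nat set)\<close>.\<close>

definition analytic_at_pt ::
    "int set \<Rightarrow> ((int \<Rightarrow> real) \<Rightarrow> real) \<Rightarrow> (int \<Rightarrow> real) \<Rightarrow> bool" where
  "analytic_at_pt I f p \<longleftrightarrow>
     (\<exists>e>0. \<exists>c :: (int \<Rightarrow> nat) \<Rightarrow> real. \<forall>r \<in> cube I p e.
        ((\<lambda>\<nu>. c \<nu> * (\<Prod>i\<in>I. (r i - p i) ^ \<nu> i)) has_sum f r) (I \<rightarrow>\<^sub>E UNIV))"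

text \<open>\<open>f\<close> has domain of definition \<open>D\<close>; its values outside \<open>D\<close> are never used.
  Homogeneity is required only where both sides are defined.\<close>

definition admissible_coeff ::
    "int set \<Rightarrow> (int \<Rightarrow> real) set \<Rightarrow> ((int \<Rightarrow> real) \<Rightarrow> real) \<Rightarrow> bool" where
  "admissible_coeff I D f \<longleftrightarrow>
     D \<subseteq> I \<rightarrow>\<^sub>E UNIV \<and>
     (\<exists>e>0. cube I (ones I) e \<subseteq> D) \<and>
     analytic_at_pt I f (ones I) \<and>
     (\<forall>\<alpha>>0. \<forall>r\<in>D. (\<lambda>i\<in>I. \<alpha> * r i) \<in> D \<longrightarrow> f (\<lambda>i\<in>I. \<alpha> * r i) = inverse \<alpha> * f r)"

definition scaled_steps :: "nat \<Rightarrow> (int \<Rightarrow> real) \<Rightarrow> int \<Rightarrow> int \<Rightarrow> real" where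
  "scaled_steps S X j = (\<lambda>i\<in>stencil S. h_step X (j + i) / h_av X)"

definition coeffs_defined ::
    "nat \<Rightarrow> (int \<Rightarrow> (int \<Rightarrow> real) set) \<Rightarrow> (int \<Rightarrow> real) \<Rightarrow> bool" where
  "coeffs_defined S D X \<longleftrightarrow> (\<forall>k\<in>{- int S..int S}. \<forall>j. scaled_steps S X j \<in> D k)"

definition mesh_coeff ::
    "nat \<Rightarrow> (int \<Rightarrow> (int \<Rightarrow> real) \<Rightarrow> real) \<Rightarrow> (int \<Rightarrow> real) \<Rightarrow> int \<Rightarrow> int \<Rightarrow> real" where
  "mesh_coeff S a X j k = 1 / h_av X * a k (scaled_steps S X j)"

definition coeff0 :: "nat \<Rightarrow> (int \<Rightarrow> (int \<Rightarrow> real) \<Rightarrow> real) \<Rightarrow> int \<Rightarrow> real" where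
  "coeff0 S a k = a k (ones (stencil S))"

definition symbol0 :: "nat \<Rightarrow> (int \<Rightarrow> (int \<Rightarrow> real) \<Rightarrow> real) \<Rightarrow> real \<Rightarrow> complex" where
  "symbol0 S a \<phi> =
     (\<Sum>k = - int S..int S. of_real (coeff0 S a k) * exp (\<i> * of_real \<phi> * of_int k))"

definition is_solution ::
    "nat \<Rightarrow> (int \<Rightarrow> (int \<Rightarrow> real) \<Rightarrow> real) \<Rightarrow> (int \<Rightarrow> real) \<Rightarrow> (real \<Rightarrow> int \<Rightarrow> complex) \<Rightarrow> bool" where
  "is_solution S a X u \<longleftrightarrow>
     (\<forall>t\<ge>0. mesh_function X (u t)) \<and>
     (\<forall>t\<ge>0. \<forall>j. \<exists>d. ((\<lambda>s. u s j) has_vector_derivative d) (at t within {0..}) \<and>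
        d + (\<Sum>k = - int S..int S. of_real (mesh_coeff S a X j k) * u t (j + k)) = 0)"

section \<open>Local mappings and exactness\<close>

definition nderiv :: "nat \<Rightarrow> (real \<Rightarrow> complex) \<Rightarrow> real \<Rightarrow> complex" where
  "nderiv n f = ((\<lambda>g x. vector_derivative g (at x)) ^^ n) f"

definition C_diff :: "nat \<Rightarrow> real set \<Rightarrow> (real \<Rightarrow> complex) set" where
  "C_diff q G = {f. (\<forall>i<q. \<forall>x\<in>G. nderiv i f differentiable (at x)) \<and>
                    continuous_on G (nderiv q f)}"

text \<open>The normed space $C^q(G)$ for a bounded open \<open>G\<close>. Its elements are represented by
  functions on the whole line, of which only the values on \<open>G\<close> matter.\<close>

definition C_space :: "nat \<Rightarrow> real set \<Rightarrow> (real \<Rightarrow> complex) set" where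
  "C_space q G = {f \<in> C_diff q G. \<forall>i\<le>q. bounded (nderiv i f ` G)}"

definition C_norm :: "nat \<Rightarrow> real set \<Rightarrow> (real \<Rightarrow> complex) \<Rightarrow> real" where
  "C_norm q G f = (MAX i\<in>{..q}. SUP x\<in>G. cmod (nderiv i f x))"

text \<open>The dual of $C^q(G)$. The norm bound makes the value of a functional independent of
  the values of its argument outside \<open>G\<close>.\<close>

definition C_dual :: "nat \<Rightarrow> real set \<Rightarrow> ((real \<Rightarrow> complex) \<Rightarrow> complex) set" where
  "C_dual q G = {L.
     (\<forall>f\<in>C_space q G. \<forall>g\<in>C_space q G. L (\<lambda>x. f x + g x) = L f + L g) \<and>
     (\<forall>c. \<forall>f\<in>C_space q G. L (\<lambda>x. c * f x) = c * L f) \<and>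
     (\<exists>B. \<forall>f\<in>C_space q G. cmod (L f) \<le> B * C_norm q G f)}"

text \<open>Equality of functionals means equality on $C^q(G)$. The smoothness \<open>q\<close> and the
  domain \<open>G\<close> belong to the mapping, so they depend neither on the mesh nor on \<open>j\<close>.\<close>

definition local_mapping ::
    "((int \<Rightarrow> real) \<Rightarrow> (real \<Rightarrow> complex) \<Rightarrow> int \<Rightarrow> complex) \<Rightarrow> bool" where
  "local_mapping P \<longleftrightarrow>
     (\<exists>(q::nat) (G::real set) (\<mu> :: (int \<Rightarrow> real) \<Rightarrow> int \<Rightarrow> (real \<Rightarrow> complex) \<Rightarrow> complex).
        open G \<and> connected G \<and> G \<noteq> {} \<and> bounded G \<and>
        (\<forall>X. is_mesh X \<longrightarrow>
           (\<forall>j. \<mu> X j \<in> C_dual q G \<and>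
                \<mu> X j (\<lambda>_. 1) \<noteq> 0 \<and>
                (\<forall>g\<in>C_space q G. \<mu> X (j + int (mesh_period X)) g = \<mu> X j g) \<and>
                (\<forall>k::nat. 1 \<le> k \<longrightarrow>
                   (\<forall>g\<in>C_space q G. \<mu> (\<lambda>i. X i / real k) j g = \<mu> X j g)) \<and>
                (\<forall>f\<in>C_diff q UNIV. P X f j = \<mu> X j (\<lambda>\<xi>. f ((\<xi> + of_int j) * h_av X))))))"

definition trunc_error ::
    "nat \<Rightarrow> (int \<Rightarrow> (int \<Rightarrow> real) \<Rightarrow> real) \<Rightarrow> (int \<Rightarrow> real) \<Rightarrow> (real \<Rightarrow> complex) \<Rightarrow>
     ((int \<Rightarrow> real) \<Rightarrow> (real \<Rightarrow> complex) \<Rightarrow> int \<Rightarrow> complex) \<Rightarrow> int \<Rightarrow> complex" where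
  "trunc_error S a X f P j =
     - P X (\<lambda>x. vector_derivative f (at x)) j +
     (\<Sum>k = - int S..int S. of_real (mesh_coeff S a X j k) * P X f (j + k))"

definition exact_on ::
    "nat \<Rightarrow> (int \<Rightarrow> (int \<Rightarrow> real) \<Rightarrow> real) \<Rightarrow> nat \<Rightarrow>
     ((int \<Rightarrow> real) \<Rightarrow> (real \<Rightarrow> complex) \<Rightarrow> int \<Rightarrow> complex) \<Rightarrow> (int \<Rightarrow> real) \<Rightarrow> bool" where
  "exact_on S a q P X \<longleftrightarrow>
     (\<forall>p :: complex poly. degree p \<le> q \<longrightarrow>
        (\<forall>j. trunc_error S a X (\<lambda>x. poly p (of_real x)) P j = 0))"

end

theory Submission
  imports Defs "HOL-Complex_Analysis.Complex_Analysis"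
begin

text \<open>
  On a mesh of period \<open>m\<close> the coefficients of the system are \<open>m\<close>-periodic in \<open>j\<close>, and on
  \<open>N\<close>-periodic sequences, \<open>N = m M\<close>, the system splits by a Fourier transform over \<open>M\<close> points
  into Bloch blocks: for \<open>\<phi> = 2 \<pi> l / N\<close> with \<open>\<bar>\<phi>\<bar> \<le> \<pi> / m\<close> an ODE for an \<open>m\<close>-periodic
  sequence with the operator \<open>L(\<i> \<phi>)\<close>, where \<open>L(z) w j = (\<Sum>k. b j k e\<^bsup>z k\<^esup> w (j + k))\<close>. The
  splitting is orthogonal, so it suffices to bound each block by \<open>K\<close>, with a closeness of \<open>b\<close>
  to the uniform coefficients that depends on \<open>m\<close> and \<open>K\<close> but not on \<open>M\<close> or \<open>\<phi>\<close>. For nearly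
  uniform meshes that closeness is just continuity of the coefficient functions at \<open>(1, \<dots>, 1)\<close>.

  In the basis of \<open>m\<close>-periodic exponentials the uniform operator is diagonal, with entries
  \<open>d\<^sub>s(z)\<close> equal to the symbol at \<open>z + 2 \<pi> \<i> s / m\<close>, and the mesh contributes a small matrix \<open>R\<close>.
  For \<open>\<bar>\<phi>\<bar> \<le> \<pi> / m\<close> and \<open>s \<noteq> 0\<close> the argument stays away from \<open>2 \<pi> \<i> \<int>\<close>, so by positivity of
  the symbol \<open>Re d\<^sub>s \<ge> \<delta> > 0\<close>. Away from \<open>\<phi> = 0\<close> also \<open>Re d\<^sub>0\<close> is bounded below, and the block
  is a contraction. Near \<open>\<phi> = 0\<close> only the branch \<open>s = 0\<close> is dangerous. It is a simple eigenvalue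
  \<open>\<mu>(z)\<close> of \<open>L(z)\<close> that is holomorphic on a disc independent of the mesh, with right and left
  eigenvectors close to the unit vector (\<open>perturbed_diagonal_eigenpair\<close>). If \<open>Re \<mu>(\<i> \<phi>) \<ge> 0\<close>,
  the flow splits into a scalar part and a part in the kernel of the left eigenvector, on which
  \<open>L\<close> is coercive; both have nonincreasing norm, and they are almost orthogonal, so the
  whole flow is bounded by a constant as close to \<open>1\<close> as desired (\<open>perturbed_diagonal_flow_bound\<close>).

  What remains is \<open>Re \<mu>(\<i> \<phi>) \<ge> 0\<close>, which perturbation theory alone cannot give, because the
  unperturbed value \<open>c \<phi>\<^bsup>\<kappa> + 1\<^esup> + \<dots>\<close> itself vanishes at \<open>0\<close>. Here exactness enters: pairing an
  approximate eigenvector, made from the moments of the local mapping, with the left eigenvector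
  gives \<open>\<mu>(z) = z + O(z\<^bsup>\<kappa>\<^esup>)\<close> (\<open>eigenvalue_consistent\<close>). The coefficients are real, so
  \<open>\<mu>(-\<i> \<phi>)\<close> is conjugate to \<open>\<mu>(\<i> \<phi>)\<close>, and \<open>Re \<mu>(\<i> \<phi>)\<close> is the value at \<open>\<i> \<phi>\<close> of the even
  holomorphic function \<open>(\<mu>(z) + \<mu>(-z)) / 2\<close>. Its difference from the uniform one is even, small
  on the disc, and of order \<open>\<phi>\<^bsup>\<kappa>\<^esup>\<close> on the imaginary axis. Since \<open>\<kappa>\<close> is odd, evenness raises the
  order to \<open>\<kappa> + 1\<close>, and the maximum principle bounds the difference by a small multiple of
  \<open>\<bar>z\<bar>\<^bsup>\<kappa> + 1\<^esup>\<close> (\<open>even_holomorphic_bound\<close>), which \<open>c \<phi>\<^bsup>\<kappa> + 1\<^esup>\<close> dominates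
  (\<open>Re_eigenvalue_nonneg\<close>).
\<close>


section \<open>Perturbation of a diagonal matrix\<close>

lemma geometric_Cauchy_uniform_limit:
  fixes X :: "nat \<Rightarrow> 'a \<Rightarrow> complex"
  assumes "\<And>n z. z \<in> U \<Longrightarrow> cmod (X (Suc n) z - X n z) \<le> (1/2)^n"
  obtains g where "uniform_limit U X g sequentially"
proof -
  have tele: "(\<Sum>i<n. X (Suc i) z - X i z) = X n z - X 0 z" for n z
    by (rule sum_lessThan_telescope)
  have "uniform_limit U (\<lambda>n z. \<Sum>i<n. X (Suc i) z - X i z)
          (\<lambda>z. \<Sum>i. X (Suc i) z - X i z) sequentially"
    by (rule Weierstrass_m_test[where M = "\<lambda>n. (1/2)^n"])
      (use assms in \<open>auto intro: summable_geometric\<close>)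
  then have "uniform_limit U (\<lambda>n z. X n z - X 0 z) (\<lambda>z. \<Sum>i. X (Suc i) z - X i z) sequentially"
    unfolding tele .
  then have "uniform_limit U (\<lambda>n z. (X n z - X 0 z) + X 0 z) (\<lambda>z. (\<Sum>i. X (Suc i) z - X i z) + X 0 z) sequentially"
    by (intro uniform_limit_intros)
  then have "uniform_limit U X (\<lambda>z. (\<Sum>i. X (Suc i) z - X i z) + X 0 z) sequentially"
    by simp
  then show thesis by (rule that)
qed

lemma norm_sum_mult_le:
  fixes r x :: "'i \<Rightarrow> complex"
  assumes "\<And>t. t \<in> I \<Longrightarrow> cmod (r t) \<le> \<epsilon>" "\<And>t. t \<in> I \<Longrightarrow> cmod (x t) \<le> B" "0 \<le> \<epsilon>"
  shows "cmod (\<Sum>t\<in>I. r t * x t) \<le> real (card I) * \<epsilon> * B"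
proof -
  have "cmod (\<Sum>t\<in>I. r t * x t) \<le> (\<Sum>t\<in>I. \<epsilon> * B)"
    by (rule sum_norm_le) (use assms in \<open>auto simp: norm_mult intro!: mult_mono\<close>)
  then show ?thesis by (simp add: mult.assoc)
qed

text \<open>
  With the normalisation \<open>x i0 = 1\<close> the row \<open>i0\<close> determines the eigenvalue, and the other
  rows become a fixed-point equation in which the perturbation is divided by the gaps
  \<open>d i0 - d s\<close>. The fixed-point map halves distances in the unit ball of the maximum norm,
  uniformly in \<open>z\<close>, so its iterates, which are holomorphic, converge uniformly. Working with
  functions of \<open>z\<close> from the start yields holomorphy on the whole of \<open>U\<close>; all bounds depend on
  \<open>\<gamma>\<close>, \<open>\<epsilon>\<close> and the size of \<open>I\<close> alone.
\<close>

lemma perturbed_diagonal_eigenpair: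
  fixes d :: "'i \<Rightarrow> complex \<Rightarrow> complex" and R :: "'i \<Rightarrow> 'i \<Rightarrow> complex \<Rightarrow> complex"
  assumes fin: "finite I" and i0: "i0 \<in> I" and U: "open U"
    and hd: "\<And>s. s \<in> I \<Longrightarrow> d s holomorphic_on U"
    and hR: "\<And>s t. s \<in> I \<Longrightarrow> t \<in> I \<Longrightarrow> R s t holomorphic_on U"
    and gap: "\<And>s z. s \<in> I - {i0} \<Longrightarrow> z \<in> U \<Longrightarrow> \<gamma> \<le> cmod (d i0 z - d s z)" and \<gamma>: "0 < \<gamma>"
    and RE: "\<And>s t z. s \<in> I \<Longrightarrow> t \<in> I \<Longrightarrow> z \<in> U \<Longrightarrow> cmod (R s t z) \<le> \<epsilon>" and \<epsilon>: "0 \<le> \<epsilon>"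
    and small: "6 * real (card I) * \<epsilon> \<le> \<gamma>"
  shows "\<exists>x \<mu>. (\<forall>s\<in>I. x s holomorphic_on U) \<and> \<mu> holomorphic_on U \<and> (\<forall>z\<in>U. x i0 z = 1) \<and>
    (\<forall>s\<in>I - {i0}. \<forall>z\<in>U. cmod (x s z) \<le> 2 * real (card I) * \<epsilon> / \<gamma>) \<and>
    (\<forall>z\<in>U. cmod (\<mu> z - d i0 z) \<le> real (card I) * \<epsilon>) \<and>
    (\<forall>s\<in>I. \<forall>z\<in>U. d s z * x s z + (\<Sum>t\<in>I. R s t z * x t z) = \<mu> z * x s z)"
proof -
  define n where "n = real (card I)"
  have n0: "0 \<le> n" by (simp add: n_def)
  have n\<epsilon>: "0 \<le> n * \<epsilon>" using n0 \<epsilon> by simp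
  \<comment> \<open>the value \<open>1\<close> at \<open>i0\<close> is kept by the map, so the normalisation needs no separate argument\<close>
  define T where "T = (\<lambda>(X :: 'i \<Rightarrow> complex \<Rightarrow> complex) s z. if s = i0 then 1 else
     ((\<Sum>t\<in>I. R s t z * X t z) - X s z * (\<Sum>t\<in>I. R i0 t z * X t z)) / (d i0 z - d s z))"
  define X where "X = (\<lambda>k. (T ^^ k) (\<lambda>s z. if s = i0 then 1 else 0))"
  have X0: "X 0 = (\<lambda>s z. if s = i0 then 1 else 0)" by (simp add: X_def)
  have XS: "X (Suc k) = T (X k)" for k by (simp add: X_def)
  have gap': "\<gamma> \<le> cmod (d i0 z - d s z)" if "s \<in> I" "s \<noteq> i0" "z \<in> U" for s z
    using gap that by auto
  have gapnz: "d i0 z - d s z \<noteq> 0" if "s \<in> I" "s \<noteq> i0" "z \<in> U" for s z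
    using gap'[OF that] \<gamma> by auto
  have Tbound: "cmod (T Y s z) \<le> 2 * n * \<epsilon> / \<gamma>"
    if Y: "\<And>s. s \<in> I \<Longrightarrow> cmod (Y s z) \<le> 1" and s: "s \<in> I" "s \<noteq> i0" and z: "z \<in> U" for Y s z
  proof -
    have 1: "cmod (\<Sum>t\<in>I. R s' t z * Y t z) \<le> n * \<epsilon> * 1" if "s' \<in> I" for s'
      unfolding n_def by (rule norm_sum_mult_le) (use RE Y z \<epsilon> that in auto)
    have 2: "cmod (Y s z * (\<Sum>t\<in>I. R i0 t z * Y t z)) \<le> 1 * (n * \<epsilon> * 1)"
      unfolding norm_mult by (rule mult_mono) (use Y s 1[OF i0] in auto)
    have "cmod ((\<Sum>t\<in>I. R s t z * Y t z) - Y s z * (\<Sum>t\<in>I. R i0 t z * Y t z)) \<le> 2 * n * \<epsilon>"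
      using norm_triangle_ineq4[of "\<Sum>t\<in>I. R s t z * Y t z" "Y s z * (\<Sum>t\<in>I. R i0 t z * Y t z)"]
        1[OF s(1)] 2 by simp
    then show ?thesis
      using s gap'[OF s z] \<gamma> n\<epsilon>
      by (auto simp: T_def norm_divide mult.commute intro!: frac_le)
  qed
  have small': "2 * n * \<epsilon> / \<gamma> \<le> 1"
    using small \<gamma> n\<epsilon> by (simp add: n_def field_simps)
  have Xle1: "\<forall>s\<in>I. \<forall>z\<in>U. cmod (X k s z) \<le> 1" for k
  proof (induction k)
    case 0 then show ?case by (simp add: X0)
  next
    case (Suc k)
    have "cmod (T (X k) s z) \<le> 1" if "s \<in> I" "z \<in> U" for s z
    proof (cases "s = i0")
      case True then show ?thesis by (simp add: T_def)
    next
      case False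
      then show ?thesis using Tbound[of "X k" z s] Suc that small' by fastforce
    qed
    then show ?case by (simp add: XS)
  qed
  have Tdiff: "cmod (T Y s z - T Z s z) \<le> D / 2"
    if Y: "\<And>s. s \<in> I \<Longrightarrow> cmod (Y s z) \<le> 1" and Z: "\<And>s. s \<in> I \<Longrightarrow> cmod (Z s z) \<le> 1"
      and D: "\<And>s. s \<in> I \<Longrightarrow> cmod (Y s z - Z s z) \<le> D" and s: "s \<in> I" and z: "z \<in> U" for Y Z s z D
  proof (cases "s = i0")
    case True
    have "0 \<le> D" using D[OF s] norm_ge_zero order_trans by blast
    then show ?thesis by (simp add: T_def True)
  next
    case False
    have D0: "0 \<le> D" using D[OF s] norm_ge_zero order_trans by blast
    define A where "A = (\<lambda>s' (Y :: 'i \<Rightarrow> complex \<Rightarrow> complex). \<Sum>t\<in>I. R s' t z * Y t z)"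
    have A1: "cmod (A s' Y) \<le> n * \<epsilon> * 1" if "s' \<in> I" for s'
      unfolding n_def A_def by (rule norm_sum_mult_le) (use RE Y z \<epsilon> that in auto)
    have Ad: "cmod (A s' Y - A s' Z) \<le> n * \<epsilon> * D" if "s' \<in> I" for s'
    proof -
      have "A s' Y - A s' Z = (\<Sum>t\<in>I. R s' t z * (Y t z - Z t z))"
        by (simp add: A_def sum_subtractf algebra_simps)
      then show ?thesis
        unfolding n_def using norm_sum_mult_le[of I "\<lambda>t. R s' t z" \<epsilon> "\<lambda>t. Y t z - Z t z" D] RE D z \<epsilon> that
        by auto
    qed
    have e: "(A s Y - Y s z * A i0 Y) - (A s Z - Z s z * A i0 Z)
      = (A s Y - A s Z) - ((Y s z - Z s z) * A i0 Y + Z s z * (A i0 Y - A i0 Z))"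
      by (simp add: algebra_simps)
    have b1: "cmod ((Y s z - Z s z) * A i0 Y) \<le> D * (n * \<epsilon> * 1)"
      unfolding norm_mult by (rule mult_mono) (use D[OF s] A1[OF i0] D0 in auto)
    have b2: "cmod (Z s z * (A i0 Y - A i0 Z)) \<le> 1 * (n * \<epsilon> * D)"
      unfolding norm_mult by (rule mult_mono) (use Z[OF s] Ad[OF i0] in auto)
    have "cmod ((A s Y - Y s z * A i0 Y) - (A s Z - Z s z * A i0 Z)) \<le> 3 * n * \<epsilon> * D"
      unfolding e
      using norm_triangle_ineq4[of "A s Y - A s Z" "(Y s z - Z s z) * A i0 Y + Z s z * (A i0 Y - A i0 Z)"]
        norm_triangle_ineq[of "(Y s z - Z s z) * A i0 Y" "Z s z * (A i0 Y - A i0 Z)"] b1 b2 Ad[OF s]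
      by (simp add: algebra_simps)
    moreover have "T Y s z - T Z s z =
        ((A s Y - Y s z * A i0 Y) - (A s Z - Z s z * A i0 Z)) / (d i0 z - d s z)"
      by (simp add: T_def A_def False diff_divide_distrib)
    ultimately have "cmod (T Y s z - T Z s z) \<le> (3 * n * \<epsilon> * D) / \<gamma>"
      using gap'[OF s False z] \<gamma> n0 \<epsilon> D0 by (auto simp: norm_divide intro!: frac_le mult_nonneg_nonneg)
    also have "\<dots> \<le> D / 2"
      using mult_right_mono[OF small D0] \<gamma> by (simp add: n_def field_simps)
    finally show ?thesis .
  qed
  have step: "\<forall>s\<in>I. \<forall>z\<in>U. cmod (X (Suc k) s z - X k s z) \<le> (1/2)^k" for k
  proof (induction k)
    case 0
    have "cmod (T (X 0) s z - X 0 s z) \<le> 1" if "s \<in> I" "z \<in> U" for s z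
    proof (cases "s = i0")
      case True then show ?thesis by (simp add: T_def X0)
    next
      case False
      have "cmod (T (X 0) s z) \<le> 2 * n * \<epsilon> / \<gamma>" by (rule Tbound) (use Xle1 that False in auto)
      then show ?thesis using small' False by (simp add: X0)
    qed
    then show ?case by (simp add: XS)
  next
    case (Suc k)
    have "cmod (T (X (Suc k)) s z - T (X k) s z) \<le> (1/2)^k / 2" if "s \<in> I" "z \<in> U" for s z
      by (rule Tdiff) (use Xle1 Suc that in auto)
    then show ?case by (simp add: XS)
  qed
  have "\<exists>g. uniform_limit U (\<lambda>k. X k s) g sequentially" if "s \<in> I" for s
    using geometric_Cauchy_uniform_limit[of U "\<lambda>k. X k s"] step that by blast
  then obtain x where x: "\<And>s. s \<in> I \<Longrightarrow> uniform_limit U (\<lambda>k. X k s) (x s) sequentially"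
    by metis
  have lim: "(\<lambda>k. X k s z) \<longlonglongrightarrow> x s z" if "s \<in> I" "z \<in> U" for s z
    using tendsto_uniform_limitI[OF x[OF that(1)] that(2)] .
  have hX: "X k s holomorphic_on U" if "s \<in> I" for k s
    using that
  proof (induction k arbitrary: s)
    case 0 then show ?case by (simp add: X0)
  next
    case (Suc k)
    show ?case
    proof (cases "s = i0")
      case True then show ?thesis by (simp add: XS T_def)
    next
      case False
      have "(\<lambda>z. ((\<Sum>t\<in>I. R s t z * X k t z) - X k s z * (\<Sum>t\<in>I. R i0 t z * X k t z))
              / (d i0 z - d s z)) holomorphic_on U"
        by (intro holomorphic_intros hd hR Suc gapnz i0 False) (use Suc.prems in auto)
      then show ?thesis by (simp add: XS T_def False)
    qed
  qed
  have hx: "x s holomorphic_on U" if "s \<in> I" for s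
  proof (rule holomorphic_uniform_sequence[OF U hX[OF that]])
    fix z assume "z \<in> U"
    then obtain e where "0 < e" "cball z e \<subseteq> U" using U open_contains_cball by blast
    then show "\<exists>e>0. cball z e \<subseteq> U \<and> uniform_limit (cball z e) (\<lambda>k. X k s) (x s) sequentially"
      using uniform_limit_on_subset[OF x[OF that]] by blast
  qed
  define \<mu> where "\<mu> = (\<lambda>z. d i0 z + (\<Sum>t\<in>I. R i0 t z * x t z))"
  have x1: "x i0 z = 1" if "z \<in> U" for z
  proof (rule LIMSEQ_unique[OF lim[OF i0 that]])
    have "X k i0 z = 1" for k by (cases k) (simp_all add: X0 XS T_def)
    then show "(\<lambda>k. X k i0 z) \<longlonglongrightarrow> 1" by simp
  qed
  have fixp: "x s z = T x s z" if "s \<in> I" "z \<in> U" for s z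
  proof (cases "s = i0")
    case True then show ?thesis using x1 that by (simp add: T_def)
  next
    case False
    have "(\<lambda>k. T (X k) s z) \<longlonglongrightarrow> T x s z"
      unfolding T_def using False gapnz[OF that(1) False that(2)] lim that i0
      by (auto intro!: tendsto_intros)
    moreover have "(\<lambda>k. T (X k) s z) \<longlonglongrightarrow> x s z"
      using LIMSEQ_Suc[OF lim[OF that]] by (simp add: XS)
    ultimately show ?thesis by (rule LIMSEQ_unique[symmetric])
  qed
  have xle: "cmod (x s z) \<le> 1" if "s \<in> I" "z \<in> U" for s z
    by (rule Lim_bounded[OF tendsto_norm[OF lim[OF that]], of 0]) (use Xle1 that in auto)
  show ?thesis
  proof (intro exI[of _ x] exI[of _ \<mu>] conjI ballI)
    show "\<mu> holomorphic_on U" unfolding \<mu>_def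
      by (intro holomorphic_intros hd hR hx i0)
    show "cmod (x s z) \<le> 2 * real (card I) * \<epsilon> / \<gamma>" if "s \<in> I - {i0}" "z \<in> U" for s z
      using Tbound[of x z s] fixp[of s z] xle that unfolding n_def by auto
    show "cmod (\<mu> z - d i0 z) \<le> real (card I) * \<epsilon>" if "z \<in> U" for z
      using norm_sum_mult_le[of I "\<lambda>t. R i0 t z" \<epsilon> "\<lambda>t. x t z" 1] RE xle that i0 \<epsilon>
      by (simp add: \<mu>_def)
    show "d s z * x s z + (\<Sum>t\<in>I. R s t z * x t z) = \<mu> z * x s z" if "s \<in> I" "z \<in> U" for s z
    proof (cases "s = i0")
      case True then show ?thesis using x1 that by (simp add: \<mu>_def)
    next
      case False
      have "x s z * (d i0 z - d s z) = (\<Sum>t\<in>I. R s t z * x t z) - x s z * (\<Sum>t\<in>I. R i0 t z * x t z)"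
        using fixp[OF that] False gapnz[OF that(1) False that(2)] by (simp add: T_def nonzero_eq_divide_eq)
      then show ?thesis by (simp add: \<mu>_def algebra_simps)
    qed
  qed (use hx x1 in auto)
qed

lemma Re_quadratic_form_perturbed_diagonal:
  fixes d :: "'i \<Rightarrow> complex" and R :: "'i \<Rightarrow> 'i \<Rightarrow> complex"
  assumes fin: "finite I" and RE: "\<And>s t. s \<in> I \<Longrightarrow> t \<in> I \<Longrightarrow> cmod (R s t) \<le> \<epsilon>"
  shows "(\<Sum>s\<in>I. Re (d s) * (cmod (v s))\<^sup>2) - real (card I) * \<epsilon> * (\<Sum>s\<in>I. (cmod (v s))\<^sup>2)
    \<le> Re (\<Sum>s\<in>I. cnj (v s) * (d s * v s + (\<Sum>t\<in>I. R s t * v t)))"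
proof (cases "I = {}")
  case False
  then obtain s0 where "s0 \<in> I" by auto
  then have \<epsilon>: "0 \<le> \<epsilon>" using RE[of s0 s0] norm_ge_zero order_trans by blast
  have "cmod (\<Sum>s\<in>I. \<Sum>t\<in>I. cnj (v s) * (R s t * v t)) \<le> (\<Sum>s\<in>I. \<Sum>t\<in>I. cmod (v s) * (\<epsilon> * cmod (v t)))"
    by (intro sum_norm_le) (auto simp: norm_mult intro!: mult_left_mono mult_right_mono RE)
  also have "\<dots> = \<epsilon> * (\<Sum>s\<in>I. cmod (v s))\<^sup>2"
    by (simp add: power2_eq_square sum_product sum_distrib_left algebra_simps)
  also have "\<dots> \<le> \<epsilon> * ((\<Sum>s\<in>I. (cmod (v s))\<^sup>2) * card I)"
    by (intro mult_left_mono sum_squared_le_sum_of_squares \<epsilon>)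
  finally have b: "- Re (\<Sum>s\<in>I. \<Sum>t\<in>I. cnj (v s) * (R s t * v t)) \<le> real (card I) * \<epsilon> * (\<Sum>s\<in>I. (cmod (v s))\<^sup>2)"
    using abs_Re_le_cmod[of "\<Sum>s\<in>I. \<Sum>t\<in>I. cnj (v s) * (R s t * v t)"] by (simp add: algebra_simps)
  have "Re (cnj (v s) * (d s * v s)) = Re (d s) * (cmod (v s))\<^sup>2" for s
    unfolding cmod_power2 by (simp add: algebra_simps power2_eq_square)
  then have "Re (\<Sum>s\<in>I. cnj (v s) * (d s * v s)) = (\<Sum>s\<in>I. Re (d s) * (cmod (v s))\<^sup>2)"
    by (simp only: Re_sum)
  moreover have "(\<Sum>s\<in>I. cnj (v s) * (d s * v s + (\<Sum>t\<in>I. R s t * v t)))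
     = (\<Sum>s\<in>I. cnj (v s) * (d s * v s)) + (\<Sum>s\<in>I. \<Sum>t\<in>I. cnj (v s) * (R s t * v t))"
    by (simp add: distrib_left sum.distrib sum_distrib_left)
  ultimately show ?thesis using b by simp
qed simp

text \<open>
  On the kernel of a functional that is close to the coordinate \<open>i0\<close>, this coordinate is
  slaved to the others.
\<close>

lemma sum_eq_zero_component_le:
  fixes y v :: "'i \<Rightarrow> complex"
  assumes fin: "finite I" and i0: "i0 \<in> I" and y0: "y i0 = 1"
    and y: "\<And>s. s \<in> I - {i0} \<Longrightarrow> cmod (y s) \<le> \<eta>" and \<eta>: "0 \<le> \<eta>"
    and ker: "(\<Sum>s\<in>I. y s * v s) = 0"
  shows "(cmod (v i0))\<^sup>2 \<le> \<eta>\<^sup>2 * real (card I) * (\<Sum>s\<in>I-{i0}. (cmod (v s))\<^sup>2)"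
proof -
  have "v i0 = - (\<Sum>s\<in>I-{i0}. y s * v s)"
    using ker by (simp add: sum.remove[OF fin i0] y0 eq_neg_iff_add_eq_0)
  then have "cmod (v i0) \<le> (\<Sum>s\<in>I-{i0}. \<eta> * cmod (v s))"
    by (auto simp: norm_mult intro!: sum_norm_le mult_right_mono y)
  then have "(cmod (v i0))\<^sup>2 \<le> (\<eta> * (\<Sum>s\<in>I-{i0}. cmod (v s)))\<^sup>2"
    by (intro power_mono) (simp_all add: sum_distrib_left)
  also have "\<dots> \<le> \<eta>\<^sup>2 * ((\<Sum>s\<in>I-{i0}. (cmod (v s))\<^sup>2) * card (I - {i0}))"
    unfolding power_mult_distrib by (intro mult_left_mono sum_squared_le_sum_of_squares) simp
  also have "\<dots> \<le> \<eta>\<^sup>2 * ((\<Sum>s\<in>I-{i0}. (cmod (v s))\<^sup>2) * card I)"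
    by (intro mult_left_mono) (auto simp: fin card_mono sum_nonneg intro!: mult_left_mono card_mono)
  finally show ?thesis by (simp add: algebra_simps)
qed

text \<open>
  The diagonal part can lose coercivity only in the direction \<open>i0\<close>, and vectors in the
  kernel of \<open>y\<close> have at most half of their norm square there. So half of \<open>\<delta>\<close> survives, and the
  perturbation costs at most half of what is left.
\<close>

lemma Re_quadratic_form_on_kernel:
  fixes d :: "'i \<Rightarrow> complex" and R :: "'i \<Rightarrow> 'i \<Rightarrow> complex"
  assumes fin: "finite I" and i0: "i0 \<in> I"
    and RE: "\<And>s t. s \<in> I \<Longrightarrow> t \<in> I \<Longrightarrow> cmod (R s t) \<le> \<epsilon>"
    and d0: "0 \<le> Re (d i0)" and d: "\<And>s. s \<in> I - {i0} \<Longrightarrow> \<delta> \<le> Re (d s)" and \<delta>: "0 < \<delta>"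
    and \<epsilon>: "4 * real (card I) * \<epsilon> \<le> \<delta>"
    and y0: "y i0 = 1" and y: "\<And>s. s \<in> I - {i0} \<Longrightarrow> cmod (y s) \<le> \<eta>" and \<eta>: "0 \<le> \<eta>"
    and \<eta>1: "\<eta>\<^sup>2 * real (card I) \<le> 1"
    and ker: "(\<Sum>s\<in>I. y s * v s) = 0"
  shows "\<delta> / 4 * (\<Sum>s\<in>I. (cmod (v s))\<^sup>2)
    \<le> Re (\<Sum>s\<in>I. cnj (v s) * (d s * v s + (\<Sum>t\<in>I. R s t * v t)))"
proof -
  define Q where "Q = (\<Sum>s\<in>I-{i0}. (cmod (v s))\<^sup>2)"
  define V where "V = (\<Sum>s\<in>I. (cmod (v s))\<^sup>2)"
  have Q0: "0 \<le> Q" by (simp add: Q_def sum_nonneg)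
  have V: "V = (cmod (v i0))\<^sup>2 + Q" by (simp add: V_def Q_def sum.remove[OF fin i0])
  have "(cmod (v i0))\<^sup>2 \<le> \<eta>\<^sup>2 * real (card I) * Q"
    unfolding Q_def by (rule sum_eq_zero_component_le[OF fin i0 y0 y \<eta> ker])
  also have "\<dots> \<le> 1 * Q" by (rule mult_right_mono[OF \<eta>1 Q0])
  finally have V2: "V \<le> 2 * Q" using V by simp
  have "\<delta> * Q \<le> (\<Sum>s\<in>I-{i0}. Re (d s) * (cmod (v s))\<^sup>2)"
    unfolding Q_def sum_distrib_left by (intro sum_mono mult_right_mono d) auto
  also have "\<dots> \<le> (\<Sum>s\<in>I. Re (d s) * (cmod (v s))\<^sup>2)"
    using d0 by (simp add: sum.remove[OF fin i0])
  finally have 1: "\<delta> * Q \<le> (\<Sum>s\<in>I. Re (d s) * (cmod (v s))\<^sup>2)" .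
  have "real (card I) * \<epsilon> * V \<le> \<delta> / 4 * V"
    using \<epsilon> V Q0 by (intro mult_right_mono) auto
  moreover have "\<delta> * V \<le> \<delta> * (2 * Q)" using V2 \<delta> by (intro mult_left_mono) auto
  ultimately have "\<delta> / 4 * V \<le> \<delta> * Q - real (card I) * \<epsilon> * V" by (simp add: field_simps)
  then show ?thesis
    using 1 Re_quadratic_form_perturbed_diagonal[of I R \<epsilon> d v, OF fin RE]
    unfolding V_def by linarith
qed

lemma nonincreasing_of_nonpos_derivative_within:
  fixes f f' :: "real \<Rightarrow> real"
  assumes "\<And>t. t \<ge> 0 \<Longrightarrow> (f has_vector_derivative f' t) (at t within {0..})"
    and "\<And>t. t \<ge> 0 \<Longrightarrow> f' t \<le> 0" and "t \<ge> 0"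
  shows "f t \<le> f 0"
proof (rule DERIV_nonpos_imp_decreasing_open[of 0 t])
  show "\<exists>y. (f has_real_derivative y) (at x) \<and> y \<le> 0" if "0 < x" "x < t" for x
  proof -
    have "at x within {0..} = at x" using that by (intro at_within_interior) (auto simp: interior_Ici)
    then show ?thesis using assms(1)[of x] assms(2)[of x] that
      by (auto simp: has_real_derivative_iff_has_vector_derivative)
  qed
  have "continuous_on {0..} f"
    using assms(1) by (auto simp: continuous_on_eq_continuous_within intro: has_vector_derivative_continuous)
  then show "continuous_on {0..t} f" by (rule continuous_on_subset) auto
qed (fact assms)

lemma energy_nonincreasing:
  fixes v w :: "real \<Rightarrow> 'i \<Rightarrow> complex"
  assumes v: "\<And>s t. s \<in> I \<Longrightarrow> t \<ge> 0 \<Longrightarrow> ((\<lambda>t. v t s) has_vector_derivative (- (of_real \<tau> * w t s))) (at t within {0..})"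
    and pos: "\<And>t. t \<ge> 0 \<Longrightarrow> 0 \<le> Re (\<Sum>s\<in>I. cnj (v t s) * w t s)" and \<tau>: "\<tau> \<ge> 0" and t: "t \<ge> 0"
  shows "(\<Sum>s\<in>I. (cmod (v t s))\<^sup>2) \<le> (\<Sum>s\<in>I. (cmod (v 0 s))\<^sup>2)"
proof (rule nonincreasing_of_nonpos_derivative_within[OF _ _ t])
  fix t :: real assume t: "t \<ge> 0"
  have D: "((\<lambda>t. (cmod (v t s))\<^sup>2) has_vector_derivative (- 2 * \<tau> * Re (cnj (v t s) * w t s)))
           (at t within {0..})" if s: "s \<in> I" for s
  proof -
    note d = v[OF s t]
    have Re: "((\<lambda>t. Re (v t s)) has_vector_derivative Re (- (of_real \<tau> * w t s))) (at t within {0..})"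
      using bounded_linear.has_vector_derivative[OF bounded_linear_Re d] by simp
    have Im: "((\<lambda>t. Im (v t s)) has_vector_derivative Im (- (of_real \<tau> * w t s))) (at t within {0..})"
      using bounded_linear.has_vector_derivative[OF bounded_linear_Im d] by simp
    have "((\<lambda>t. Re (v t s) * Re (v t s) + Im (v t s) * Im (v t s)) has_vector_derivative
       (Re (v t s) * Re (- (of_real \<tau> * w t s)) + Re (- (of_real \<tau> * w t s)) * Re (v t s)) +
       (Im (v t s) * Im (- (of_real \<tau> * w t s)) + Im (- (of_real \<tau> * w t s)) * Im (v t s))) (at t within {0..})"
      by (intro has_vector_derivative_add has_vector_derivative_mult Re Im)
    then show ?thesis
      unfolding cmod_power2 by (simp add: power2_eq_square algebra_simps)
  qed
  have "((\<lambda>t. \<Sum>s\<in>I. (cmod (v t s))\<^sup>2) has_vector_derivative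
     (\<Sum>s\<in>I. - 2 * \<tau> * Re (cnj (v t s) * w t s))) (at t within {0..})"
    by (intro has_vector_derivative_sum D)
  then show "((\<lambda>t. \<Sum>s\<in>I. (cmod (v t s))\<^sup>2) has_vector_derivative
     - 2 * \<tau> * Re (\<Sum>s\<in>I. cnj (v t s) * w t s)) (at t within {0..})"
    by (simp add: sum_distrib_left Re_sum)
  show "- 2 * \<tau> * Re (\<Sum>s\<in>I. cnj (v t s) * w t s) \<le> 0"
    using mult_nonneg_nonneg[OF \<tau> pos[OF t]] by simp
qed

text \<open>
  The triangle inequality would compare the norm of \<open>\<alpha> x + v\<close> with those of its parts only
  up to a factor like \<open>sqrt 2\<close>, which is useless for constants near \<open>1\<close>. But \<open>x\<close> is almost the unit
  vector \<open>i0\<close>, and \<open>v\<close> has almost no component there, so Pythagoras holds up to the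
  relative error \<open>\<zeta>\<close>.
\<close>

lemma near_orthogonal_splitting:
  fixes x y v :: "'i \<Rightarrow> complex" and \<alpha> :: complex
  assumes fin: "finite I" and i0: "i0 \<in> I" and x0: "x i0 = 1" and y0: "y i0 = 1"
    and x: "\<And>s. s \<in> I - {i0} \<Longrightarrow> cmod (x s) \<le> \<eta>" and y: "\<And>s. s \<in> I - {i0} \<Longrightarrow> cmod (y s) \<le> \<eta>"
    and \<eta>: "0 \<le> \<eta>" and ker: "(\<Sum>s\<in>I. y s * v s) = 0"
  defines "W \<equiv> (cmod \<alpha>)\<^sup>2 * (\<Sum>s\<in>I. (cmod (x s))\<^sup>2) + (\<Sum>s\<in>I. (cmod (v s))\<^sup>2)"
    and "\<zeta> \<equiv> 2 * \<eta> * sqrt (real (card I))"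
  shows "\<bar>(\<Sum>s\<in>I. (cmod (\<alpha> * x s + v s))\<^sup>2) - W\<bar> \<le> \<zeta> * W"
proof -
  define c where "c = real (card I)"
  have c0: "0 \<le> c" by (simp add: c_def)
  define Q where "Q = (\<Sum>s\<in>I-{i0}. (cmod (v s))\<^sup>2)"
  define V where "V = (\<Sum>s\<in>I. (cmod (v s))\<^sup>2)"
  have V: "V = (cmod (v i0))\<^sup>2 + Q" by (simp add: V_def Q_def sum.remove[OF fin i0])
  have Q0: "0 \<le> Q" by (simp add: Q_def sum_nonneg)
  have QV: "Q \<le> V" using V by simp
  have V0: "0 \<le> V" using V Q0 by simp
  define q where "q = (\<Sum>s\<in>I-{i0}. cmod (v s))"
  have q0: "0 \<le> q" by (simp add: q_def sum_nonneg)
  have "q\<^sup>2 \<le> Q * card (I - {i0})" unfolding q_def Q_def by (rule sum_squared_le_sum_of_squares)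
  also have "\<dots> \<le> V * c"
    by (intro mult_mono QV) (auto simp: c_def fin card_mono V0)
  finally have "q \<le> sqrt (V * c)" using real_le_rsqrt by blast
  then have q: "q \<le> sqrt c * sqrt V" by (simp add: real_sqrt_mult mult.commute)
  have v0: "cmod (v i0) \<le> \<eta> * q"
  proof -
    have "v i0 = - (\<Sum>s\<in>I-{i0}. y s * v s)"
      using ker by (simp add: sum.remove[OF fin i0] y0 eq_neg_iff_add_eq_0)
    then show ?thesis unfolding q_def sum_distrib_left
      by (auto simp: norm_mult intro!: sum_norm_le mult_right_mono y)
  qed
  have "cmod (\<Sum>s\<in>I-{i0}. x s * cnj (v s)) \<le> \<eta> * q"
    unfolding q_def sum_distrib_left by (auto simp: norm_mult intro!: sum_norm_le mult_right_mono x)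
  then have xv: "cmod (\<Sum>s\<in>I. x s * cnj (v s)) \<le> 2 * \<eta> * q"
    using v0 norm_triangle_ineq[of "cnj (v i0)" "\<Sum>s\<in>I-{i0}. x s * cnj (v s)"]
    by (simp add: sum.remove[OF fin i0] x0)
  define P where "P = (\<Sum>s\<in>I. (cmod (x s))\<^sup>2)"
  have P1: "1 \<le> P" by (simp add: P_def sum.remove[OF fin i0] x0 sum_nonneg)
  have e: "(cmod (\<alpha> * x s + v s))\<^sup>2 = (cmod \<alpha>)\<^sup>2 * (cmod (x s))\<^sup>2 + (cmod (v s))\<^sup>2 + 2 * Re (\<alpha> * (x s * cnj (v s)))" for s
    unfolding cmod_power2 by (simp add: power2_eq_square algebra_simps)
  have "(\<Sum>s\<in>I. (cmod (\<alpha> * x s + v s))\<^sup>2) - W = 2 * Re (\<alpha> * (\<Sum>s\<in>I. x s * cnj (v s)))"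
    unfolding e W_def by (simp add: sum.distrib sum_distrib_left Re_sum)
  also have "\<bar>\<dots>\<bar> \<le> 2 * (cmod \<alpha> * (2 * \<eta> * q))"
    using abs_Re_le_cmod[of "\<alpha> * (\<Sum>s\<in>I. x s * cnj (v s))"] mult_left_mono[OF xv norm_ge_zero[of \<alpha>]]
    by (simp add: norm_mult)
  also have "\<dots> \<le> 2 * (cmod \<alpha> * (2 * \<eta> * (sqrt c * sqrt V)))"
    by (intro mult_left_mono q) (use \<eta> in auto)
  also have "\<dots> = \<zeta> * (2 * cmod \<alpha> * sqrt V)" by (simp add: \<zeta>_def c_def)
  also have "\<dots> \<le> \<zeta> * W"
  proof (rule mult_left_mono)
    have "2 * cmod \<alpha> * sqrt V \<le> (cmod \<alpha>)\<^sup>2 + (sqrt V)\<^sup>2" by (rule sum_squares_bound)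
    also have "\<dots> \<le> W"
      using mult_left_mono[OF P1, of "(cmod \<alpha>)\<^sup>2"] V0 by (simp add: W_def P_def[symmetric] V_def[symmetric])
    finally show "2 * cmod \<alpha> * sqrt V \<le> W" .
    show "0 \<le> \<zeta>" using \<eta> by (simp add: \<zeta>_def)
  qed
  finally show ?thesis .
qed

lemma left_eigenvector_pairing:
  fixes d :: "'i \<Rightarrow> complex" and R :: "'i \<Rightarrow> 'i \<Rightarrow> complex"
  assumes left: "\<And>t. t \<in> I \<Longrightarrow> d t * y t + (\<Sum>s\<in>I. R s t * y s) = \<mu> * y t"
  shows "(\<Sum>s\<in>I. y s * (d s * v s + (\<Sum>t\<in>I. R s t * v t))) = \<mu> * (\<Sum>s\<in>I. y s * v s)"
proof -
  have "(\<Sum>s\<in>I. y s * (\<Sum>t\<in>I. R s t * v t)) = (\<Sum>t\<in>I. (\<Sum>s\<in>I. R s t * y s) * v t)"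
    unfolding sum_distrib_left sum_distrib_right by (subst sum.swap) (simp add: algebra_simps)
  then have "(\<Sum>s\<in>I. y s * (d s * v s + (\<Sum>t\<in>I. R s t * v t)))
     = (\<Sum>t\<in>I. (d t * y t + (\<Sum>s\<in>I. R s t * y s)) * v t)"
    by (simp add: distrib_left distrib_right sum.distrib algebra_simps)
  also have "\<dots> = (\<Sum>t\<in>I. \<mu> * (y t * v t))"
    by (rule sum.cong) (simp_all add: left)
  finally show ?thesis by (simp add: sum_distrib_left)
qed

text \<open>
  Both vectors are close to the unit vector \<open>i0\<close>.
\<close>

lemma eigenvector_pairing_nonzero:
  fixes x y :: "'i \<Rightarrow> complex"
  assumes fin: "finite I" and i0: "i0 \<in> I" and x0: "x i0 = 1" and y0: "y i0 = 1"
    and x: "\<And>s. s \<in> I - {i0} \<Longrightarrow> cmod (x s) \<le> \<eta>" and y: "\<And>s. s \<in> I - {i0} \<Longrightarrow> cmod (y s) \<le> \<eta>"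
    and \<eta>: "0 \<le> \<eta>" and \<eta>1: "\<eta>\<^sup>2 * real (card I) < 1"
  shows "(\<Sum>s\<in>I. y s * x s) \<noteq> 0"
proof
  assume "(\<Sum>s\<in>I. y s * x s) = 0"
  then have "(\<Sum>s\<in>I-{i0}. y s * x s) = -1"
    by (simp add: sum.remove[OF fin i0] x0 y0 eq_neg_iff_add_eq_0 add.commute)
  then have "1 \<le> cmod (\<Sum>s\<in>I-{i0}. y s * x s)" by simp
  also have "\<dots> \<le> (\<Sum>s\<in>I-{i0}. \<eta> * \<eta>)"
    by (intro sum_norm_le) (auto simp: norm_mult intro!: mult_mono x y \<eta>)
  also have "\<dots> \<le> \<eta>\<^sup>2 * real (card I)"
    using fin by (simp add: power2_eq_square mult.commute mult_left_mono card_Diff_subset i0)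
  finally show False using \<eta>1 by simp
qed

text \<open>
  Split \<open>v = \<alpha> x + u\<close> with \<open>u\<close> in the kernel of the left eigenvector \<open>y\<close>. Both parts evolve
  independently: \<open>\<alpha>\<close> by the scalar equation with \<open>\<mu>\<close>, and \<open>u\<close> by the full system, which
  preserves the kernel and is dissipative on it. So the sum \<open>W\<close> of the squared norms of the
  two parts does not grow, and \<open>near_orthogonal_splitting\<close> compares it with the norm of \<open>v\<close>.
\<close>

lemma perturbed_diagonal_flow_bound:
  fixes d :: "'i \<Rightarrow> complex" and R :: "'i \<Rightarrow> 'i \<Rightarrow> complex" and v :: "real \<Rightarrow> 'i \<Rightarrow> complex"
  assumes fin: "finite I" and i0: "i0 \<in> I" and x0: "x i0 = 1" and y0: "y i0 = 1"
    and x: "\<And>s. s \<in> I - {i0} \<Longrightarrow> cmod (x s) \<le> \<eta>" and y: "\<And>s. s \<in> I - {i0} \<Longrightarrow> cmod (y s) \<le> \<eta>"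
    and \<eta>: "0 \<le> \<eta>" and \<eta>1: "\<eta>\<^sup>2 * real (card I) < 1"
    and right: "\<And>s. s \<in> I \<Longrightarrow> d s * x s + (\<Sum>t\<in>I. R s t * x t) = \<mu> * x s"
    and left: "\<And>t. t \<in> I \<Longrightarrow> d t * y t + (\<Sum>s\<in>I. R s t * y s) = \<mu> * y t"
    and \<mu>: "0 \<le> Re \<mu>"
    and coercive: "\<And>w. (\<Sum>s\<in>I. y s * w s) = 0 \<Longrightarrow>
       0 \<le> Re (\<Sum>s\<in>I. cnj (w s) * (d s * w s + (\<Sum>t\<in>I. R s t * w t)))"
    and ode: "\<And>s t. s \<in> I \<Longrightarrow> t \<ge> 0 \<Longrightarrow> ((\<lambda>t. v t s) has_vector_derivative
         (- (of_real \<tau> * (d s * v t s + (\<Sum>r\<in>I. R s r * v t r))))) (at t within {0..})"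
    and \<tau>: "0 \<le> \<tau>" and t: "0 \<le> t"
  defines "\<zeta> \<equiv> 2 * \<eta> * sqrt (real (card I))"
  assumes K: "1 + \<zeta> \<le> K\<^sup>2 * (1 - \<zeta>)"
  shows "(\<Sum>s\<in>I. (cmod (v t s))\<^sup>2) \<le> K\<^sup>2 * (\<Sum>s\<in>I. (cmod (v 0 s))\<^sup>2)"
proof -
  define p where "p = (\<Sum>s\<in>I. y s * x s)"
  have p: "p \<noteq> 0" unfolding p_def 
    by (rule eigenvector_pairing_nonzero[of I i0 x y \<eta>, OF fin i0 x0 y0 x y \<eta> \<eta>1])
  define A where "A = (\<lambda>w s. d s * w s + (\<Sum>r\<in>I. R s r * w r))"
  define \<alpha> where "\<alpha> = (\<lambda>t. (\<Sum>s\<in>I. y s * v t s) / p)"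
  define u where "u = (\<lambda>t s. v t s - \<alpha> t * x s)"
  have D\<alpha>: "(\<alpha> has_vector_derivative - (of_real \<tau> * (\<mu> * \<alpha> t))) (at t within {0..})" if "t \<ge> 0" for t
  proof -
    have "(\<alpha> has_vector_derivative (\<Sum>s\<in>I. y s * (- (of_real \<tau> * A (v t) s))) / p) (at t within {0..})"
      unfolding \<alpha>_def A_def
      by (intro has_vector_derivative_divide has_vector_derivative_sum has_vector_derivative_mult_right ode that)
    moreover have "(\<Sum>s\<in>I. y s * (- (of_real \<tau> * A (v t) s))) = - of_real \<tau> * (\<Sum>s\<in>I. y s * A (v t) s)"
      by (simp add: sum_distrib_left sum_negf algebra_simps)
    moreover have "(\<Sum>s\<in>I. y s * A (v t) s) = \<mu> * (\<Sum>s\<in>I. y s * v t s)"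
      unfolding A_def by (rule left_eigenvector_pairing[OF left])
    ultimately show ?thesis by (simp add: \<alpha>_def)
  qed
  have Du: "((\<lambda>t. u t s) has_vector_derivative - (of_real \<tau> * A (u t) s)) (at t within {0..})"
    if "s \<in> I" "t \<ge> 0" for s t
  proof -
    have D: "((\<lambda>t. u t s) has_vector_derivative - (of_real \<tau> * A (v t) s) - (- (of_real \<tau> * (\<mu> * \<alpha> t))) * x s)
       (at t within {0..})"
      unfolding u_def A_def
      by (intro has_vector_derivative_diff has_vector_derivative_mult_left ode D\<alpha> that)
    have "A (u t) s = A (v t) s - \<alpha> t * A x s"
      by (simp add: A_def u_def algebra_simps sum_subtractf sum_distrib_left)
    moreover have "A x s = \<mu> * x s" using right[OF that(1)] by (simp add: A_def)
    ultimately have "A (v t) s = A (u t) s + \<mu> * (\<alpha> t * x s)" by simp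
    then have "- (of_real \<tau> * A (v t) s) - (- (of_real \<tau> * (\<mu> * \<alpha> t))) * x s = - (of_real \<tau> * A (u t) s)"
      by (simp add: algebra_simps)
    with D show ?thesis by simp
  qed
  have ker: "(\<Sum>s\<in>I. y s * u t s) = 0" for t
  proof -
    have "(\<Sum>s\<in>I. y s * u t s) = (\<Sum>s\<in>I. y s * v t s) - \<alpha> t * p"
      by (simp add: u_def p_def algebra_simps sum_subtractf sum_distrib_left)
    then show ?thesis using p by (simp add: \<alpha>_def)
  qed
  have u_le: "(\<Sum>s\<in>I. (cmod (u t s))\<^sup>2) \<le> (\<Sum>s\<in>I. (cmod (u 0 s))\<^sup>2)"
    by (rule energy_nonincreasing[where w = "\<lambda>t. A (u t)", OF Du _ \<tau> t])
      (use coercive[OF ker] in \<open>auto simp: A_def\<close>)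
  have "(\<Sum>s\<in>{()}. (cmod (\<alpha> t))\<^sup>2) \<le> (\<Sum>s\<in>{()}. (cmod (\<alpha> 0))\<^sup>2)"
  proof (rule energy_nonincreasing[where w = "\<lambda>t _. \<mu> * \<alpha> t", OF _ _ \<tau> t])
    show "0 \<le> Re (\<Sum>s\<in>{()}. cnj (\<alpha> t) * (\<mu> * \<alpha> t))" for t
    proof -
      have "Re (cnj (\<alpha> t) * (\<mu> * \<alpha> t)) = Re \<mu> * (cmod (\<alpha> t))\<^sup>2"
        unfolding cmod_power2 by (simp add: algebra_simps power2_eq_square)
      then show ?thesis using \<mu> by simp
    qed
  qed (use D\<alpha> in auto)
  then have \<alpha>_le: "(cmod (\<alpha> t))\<^sup>2 \<le> (cmod (\<alpha> 0))\<^sup>2" by simp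
  define W where "W = (\<lambda>t. (cmod (\<alpha> t))\<^sup>2 * (\<Sum>s\<in>I. (cmod (x s))\<^sup>2) + (\<Sum>s\<in>I. (cmod (u t s))\<^sup>2))"
  have W_le: "W t \<le> W 0" unfolding W_def
    by (intro add_mono mult_right_mono \<alpha>_le u_le sum_nonneg) simp
  have W0: "0 \<le> W t" for t by (simp add: W_def sum_nonneg)
  have split: "\<bar>(\<Sum>s\<in>I. (cmod (v t s))\<^sup>2) - W t\<bar> \<le> \<zeta> * W t" for t
    using near_orthogonal_splitting[of I i0 x y \<eta> "u t" "\<alpha> t", OF fin i0 x0 y0 x y \<eta> ker]
    by (simp add: W_def \<zeta>_def u_def)
  have \<zeta>0: "0 \<le> \<zeta>" using \<eta> by (simp add: \<zeta>_def)
  have "(\<Sum>s\<in>I. (cmod (v t s))\<^sup>2) \<le> (1 + \<zeta>) * W t" using split[of t] by (simp add: algebra_simps)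
  also have "\<dots> \<le> (1 + \<zeta>) * W 0" using W_le \<zeta>0 by (intro mult_left_mono) auto
  also have "\<dots> \<le> K\<^sup>2 * (1 - \<zeta>) * W 0" by (intro mult_right_mono K W0)
  also have "\<dots> = K\<^sup>2 * ((1 - \<zeta>) * W 0)" by simp
  also have "\<dots> \<le> K\<^sup>2 * (\<Sum>s\<in>I. (cmod (v 0 s))\<^sup>2)"
    using split[of 0] by (intro mult_left_mono) (auto simp: algebra_simps)
  finally show ?thesis .
qed

section \<open>Even holomorphic functions that are small on the imaginary axis\<close>

text \<open>
  The order of the zero at \<open>0\<close> can be read off along a single direction; the imaginary
  axis is the one on which the real part of the eigenvalue is known.
\<close>

lemma holomorphic_factor_power_of_bigo_imaginary:
  assumes "f holomorphic_on ball 0 r" "0 < r"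
    and "(\<lambda>\<phi>::real. f (\<i> * of_real \<phi>)) \<in> O[at 0](\<lambda>\<phi>. of_real \<phi> ^ n)"
  obtains g where "g holomorphic_on ball 0 r" "\<And>z. z \<in> ball 0 r \<Longrightarrow> f z = z ^ n * g z"
  using assms
proof (induction n arbitrary: f thesis)
  case 0
  then show ?case using "0.prems"(1)[of f] by simp
next
  case (Suc n)
  note hf = Suc.prems(2) and r = Suc.prems(3)
  from Suc.prems(4) obtain c where c: "c > 0"
      "\<forall>\<^sub>F \<phi> in at (0::real). cmod (f (\<i> * of_real \<phi>)) \<le> c * cmod (of_real \<phi> ^ Suc n)"
    by (rule landau_o.bigE)
  have "continuous (at 0) f"
    using hf r holomorphic_on_imp_continuous_on continuous_on_eq_continuous_at[of "ball 0 r" f] by auto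
  then have "isCont (\<lambda>\<phi>::real. f (\<i> * of_real \<phi>)) 0"
    by (intro isCont_o2[of 0 "\<lambda>\<phi>. \<i> * of_real \<phi>" f] continuous_intros) auto
  then have 1: "((\<lambda>\<phi>::real. f (\<i> * of_real \<phi>)) \<longlongrightarrow> f 0) (at 0)"
    by (simp add: isCont_def)
  have 2: "((\<lambda>\<phi>::real. f (\<i> * of_real \<phi>)) \<longlongrightarrow> 0) (at 0)"
  proof (rule Lim_null_comparison[OF c(2)])
    have "((\<lambda>\<phi>::real. c * cmod (of_real \<phi> ^ Suc n)) \<longlongrightarrow> c * cmod (of_real 0 ^ Suc n)) (at 0)"
      by (intro tendsto_intros)
    then show "((\<lambda>\<phi>::real. c * cmod (of_real \<phi> ^ Suc n)) \<longlongrightarrow> 0) (at 0)" by simp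
  qed
  \<comment> \<open>along the imaginary axis \<open>f\<close> tends to \<open>f 0\<close> by continuity and to \<open>0\<close> by the growth bound\<close>
  have f0: "f 0 = 0" using tendsto_unique[OF _ 1 2] by simp
  define f1 where "f1 = (\<lambda>z. if z = 0 then deriv f 0 else (f z - f 0) / (z - 0))"
  have h1: "f1 holomorphic_on ball 0 r" unfolding f1_def by (rule pole_lemma_open[OF hf open_ball])
  have f1: "f z = z * f1 z" for z by (simp add: f1_def f0)
  have "(\<lambda>\<phi>::real. f1 (\<i> * of_real \<phi>)) \<in> O[at 0](\<lambda>\<phi>. of_real \<phi> ^ n)"
  proof (rule landau_o.bigI[OF c(1)])
    show "\<forall>\<^sub>F \<phi> in at (0::real). cmod (f1 (\<i> * of_real \<phi>)) \<le> c * cmod (of_real \<phi> ^ n)"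
      using c(2) eventually_neq_at_within[of 0 0 UNIV]
    proof eventually_elim
      case (elim \<phi>)
      then have "\<bar>\<phi>\<bar> * cmod (f1 (\<i> * of_real \<phi>)) \<le> \<bar>\<phi>\<bar> * (c * cmod (of_real \<phi> ^ n))"
        by (simp add: f1 norm_mult norm_power algebra_simps)
      then show ?case using elim(2) by (simp add: mult_le_cancel_left)
    qed
  qed
  from Suc.IH[OF _ h1 r this] obtain g where
    "g holomorphic_on ball 0 r" "\<And>z. z \<in> ball 0 r \<Longrightarrow> f1 z = z ^ n * g z" by blast
  then show ?case using f1 Suc.prems(1)[of g] by (simp add: ac_simps)
qed

text \<open>
  Write \<open>f = z\<^bsup>n\<^esup> g\<close>. As \<open>f\<close> is even and \<open>n\<close> is odd, \<open>g\<close> is odd and vanishes at \<open>0\<close>, which gives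
  one more power of \<open>z\<close> than the growth hypothesis. The maximum principle for the quotient
  \<open>f / z\<^bsup>n + 1\<^esup>\<close> then turns the bound \<open>B\<close> on \<open>f\<close> into a bound whose constant is proportional to \<open>B\<close>;
  it does not involve the constant hidden in the growth hypothesis, over which there is no control.
\<close>

lemma even_holomorphic_bound:
  assumes hf: "f holomorphic_on ball 0 r" and r: "0 < r"
    and O: "(\<lambda>\<phi>::real. f (\<i> * of_real \<phi>)) \<in> O[at 0](\<lambda>\<phi>. of_real \<phi> ^ n)"
    and n: "odd n" and even: "\<And>z. z \<in> ball 0 r \<Longrightarrow> f (- z) = f z"
    and B: "\<And>z. z \<in> ball 0 r \<Longrightarrow> cmod (f z) \<le> B" and z: "cmod z \<le> r / 2"
  shows "cmod (f z) \<le> B * (2 / r) ^ Suc n * cmod z ^ Suc n"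
proof -
  obtain g where g: "g holomorphic_on ball 0 r" "\<And>z. z \<in> ball 0 r \<Longrightarrow> f z = z ^ n * g z"
    using holomorphic_factor_power_of_bigo_imaginary[OF hf r O] by blast
  have odd: "g (- z) = - g z" if "z \<in> ball 0 r - {0}" for z
  proof -
    have "(- z) ^ n * g (- z) = z ^ n * g z" using even[of z] g(2)[of z] g(2)[of "- z"] that by simp
    then have "z ^ n * (g z + g (- z)) = 0" using n by (simp add: power_minus_odd distrib_left) (metis add.left_inverse)
    then have "g z + g (- z) = 0" using that by simp
    then show ?thesis by (simp add: eq_neg_iff_add_eq_0 add.commute)
  qed
  have "continuous (at 0) g"
    using g(1) r holomorphic_on_imp_continuous_on continuous_on_eq_continuous_at[of "ball 0 r" g] by auto
  then have c: "isCont g 0" by simp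
  have "isCont (\<lambda>z. g (- z) + g z) 0"
    by (intro continuous_intros isCont_o2[of 0 "\<lambda>z. - z" g]) (use c in auto)
  then have 1: "((\<lambda>z. g (- z) + g z) \<longlongrightarrow> 2 * g 0) (at 0)" by (simp add: isCont_def)
  have "\<forall>\<^sub>F z in at 0. 0 = g (- z) + g z"
    using eventually_at_in_open[OF open_ball, of 0 0 r] r by (auto elim!: eventually_mono simp: odd)
  then have 2: "((\<lambda>z. g (- z) + g z) \<longlongrightarrow> 0) (at 0)"
    by (rule Lim_transform_eventually[OF tendsto_const])
  have g0: "g 0 = 0" using tendsto_unique[OF _ 1 2] by simp
  define g1 where "g1 = (\<lambda>z. if z = 0 then deriv g 0 else (g z - g 0) / (z - 0))"
  have h1: "g1 holomorphic_on ball 0 r" unfolding g1_def by (rule pole_lemma_open[OF g(1) open_ball])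
  have g1: "f z = z ^ Suc n * g1 z" if "z \<in> ball 0 r" for z
    using g(2)[OF that] by (simp add: g1_def g0)
  have sub: "cball 0 (r/2) \<subseteq> ball (0::complex) r" using r by auto
  have "cmod (g1 z) \<le> B / (r / 2) ^ Suc n"
  proof (rule maximum_modulus_frontier[of g1 "cball 0 (r/2)"])
    show "g1 holomorphic_on interior (cball 0 (r / 2))"
      using holomorphic_on_subset[OF h1] sub interior_subset by blast
    show "continuous_on (closure (cball 0 (r / 2))) g1"
      using holomorphic_on_imp_continuous_on[OF holomorphic_on_subset[OF h1 sub]] by simp
    show "bounded (cball (0::complex) (r / 2))" by simp
    show "z \<in> cball 0 (r / 2)" using z by simp
    fix w :: complex assume "w \<in> frontier (cball 0 (r / 2))"
    then have w: "cmod w = r / 2" by (simp add: frontier_cball)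
    then have "cmod (w ^ Suc n * g1 w) \<le> B" using B[of w] g1[of w] r by simp
    then have "(r / 2) ^ Suc n * cmod (g1 w) \<le> B" by (simp only: norm_mult norm_power w)
    then show "cmod (g1 w) \<le> B / (r / 2) ^ Suc n" using r by (simp only: pos_le_divide_eq zero_less_power half_gt_zero mult.commute)
  qed
  then have "cmod z ^ Suc n * cmod (g1 z) \<le> cmod z ^ Suc n * (B / (r / 2) ^ Suc n)"
    by (rule mult_left_mono) simp
  moreover have "cmod (f z) = cmod z ^ Suc n * cmod (g1 z)"
    using g1[of z] z r by (simp add: norm_mult norm_power)
  ultimately have "cmod (f z) \<le> cmod z ^ Suc n * (B / (r / 2) ^ Suc n)" by simp
  also have "\<dots> = B * (2 / r) ^ Suc n * cmod z ^ Suc n"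
    by (simp add: power_divide)
  finally show ?thesis .
qed

section \<open>Fourier transform of periodic sequences\<close>

definition root_unity :: "nat \<Rightarrow> int \<Rightarrow> complex" where
  "root_unity m j = cis (2 * pi * of_int j / of_nat m)"

lemma root_unity_add: "root_unity m (i + j) = root_unity m i * root_unity m j"
  by (simp add: root_unity_def cis_mult add_divide_distrib distrib_left)

lemma cnj_root_unity: "cnj (root_unity m j) = root_unity m (- j)"
  by (simp add: root_unity_def cis_cnj)

lemma norm_root_unity [simp]: "cmod (root_unity m j) = 1" by (simp add: root_unity_def)

lemma root_unity_eq_1_iff:
  assumes "m > 0" shows "root_unity m j = 1 \<longleftrightarrow> int m dvd j"
proof
  assume "root_unity m j = 1"
  then have "cos (2 * pi * of_int j / of_nat m) = 1" by (simp add: root_unity_def complex_eq_iff)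
  then obtain k :: int where "2 * pi * of_int j / of_nat m = of_int k * 2 * pi"
    using cos_one_2pi_int by blast
  then have "of_int j = (of_int (int m * k) :: real)" using assms by (simp add: field_simps)
  then show "int m dvd j" by (metis dvd_triv_left of_int_eq_iff)
next
  assume "int m dvd j"
  then obtain k where "j = int m * k" ..
  then have "2 * pi * of_int j / of_nat m = 2 * pi * of_int k" using assms by simp
  then show "root_unity m j = 1" by (simp add: root_unity_def cis_multiple_2pi)
qed

lemma root_unity_periodic: "m > 0 \<Longrightarrow> root_unity m (j + int m * k) = root_unity m j"
  using root_unity_eq_1_iff[of m "int m * k"] by (simp add: root_unity_add)

lemma sum_periodic_shift:
  fixes f :: "int \<Rightarrow> 'a::comm_monoid_add"
  assumes per: "\<And>j. f (j + int m) = f j"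
  shows "sum f {a..<a + int m} = sum f {0..<int m}"
proof (cases "m = 0")
  case False
  have step: "sum f {a + 1..<a + 1 + int m} = sum f {a..<a + int m}" for a
  proof -
    have "{a + 1..<a + 1 + int m} = insert (a + int m) {a + 1..<a + int m}"
         "{a..<a + int m} = insert a {a + 1..<a + int m}" using False by auto
    then show ?thesis by (simp add: per)
  qed
  show ?thesis
  proof (induction a rule: int_induct[of _ 0])
    case (step2 i) then show ?case using step[of "i - 1"] by simp
  qed (use step in simp_all)
qed simp

lemma periodic_add_multiple:
  fixes f :: "int \<Rightarrow> 'a"
  assumes "\<And>j. f (j + int m) = f j" shows "f (j + int m * k) = f j"
proof (induction k rule: int_induct[of _ 0])
  case (step1 i) then show ?case using assms[of "j + int m * i"] by (simp add: algebra_simps)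
next
  case (step2 i) then show ?case using assms[of "j + int m * (i - 1)"] by (simp add: algebra_simps)
qed simp

lemma periodic_mod:
  fixes f :: "int \<Rightarrow> 'a"
  assumes "\<And>j. f (j + int m) = f j" shows "f (j mod int m) = f j"
  using periodic_add_multiple[of f m "j mod int m" "j div int m", OF assms]
  by simp

lemma sum_split_residues:
  fixes f :: "int \<Rightarrow> 'a::comm_monoid_add"
  assumes "m > 0"
  shows "(\<Sum>j=0..<int (m * M). f j) = (\<Sum>j=0..<int m. \<Sum>q=0..<int M. f (j + int m * q))"
proof -
  have "(\<Sum>j=0..<int m. \<Sum>q=0..<int M. f (j + int m * q))
      = (\<Sum>(j, q)\<in>{0..<int m} \<times> {0..<int M}. f (j + int m * q))"
    by (simp add: sum.cartesian_product)
  also have "\<dots> = (\<Sum>j=0..<int (m * M). f j)"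
  proof (rule sum.reindex_bij_witness[of _ "\<lambda>j. (j mod int m, j div int m)" "\<lambda>(j, q). j + int m * q"];
      clarsimp simp: assms)
    fix j assume j: "0 \<le> j" "j < int m * int M"
    then have "0 \<le> j div int m" using assms by (simp add: pos_imp_zdiv_nonneg_iff)
    moreover have "j div int m < int M"
    proof (rule ccontr)
      assume "\<not> j div int m < int M"
      then have "int m * int M \<le> int m * (j div int m)" by (intro mult_left_mono) auto
      moreover have "int m * (j div int m) + j mod int m = j" by simp
      moreover have "0 \<le> j mod int m" using assms by simp
      ultimately show False using j by linarith
    qed
    ultimately show "0 \<le> j div int m \<and> j div int m < int M" by simp
  next
    fix j q assume "0 \<le> j" "j < int m" "0 \<le> q" "q < int M"
    then have "int m * (q + 1) \<le> int m * int M" by (intro mult_left_mono) auto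
    then show "j + int m * q < int m * int M" using \<open>j < int m\<close> by (simp add: distrib_left)
  qed
  finally show ?thesis ..
qed

text \<open>
  Multiplication by \<open>root_unity m s\<close> shifts the summation index, so it fixes the sum.
\<close>

lemma sum_root_unity:
  assumes m: "m > 0"
  shows "(\<Sum>j=0..<int m. root_unity m (s * j)) = (if int m dvd s then of_nat m else 0)"
proof (cases "int m dvd s")
  case True
  then have "root_unity m (s * j) = 1" for j using root_unity_eq_1_iff[OF m] by simp
  then show ?thesis using True by simp
next
  case False
  define Z where "Z = (\<Sum>j=0..<int m. root_unity m (s * j))"
  have "root_unity m s * Z = (\<Sum>j=0..<int m. root_unity m (s * (j + 1)))"
    by (simp add: Z_def sum_distrib_left distrib_left root_unity_add mult.commute)
  also have "\<dots> = (\<Sum>j=1..<1 + int m. root_unity m (s * j))"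
    by (rule sum.reindex_bij_witness[of _ "\<lambda>j. j - 1" "\<lambda>j. j + 1"]) auto
  also have "\<dots> = Z"
    unfolding Z_def
    by (rule sum_periodic_shift) (use root_unity_periodic[OF m] in \<open>simp add: distrib_left mult.commute[of s "int m"]\<close>)
  finally have "(root_unity m s - 1) * Z = 0" by (simp add: algebra_simps)
  then show ?thesis using False root_unity_eq_1_iff[OF m] by (simp add: Z_def)
qed

definition dft :: "nat \<Rightarrow> (int \<Rightarrow> complex) \<Rightarrow> int \<Rightarrow> complex" where
  "dft m f s = (\<Sum>j=0..<int m. f j * root_unity m (- (s * j))) / of_nat m"

lemma dft_periodic: "m > 0 \<Longrightarrow> dft m f (s + int m) = dft m f s"
proof -
  assume m: "m > 0"
  have "root_unity m (- ((s + int m) * j)) = root_unity m (- (s * j))" for j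
    using root_unity_periodic[OF m, of "- (s * j)" "- j"] by (simp add: algebra_simps)
  then show ?thesis by (simp add: dft_def)
qed

lemma dft_diff: "dft m (\<lambda>j. f j - g j) s = dft m f s - dft m g s"
  by (simp add: dft_def sum_subtractf diff_divide_distrib algebra_simps)

lemma dft_cmult: "dft m (\<lambda>j. c * f j) s = c * dft m f s"
  by (simp add: dft_def sum_distrib_left mult.assoc)

lemma dft_sum: "dft m (\<lambda>j. \<Sum>t\<in>T. f t j) s = (\<Sum>t\<in>T. dft m (f t) s)"
  unfolding dft_def sum_distrib_right by (subst sum.swap) (simp add: sum_divide_distrib)

lemma dft_root_unity:
  assumes m: "m > 0"
  shows "dft m (\<lambda>j. root_unity m (t * j)) s = (if int m dvd t - s then 1 else 0)"
proof -
  have "root_unity m (t * j) * root_unity m (- (s * j)) = root_unity m ((t - s) * j)" for j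
    by (simp add: root_unity_add[symmetric] algebra_simps)
  then show ?thesis using m by (simp add: dft_def sum_root_unity)
qed

lemma dft_inversion:
  assumes m: "m > 0" and per: "\<And>j. f (j + int m) = f j"
  shows "(\<Sum>s=0..<int m. dft m f s * root_unity m (s * j)) = f j"
proof -
  have "(\<Sum>s=0..<int m. dft m f s * root_unity m (s * j))
      = (\<Sum>s=0..<int m. \<Sum>i=0..<int m. f i * root_unity m ((j - i) * s) / of_nat m)"
    unfolding dft_def sum_divide_distrib sum_distrib_right
    by (intro sum.cong refl) (simp add: root_unity_add[symmetric] algebra_simps)
  also have "\<dots> = (\<Sum>i=0..<int m. f i * (if int m dvd j - i then 1 else 0))"
    using m by (subst sum.swap, intro sum.cong refl) (simp add: sum_divide_distrib[symmetric] sum_distrib_left[symmetric] sum_root_unity)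
  also have "\<dots> = (\<Sum>i=0..<int m. if i = j mod int m then f i else 0)"
  proof (rule sum.cong)
    fix i assume "i \<in> {0..<int m}"
    then have "int m dvd j - i \<longleftrightarrow> i = j mod int m"
      by (metis atLeastLessThan_iff mod_eq_dvd_iff mod_pos_pos_trivial)
    then show "f i * (if int m dvd j - i then 1 else 0) = (if i = j mod int m then f i else 0)" by simp
  qed simp
  also have "\<dots> = f (j mod int m)" using m by simp
  also have "\<dots> = f j" by (rule periodic_mod[of f m j, OF per])
  finally show ?thesis .
qed

lemma dft_parseval:
  assumes m: "m > 0" and per: "\<And>j. f (j + int m) = f j"
  shows "(\<Sum>s=a..<a + int m. (cmod (dft m f s))\<^sup>2) = (\<Sum>j=0..<int m. (cmod (f j))\<^sup>2) / real m"
proof -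
  have "of_real (\<Sum>s=0..<int m. (cmod (dft m f s))\<^sup>2) = (\<Sum>s=0..<int m. dft m f s * cnj (dft m f s))"
    by (simp add: complex_norm_square del: of_real_power)
  also have "\<dots> = (\<Sum>s=0..<int m. \<Sum>j=0..<int m. cnj (f j) * (dft m f s * root_unity m (s * j)) / of_nat m)"
    unfolding dft_def[of m f "_", THEN arg_cong[of _ _ cnj]]
    by (simp add: cnj_root_unity sum_divide_distrib sum_distrib_left sum_distrib_right algebra_simps)
  also have "\<dots> = (\<Sum>j=0..<int m. cnj (f j) * (\<Sum>s=0..<int m. dft m f s * root_unity m (s * j)) / of_nat m)"
    by (subst sum.swap) (simp add: sum_distrib_left sum_divide_distrib)
  also have "\<dots> = (\<Sum>j=0..<int m. cnj (f j) * f j / of_nat m)"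
    by (simp add: dft_inversion[of m f, OF m per])
  also have "\<dots> = of_real ((\<Sum>j=0..<int m. (cmod (f j))\<^sup>2) / real m)"
    by (simp add: complex_norm_square sum_divide_distrib mult.commute del: of_real_power)
  finally have "(\<Sum>s=0..<int m. (cmod (dft m f s))\<^sup>2) = (\<Sum>j=0..<int m. (cmod (f j))\<^sup>2) / real m"
    by (simp only: of_real_eq_iff)
  moreover have "(\<Sum>s=a..<a + int m. (cmod (dft m f s))\<^sup>2) = (\<Sum>s=0..<int m. (cmod (dft m f s))\<^sup>2)"
    by (rule sum_periodic_shift) (simp add: dft_periodic[OF m])
  ultimately show ?thesis by simp
qed

section \<open>Bloch operators\<close>

text \<open>
  At \<open>z = \<i> \<phi>\<close> this is the Fourier symbol; complex \<open>z\<close> makes the maximum principle available.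
\<close>

definition exp_symbol :: "nat \<Rightarrow> (int \<Rightarrow> real) \<Rightarrow> complex \<Rightarrow> complex" where
  "exp_symbol S \<alpha> z = (\<Sum>k=-int S..int S. of_real (\<alpha> k) * exp (z * of_int k))"

text \<open>
  The operator \<open>(\<Sum>k. b j k v (j + k))\<close> seen on sequences \<open>v j = e\<^bsup>z j\<^esup> w j\<close>, after division by
  \<open>e\<^bsup>z j\<^esup>\<close>.
\<close>

definition bloch_op :: "nat \<Rightarrow> (int \<Rightarrow> int \<Rightarrow> real) \<Rightarrow> complex \<Rightarrow> (int \<Rightarrow> complex) \<Rightarrow> int \<Rightarrow> complex" where
  "bloch_op S b z w j = (\<Sum>k=-int S..int S. of_real (b j k) * exp (z * of_int k) * w (j + k))"

text \<open>
  The matrix of \<open>bloch_op\<close> in the basis of \<open>m\<close>-periodic exponentials.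
\<close>

definition bloch_matrix :: "nat \<Rightarrow> nat \<Rightarrow> (int \<Rightarrow> int \<Rightarrow> real) \<Rightarrow> int \<Rightarrow> int \<Rightarrow> complex \<Rightarrow> complex" where
  "bloch_matrix m S b s t z = dft m (bloch_op S b z (\<lambda>j. root_unity m (t * j))) s"

text \<open>
  The eigenvalue of the uniform operator on the exponential \<open>root_unity m (s * j)\<close>.
\<close>

definition branch_symbol :: "nat \<Rightarrow> nat \<Rightarrow> (int \<Rightarrow> real) \<Rightarrow> int \<Rightarrow> complex \<Rightarrow> complex" where
  "branch_symbol m S \<alpha> s z = exp_symbol S \<alpha> (z + \<i> * of_real (2 * pi * of_int s / of_nat m))"

text \<open>
  The growth bound for the blocks of all frequencies at once. The frequencies \<open>\<phi>\<close> form one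
  cell of the lattice dual to \<open>m \<int>\<close>, and \<open>\<tau>\<close> stands for the reciprocal mesh width.
\<close>

definition bloch_stable :: "nat \<Rightarrow> nat \<Rightarrow> (int \<Rightarrow> int \<Rightarrow> real) \<Rightarrow> real \<Rightarrow> bool" where
  "bloch_stable m S b K \<longleftrightarrow> (\<forall>\<phi> \<tau> v. \<bar>\<phi>\<bar> \<le> pi / real m \<longrightarrow> 0 \<le> \<tau> \<longrightarrow>
      (\<forall>t\<ge>0. \<forall>j. v t (j + int m) = v t j) \<longrightarrow>
      (\<forall>t\<ge>0. \<forall>j. ((\<lambda>t. v t j) has_vector_derivative
        - (of_real \<tau> * bloch_op S b (\<i> * of_real \<phi>) (v t) j)) (at t within {0..})) \<longrightarrow>
      (\<forall>t\<ge>0. (\<Sum>j=0..<int m. (cmod (v t j))\<^sup>2) \<le> K\<^sup>2 * (\<Sum>j=0..<int m. (cmod (v 0 j))\<^sup>2)))"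

lemma bloch_op_sum:
  "bloch_op S b z (\<lambda>j. \<Sum>t\<in>T. g t j * c t) = (\<lambda>j. \<Sum>t\<in>T. c t * bloch_op S b z (g t) j)"
proof
  fix j
  show "bloch_op S b z (\<lambda>j. \<Sum>t\<in>T. g t j * c t) j = (\<Sum>t\<in>T. c t * bloch_op S b z (g t) j)"
    unfolding bloch_op_def sum_distrib_left by (subst sum.swap) (simp add: algebra_simps)
qed

lemma bloch_op_periodic:
  assumes "\<And>j k. b (j + int m) k = b j k" "\<And>j. w (j + int m) = w j"
  shows "bloch_op S b z w (j + int m) = bloch_op S b z w j"
proof -
  have "w (j + int m + k) = w (j + k)" for k using assms(2)[of "j + k"] by (simp add: ac_simps)
  then show ?thesis by (simp add: bloch_op_def assms(1))
qed

lemma bloch_op_root_unity: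
  "bloch_op S (\<lambda>_. \<alpha>) z (\<lambda>j. root_unity m (t * j)) j = branch_symbol m S \<alpha> t z * root_unity m (t * j)"
proof -
  define A where "A = \<i> * of_real (2 * pi * of_int t / of_nat m)"
  have "root_unity m (t * (j + k)) = exp (A * of_int k) * root_unity m (t * j)" for k
    by (simp add: A_def root_unity_def cis_conv_exp exp_add[symmetric] add_divide_distrib ring_distribs mult_ac)
  moreover have "branch_symbol m S \<alpha> t z = exp_symbol S \<alpha> (z + A)"
    by (simp add: branch_symbol_def A_def)
  moreover have "exp ((z + A) * of_int k) = exp (z * of_int k) * exp (A * of_int k)" for k
    by (simp add: distrib_right exp_add)
  ultimately show ?thesis
    by (simp only: bloch_op_def exp_symbol_def sum_distrib_right mult.assoc)
qed

text \<open>
  In Fourier coordinates \<open>bloch_op\<close> is the diagonal matrix of the uniform operator plus the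
  matrix of the deviation \<open>b - \<alpha>\<close>.
\<close>

lemma dft_bloch_op:
  assumes m: "m > 0" and w: "\<And>j. w (j + int m) = w j" and s: "s \<in> {0..<int m}"
  shows "dft m (bloch_op S b z w) s = branch_symbol m S \<alpha> s z * dft m w s
     + (\<Sum>t=0..<int m. bloch_matrix m S (\<lambda>j k. b j k - \<alpha> k) s t z * dft m w t)"
proof -
  define r where "r = (\<lambda>t j. root_unity m (t * j))"
  have w': "w = (\<lambda>j. \<Sum>t=0..<int m. r t j * dft m w t)"
    using dft_inversion[of m w, OF m w] by (simp add: mult.commute r_def)
  have split: "bloch_op S b z w = (\<lambda>j. bloch_op S b z w j - bloch_op S (\<lambda>_. \<alpha>) z w j + bloch_op S (\<lambda>_. \<alpha>) z w j)" by simp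
  have diff: "bloch_op S b z g j - bloch_op S (\<lambda>_. \<alpha>) z g j = bloch_op S (\<lambda>j k. b j k - \<alpha> k) z g j" for g j
    by (simp add: bloch_op_def sum_subtractf algebra_simps)
  have exp: "dft m (bloch_op S b' z w) s = (\<Sum>t=0..<int m. dft m w t * dft m (bloch_op S b' z (r t)) s)" for b'
  proof -
    have "bloch_op S b' z w = (\<lambda>j. \<Sum>t=0..<int m. dft m w t * bloch_op S b' z (r t) j)"
      by (subst w') (rule bloch_op_sum)
    then show ?thesis by (simp add: dft_sum dft_cmult)
  qed
  have "dft m (bloch_op S (\<lambda>_. \<alpha>) z (r t)) s = (if t = s then branch_symbol m S \<alpha> s z else 0)"
    if "t \<in> {0..<int m}" for t
  proof -
    have "int m dvd t - s \<longleftrightarrow> t = s"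
      using that s by (metis atLeastLessThan_iff mod_eq_dvd_iff mod_pos_pos_trivial)
    moreover have "bloch_op S (\<lambda>_. \<alpha>) z (r t) = (\<lambda>j. branch_symbol m S \<alpha> t z * root_unity m (t * j))"
      unfolding r_def by (rule ext) (rule bloch_op_root_unity)
    ultimately show ?thesis using m by (simp add: dft_cmult dft_root_unity)
  qed
  then have "dft m (bloch_op S (\<lambda>_. \<alpha>) z w) s
      = (\<Sum>t=0..<int m. if t = s then dft m w s * branch_symbol m S \<alpha> s z else 0)"
    unfolding exp by (intro sum.cong) auto
  also have "\<dots> = branch_symbol m S \<alpha> s z * dft m w s" using s by simp
  finally have 1: "dft m (bloch_op S (\<lambda>_. \<alpha>) z w) s = branch_symbol m S \<alpha> s z * dft m w s" .
  have "dft m (bloch_op S b z w) s - dft m (bloch_op S (\<lambda>_. \<alpha>) z w) s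
     = (\<Sum>t=0..<int m. bloch_matrix m S (\<lambda>j k. b j k - \<alpha> k) s t z * dft m w t)"
    unfolding dft_diff[symmetric] diff unfolding exp by (simp add: bloch_matrix_def r_def mult.commute)
  then show ?thesis using 1 by (simp add: algebra_simps)
qed

lemma dft_trig_sum:
  assumes m: "m > 0" and s: "s \<in> {0..<int m}"
  shows "dft m (\<lambda>j. \<Sum>t=0..<int m. x t * root_unity m (t * j)) s = x s"
proof -
  have "int m dvd t - s \<longleftrightarrow> t = s" if "t \<in> {0..<int m}" for t
    using that s by (metis atLeastLessThan_iff mod_eq_dvd_iff mod_pos_pos_trivial)
  then have "(\<Sum>t=0..<int m. x t * (if int m dvd t - s then 1 else 0)) = (\<Sum>t=0..<int m. if t = s then x s else 0)"
    by (intro sum.cong) auto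
  then show ?thesis using s m by (simp add: dft_sum dft_cmult dft_root_unity)
qed

lemma dft_eq_imp_eq:
  assumes m: "m > 0" and f: "\<And>j. f (j + int m) = f j" and g: "\<And>j. g (j + int m) = g j"
    and eq: "\<And>s. s \<in> {0..<int m} \<Longrightarrow> dft m f s = dft m g s"
  shows "f j = g j"
  using dft_inversion[of m f j, OF m f] dft_inversion[of m g j, OF m g] eq by simp

lemma norm_dft_le:
  assumes m: "m > 0" and f: "\<And>j. cmod (f j) \<le> B" shows "cmod (dft m f s) \<le> B"
proof -
  have "cmod (\<Sum>j=0..<int m. f j * root_unity m (- (s * j))) \<le> (\<Sum>j=0..<int m. B)"
    by (rule sum_norm_le) (simp add: norm_mult f)
  then show ?thesis using m by (simp add: dft_def norm_divide divide_le_eq mult.commute)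
qed

lemma norm_dft_le_sum:
  assumes m: "m > 0" shows "cmod (dft m f s) \<le> (\<Sum>j=0..<int m. cmod (f j))"
proof -
  have "cmod (\<Sum>j=0..<int m. f j * root_unity m (- (s * j))) \<le> (\<Sum>j=0..<int m. cmod (f j))"
    by (rule sum_norm_le) (simp add: norm_mult)
  also have "\<dots> \<le> (\<Sum>j=0..<int m. cmod (f j)) * real m"
    using mult_left_mono[of 1 "real m" "\<Sum>j=0..<int m. cmod (f j)"] m by (simp add: sum_nonneg)
  finally show ?thesis using m by (simp add: dft_def norm_divide divide_le_eq)
qed

lemma norm_bloch_matrix_le:
  assumes m: "m > 0" and b: "\<And>j k. k \<in> {-int S..int S} \<Longrightarrow> \<bar>b j k\<bar> * ((2 * real S + 1) * exp (real S)) \<le> \<epsilon>"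
    and z: "\<bar>Re z\<bar> \<le> 1"
  shows "cmod (bloch_matrix m S b s t z) \<le> \<epsilon>"
  unfolding bloch_matrix_def
proof (rule norm_dft_le[OF m])
  fix j
  have "cmod (of_real (b j k) * exp (z * of_int k) * root_unity m (t * (j + k))) \<le> \<epsilon> / (2 * real S + 1)"
    if k: "k \<in> {-int S..int S}" for k
  proof -
    have "\<bar>Re z * of_int k\<bar> \<le> 1 * real S" unfolding abs_mult by (rule mult_mono) (use z k in auto)
    then have "exp (Re z * of_int k) \<le> exp (real S)" by simp
    then have "\<bar>b j k\<bar> * exp (Re z * of_int k) \<le> \<bar>b j k\<bar> * exp (real S)" by (intro mult_left_mono) auto
    also have "\<dots> \<le> \<epsilon> / (2 * real S + 1)" using b[OF k, of j] by (simp add: field_simps)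
    finally show ?thesis by (simp add: norm_mult norm_exp)
  qed
  then have "cmod (bloch_op S b z (\<lambda>j. root_unity m (t * j)) j) \<le> (\<Sum>k=-int S..int S. \<epsilon> / (2 * real S + 1))"
    unfolding bloch_op_def by (rule sum_norm_le)
  also have "\<dots> = \<epsilon>" by (simp add: nat_add_distrib nat_mult_distrib field_simps)
  finally show "cmod (bloch_op S b z (\<lambda>j. root_unity m (t * j)) j) \<le> \<epsilon>" .
qed

lemma holomorphic_bloch_matrix [holomorphic_intros]: "bloch_matrix m S b s t holomorphic_on U"
proof -
  have "(\<lambda>z. bloch_matrix m S b s t z) holomorphic_on U"
    unfolding bloch_matrix_def dft_def bloch_op_def divide_inverse by (intro holomorphic_intros)
  then show ?thesis by simp
qed

lemma holomorphic_branch_symbol [holomorphic_intros]: "branch_symbol m S \<alpha> s holomorphic_on U"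
proof -
  have "(\<lambda>z. branch_symbol m S \<alpha> s z) holomorphic_on U"
    unfolding branch_symbol_def exp_symbol_def by (intro holomorphic_intros)
  then show ?thesis by simp
qed

lemma bloch_op_cnj: "bloch_op S b (cnj z) (\<lambda>j. cnj (w j)) j = cnj (bloch_op S b z w j)"
  by (simp add: bloch_op_def exp_cnj)

text \<open>
  The coefficients are real, so complex conjugation maps eigenvectors at \<open>z\<close> to
  eigenvectors at \<open>cnj z\<close>. Conjugation is simple for sequences but permutes the Fourier
  coefficients, so the proof passes to sequences and back.
\<close>

lemma bloch_conjugate_eigenvector:
  assumes m: "m > 0" and per: "\<And>j k. b (j + int m) k = b j k"
    and eig: "\<And>s. s \<in> {0..<int m} \<Longrightarrow> branch_symbol m S \<alpha> s z * x s
       + (\<Sum>t=0..<int m. bloch_matrix m S (\<lambda>j k. b j k - \<alpha> k) s t z * x t) = \<mu> * x s"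
    and nz: "s0 \<in> {0..<int m}" "x s0 \<noteq> 0"
  obtains v where "\<And>s. s \<in> {0..<int m} \<Longrightarrow> branch_symbol m S \<alpha> s (cnj z) * v s
       + (\<Sum>t=0..<int m. bloch_matrix m S (\<lambda>j k. b j k - \<alpha> k) s t (cnj z) * v t) = cnj \<mu> * v s"
    "\<exists>s\<in>{0..<int m}. v s \<noteq> 0"
proof -
  define w where "w = (\<lambda>j. \<Sum>t=0..<int m. x t * root_unity m (t * j))"
  have wper: "w (j + int m) = w j" for j
  proof -
    have "root_unity m (t * (j + int m)) = root_unity m (t * j)" for t
      using root_unity_periodic[OF m, of "t * j" t] by (simp add: algebra_simps)
    then show ?thesis by (simp add: w_def)
  qed
  have x: "dft m w s = x s" if "s \<in> {0..<int m}" for s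
    unfolding w_def by (rule dft_trig_sum[OF m that])
  have "bloch_op S b z w j = \<mu> * w j" for j
  proof (rule dft_eq_imp_eq[OF m])
    show "dft m (bloch_op S b z w) s = dft m (\<lambda>j. \<mu> * w j) s" if "s \<in> {0..<int m}" for s
      using dft_bloch_op[of m w s S b z \<alpha>, OF m wper that] eig[OF that] x that by (simp add: dft_cmult)
  qed (simp_all add: wper bloch_op_periodic[of b m w, OF per wper])
  then have eigw: "bloch_op S b (cnj z) (\<lambda>j. cnj (w j)) = (\<lambda>j. cnj \<mu> * cnj (w j))"
    by (simp add: bloch_op_cnj fun_eq_iff)
  define v where "v = dft m (\<lambda>j. cnj (w j))"
  have wper': "cnj (w (j + int m)) = cnj (w j)" for j by (simp add: wper)
  show thesis
  proof (rule that[of v])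
    show "branch_symbol m S \<alpha> s (cnj z) * v s
       + (\<Sum>t=0..<int m. bloch_matrix m S (\<lambda>j k. b j k - \<alpha> k) s t (cnj z) * v t) = cnj \<mu> * v s"
      if "s \<in> {0..<int m}" for s
      using dft_bloch_op[of m "\<lambda>j. cnj (w j)" s S b "cnj z" \<alpha>, OF m wper' that] unfolding eigw
      by (simp add: v_def dft_cmult)
    show "\<exists>s\<in>{0..<int m}. v s \<noteq> 0"
    proof (rule ccontr)
      assume "\<not> (\<exists>s\<in>{0..<int m}. v s \<noteq> 0)"
      then have "cnj (w j) = 0" for j
        using dft_inversion[of m "\<lambda>j. cnj (w j)" j, OF m wper'] by (simp add: v_def)
      then have "dft m w s0 = 0" by (simp add: dft_def)
      then show False using x nz by simp
    qed
  qed
qed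

section \<open>The slow branch of a perturbed Bloch operator\<close>

lemma branch_symbol_0: "branch_symbol m S \<alpha> 0 z = exp_symbol S \<alpha> z"
  by (simp add: branch_symbol_def)

lemma exp_symbol_cnj: "exp_symbol S \<alpha> (cnj z) = cnj (exp_symbol S \<alpha> z)"
  by (simp add: exp_symbol_def exp_cnj)

text \<open>
  A bound on the whole unit disc rather than a Landau symbol for \<open>z\<close> tending to \<open>0\<close>, so that
  the value at \<open>0\<close> is covered as well.
\<close>

definition vanishes_to_order :: "nat \<Rightarrow> (complex \<Rightarrow> complex) \<Rightarrow> bool" where
  "vanishes_to_order n F \<longleftrightarrow> (\<exists>C. \<forall>z. cmod z \<le> 1 \<longrightarrow> cmod (F z) \<le> C * cmod z ^ n)"

text \<open>
  This is what exactness means for the blocks: \<open>w z\<close> is an eigenvector of \<open>L(z)\<close> with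
  eigenvalue \<open>z\<close>, up to an error of order \<open>\<kappa>\<close>. Equivalently the scheme differentiates a discrete
  version of \<open>e\<^bsup>z x\<^esup>\<close> correctly to this order. Only qualitative information is kept: no bound on
  \<open>w\<close> is available that would be uniform over the meshes.
\<close>

definition consistent_to_order :: "nat \<Rightarrow> nat \<Rightarrow> (int \<Rightarrow> int \<Rightarrow> real) \<Rightarrow> nat \<Rightarrow> bool" where
  "consistent_to_order m S b \<kappa> \<longleftrightarrow> (\<exists>w.
     (\<forall>z j. w z (j + int m) = w z j) \<and> (\<forall>j. isCont (\<lambda>z. w z j) 0) \<and> (\<exists>j. w 0 j \<noteq> 0) \<and>
     (\<forall>j. vanishes_to_order \<kappa> (\<lambda>z. bloch_op S b z (w z) j - z * w z j)))"

text \<open>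
  Here \<open>\<epsilon>\<close> bounds the entries of the deviation from the uniform matrix, \<open>\<delta>\<close> is the gap of the
  branches \<open>s \<noteq> 0\<close> on the imaginary axis, half of which is kept on the disc of radius \<open>\<rho>\<close>, and \<open>\<eta>\<close>
  is the bound that \<open>perturbed_diagonal_eigenpair\<close> gives for the components of the eigenvectors
  off the branch \<open>0\<close>. With the constant \<open>24\<close> that lemma applies with the gap \<open>\<delta> / 4\<close>; together with
  \<open>16\<close> it keeps the real part of the perturbed eigenvalue below \<open>\<delta> / 4\<close>, which is also the
  coercivity constant on the kernel of the left eigenvector.
\<close>

locale bloch_perturbation =
  fixes m S :: nat and \<alpha> :: "int \<Rightarrow> real" and b :: "int \<Rightarrow> int \<Rightarrow> real" and \<rho> \<delta> \<epsilon> \<eta> :: real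
  assumes m: "m > 0"
    and per: "\<And>j k. b (j + int m) k = b j k"
    and close: "\<And>j k. k \<in> {-int S..int S} \<Longrightarrow> \<bar>b j k - \<alpha> k\<bar> * ((2 * real S + 1) * exp (real S)) \<le> \<epsilon>"
    and \<rho>: "0 < \<rho>" "\<rho> \<le> 1" "\<rho> \<le> pi / real m" and \<delta>: "0 < \<delta>"
    and gap_ball: "\<And>s z. s \<in> {1..<int m} \<Longrightarrow> cmod z < \<rho> \<Longrightarrow> \<delta> / 2 \<le> Re (branch_symbol m S \<alpha> s z)"
    and small_ball: "\<And>z. cmod z < \<rho> \<Longrightarrow> cmod (branch_symbol m S \<alpha> 0 z) \<le> \<delta> / 16"
    and gap_imag: "\<And>s \<phi>. s \<in> {1..<int m} \<Longrightarrow> \<bar>\<phi>\<bar> \<le> pi / real m \<Longrightarrow>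
      \<delta> \<le> Re (branch_symbol m S \<alpha> s (\<i> * of_real \<phi>))"
    and nonneg_imag: "\<And>\<phi>. 0 \<le> Re (branch_symbol m S \<alpha> 0 (\<i> * of_real \<phi>))"
    and small: "24 * real m * \<epsilon> \<le> \<delta>"
    and \<eta>_def: "\<eta> = 8 * real m * \<epsilon> / \<delta>" and \<eta>1: "\<eta>\<^sup>2 * real m < 1"
begin

abbreviation "I \<equiv> {0..<int m}"
abbreviation "d \<equiv> branch_symbol m S \<alpha>"
abbreviation "R \<equiv> bloch_matrix m S (\<lambda>j k. b j k - \<alpha> k)"

lemma \<epsilon>: "0 \<le> \<epsilon>"
proof -
  have "0 \<le> \<bar>b 0 0 - \<alpha> 0\<bar> * ((2 * real S + 1) * exp (real S))" by simp
  also have "\<dots> \<le> \<epsilon>" by (rule close) simp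
  finally show ?thesis .
qed

lemma \<eta>: "0 \<le> \<eta>" using \<epsilon> \<delta> by (simp add: \<eta>_def)

lemma index: "0 \<in> I" "I - {0} = {1..<int m}" using m by auto

lemma R_le: "\<bar>Re z\<bar> \<le> 1 \<Longrightarrow> cmod (R s t z) \<le> \<epsilon>"
  by (rule norm_bloch_matrix_le[OF m close])

lemma ball_Re: "z \<in> ball 0 \<rho> \<Longrightarrow> \<bar>Re z\<bar> \<le> 1"
  using abs_Re_le_cmod[of z] \<rho>(2) by simp

lemma gap: "s \<in> I - {0} \<Longrightarrow> z \<in> ball 0 \<rho> \<Longrightarrow> \<delta> / 4 \<le> cmod (d 0 z - d s z)"
  using gap_ball[of s z] small_ball[of z] complex_Re_le_cmod[of "d s z"]
    norm_triangle_ineq2[of "d s z" "d 0 z"] \<delta> unfolding index(2)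
  by (simp add: norm_minus_commute)

end

locale bloch_eigenpair = bloch_perturbation +
  fixes x y :: "int \<Rightarrow> complex \<Rightarrow> complex" and \<mu> :: "complex \<Rightarrow> complex"
  assumes hol: "\<And>s. s \<in> I \<Longrightarrow> y s holomorphic_on ball 0 \<rho>" "\<mu> holomorphic_on ball 0 \<rho>"
    and one: "\<And>z. z \<in> ball 0 \<rho> \<Longrightarrow> x 0 z = 1" "\<And>z. z \<in> ball 0 \<rho> \<Longrightarrow> y 0 z = 1"
    and le: "\<And>s z. s \<in> I - {0} \<Longrightarrow> z \<in> ball 0 \<rho> \<Longrightarrow> cmod (x s z) \<le> \<eta>"
            "\<And>s z. s \<in> I - {0} \<Longrightarrow> z \<in> ball 0 \<rho> \<Longrightarrow> cmod (y s z) \<le> \<eta>"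
    and \<mu>_le: "\<And>z. z \<in> ball 0 \<rho> \<Longrightarrow> cmod (\<mu> z - d 0 z) \<le> real m * \<epsilon>"
    and right: "\<And>s z. s \<in> I \<Longrightarrow> z \<in> ball 0 \<rho> \<Longrightarrow> d s z * x s z + (\<Sum>t\<in>I. R s t z * x t z) = \<mu> z * x s z"
    and left: "\<And>t z. t \<in> I \<Longrightarrow> z \<in> ball 0 \<rho> \<Longrightarrow> d t z * y t z + (\<Sum>s\<in>I. R s t z * y s z) = \<mu> z * y t z"

text \<open>
  The left eigenvector is a right eigenvector of the transposed matrix; it belongs to the
  same eigenvalue because its pairing with the right one does not vanish.
\<close>

lemma (in bloch_perturbation) eigenpair_exists:
  "\<exists>x y \<mu>. bloch_eigenpair m S \<alpha> b \<rho> \<delta> \<epsilon> \<eta> x y \<mu>"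
proof -
  have card_I: "card I = m" by simp
  have g4: "0 < \<delta> / 4" using \<delta> by simp
  have sm: "6 * real (card I) * \<epsilon> \<le> \<delta> / 4" using small by simp
  have \<eta>': "2 * real m * \<epsilon> / (\<delta> / 4) = \<eta>" by (simp add: \<eta>_def)
  have "\<exists>x \<mu>. (\<forall>s\<in>I. x s holomorphic_on ball 0 \<rho>) \<and> \<mu> holomorphic_on ball 0 \<rho> \<and>
      (\<forall>z\<in>ball 0 \<rho>. x 0 z = 1) \<and>
      (\<forall>s\<in>I - {0}. \<forall>z\<in>ball 0 \<rho>. cmod (x s z) \<le> 2 * real (card I) * \<epsilon> / (\<delta> / 4)) \<and>
      (\<forall>z\<in>ball 0 \<rho>. cmod (\<mu> z - d 0 z) \<le> real (card I) * \<epsilon>) \<and>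
      (\<forall>s\<in>I. \<forall>z\<in>ball 0 \<rho>. d s z * x s z + (\<Sum>t\<in>I. Q s t z * x t z) = \<mu> z * x s z)"
    if "\<And>s t. Q s t holomorphic_on ball 0 \<rho>" "\<And>s t z. z \<in> ball 0 \<rho> \<Longrightarrow> cmod (Q s t z) \<le> \<epsilon>" for Q
    by (rule perturbed_diagonal_eigenpair[of I 0 "ball 0 \<rho>" d Q "\<delta> / 4" \<epsilon>, OF finite_atLeastLessThan_int index(1) open_ball
        holomorphic_branch_symbol that(1) gap g4 that(2) \<epsilon> sm])
  note ex = this[unfolded card_I \<eta>']
  have R_ball: "cmod (R s t z) \<le> \<epsilon>" if "z \<in> ball 0 \<rho>" for s t z by (rule R_le[OF ball_Re[OF that]])
  obtain x \<mu> where x: "\<mu> holomorphic_on ball 0 \<rho>" "\<forall>z\<in>ball 0 \<rho>. x 0 z = 1"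
    "\<forall>s\<in>I - {0}. \<forall>z\<in>ball 0 \<rho>. cmod (x s z) \<le> \<eta>"
    "\<forall>z\<in>ball 0 \<rho>. cmod (\<mu> z - d 0 z) \<le> real m * \<epsilon>"
    "\<forall>s\<in>I. \<forall>z\<in>ball 0 \<rho>. d s z * x s z + (\<Sum>t\<in>I. R s t z * x t z) = \<mu> z * x s z"
    by (rule exE[OF ex[of R]], rule holomorphic_bloch_matrix, erule R_ball, elim exE conjE, rule that)
  obtain y \<nu> where y: "\<forall>s\<in>I. y s holomorphic_on ball 0 \<rho>" "\<forall>z\<in>ball 0 \<rho>. y 0 z = 1"
    "\<forall>s\<in>I - {0}. \<forall>z\<in>ball 0 \<rho>. cmod (y s z) \<le> \<eta>"
    "\<forall>t\<in>I. \<forall>z\<in>ball 0 \<rho>. d t z * y t z + (\<Sum>s\<in>I. R s t z * y s z) = \<nu> z * y t z"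
    by (rule exE[OF ex[of "\<lambda>s t. R t s"]], rule holomorphic_bloch_matrix, erule R_ball, elim exE conjE, rule that)
  have "\<nu> z = \<mu> z" if z: "z \<in> ball 0 \<rho>" for z
  proof -
    have "(\<Sum>s\<in>I. y s z * (d s z * x s z + (\<Sum>t\<in>I. R s t z * x t z))) = \<nu> z * (\<Sum>s\<in>I. y s z * x s z)"
      by (rule left_eigenvector_pairing) (use y(4) z in auto)
    moreover have "(\<Sum>s\<in>I. y s z * (d s z * x s z + (\<Sum>t\<in>I. R s t z * x t z))) = \<mu> z * (\<Sum>s\<in>I. y s z * x s z)"
      unfolding sum_distrib_left by (rule sum.cong) (use x(5) z in auto)
    moreover have "(\<Sum>s\<in>I. y s z * x s z) \<noteq> 0"
      by (rule eigenvector_pairing_nonzero[of I 0 "\<lambda>s. x s z" "\<lambda>s. y s z" \<eta>])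
        (use x y z index \<eta> \<eta>1 in auto)
    ultimately show ?thesis by simp
  qed
  then have "bloch_eigenpair m S \<alpha> b \<rho> \<delta> \<epsilon> \<eta> x y \<mu>"
    using x y by unfold_locales auto
  then show ?thesis by blast
qed

context bloch_eigenpair
begin

lemma imag_in_ball: "\<bar>\<phi>\<bar> < \<rho> \<Longrightarrow> \<i> * of_real \<phi> \<in> ball 0 \<rho>"
  by (simp add: norm_mult)

lemma coercive_on_kernel:
  assumes \<phi>: "\<bar>\<phi>\<bar> < \<rho>" and ker: "(\<Sum>s\<in>I. y s (\<i> * of_real \<phi>) * v s) = 0"
  shows "\<delta> / 4 * (\<Sum>s\<in>I. (cmod (v s))\<^sup>2) \<le> Re (\<Sum>s\<in>I. cnj (v s) *
      (d s (\<i> * of_real \<phi>) * v s + (\<Sum>t\<in>I. R s t (\<i> * of_real \<phi>) * v t)))"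
proof (rule Re_quadratic_form_on_kernel[where ?i0.0 = 0 and \<epsilon> = \<epsilon> and \<eta> = \<eta> and y = "\<lambda>s. y s (\<i> * of_real \<phi>)"])
  show "\<delta> \<le> Re (d s (\<i> * of_real \<phi>))" if "s \<in> I - {0}" for s
    using gap_imag[of s \<phi>] that \<phi> \<rho>(3) index(2) by simp
qed (use index imag_in_ball[OF \<phi>] one le \<eta> \<eta>1 ker R_le nonneg_imag \<delta> small \<epsilon> in \<open>auto\<close>)

text \<open>
  An eigenvector with eigenvalue \<open>\<nu>\<close> of small real part cannot lie in the kernel of the
  left eigenvector, where the matrix is coercive. Pairing with the left eigenvector then
  identifies \<open>\<nu>\<close>. This identifies the conjugate eigenvalue and also shows that the
  approximate eigenvector of the exact scheme has a component along the branch \<open>0\<close>.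
\<close>

lemma slow_eigenvalue_unique:
  assumes \<phi>: "\<bar>\<phi>\<bar> < \<rho>"
    and eig: "\<And>s. s \<in> I \<Longrightarrow> d s (\<i> * of_real \<phi>) * v s + (\<Sum>t\<in>I. R s t (\<i> * of_real \<phi>) * v t) = \<nu> * v s"
    and nz: "\<exists>s\<in>I. v s \<noteq> 0" and \<nu>: "Re \<nu> < \<delta> / 4"
  shows "(\<Sum>s\<in>I. y s (\<i> * of_real \<phi>) * v s) \<noteq> 0" "\<nu> = \<mu> (\<i> * of_real \<phi>)"
proof -
  let ?z = "\<i> * complex_of_real \<phi>"
  have z: "?z \<in> ball 0 \<rho>" by (rule imag_in_ball[OF \<phi>])
  show ne: "(\<Sum>s\<in>I. y s ?z * v s) \<noteq> 0"
  proof
    assume "(\<Sum>s\<in>I. y s ?z * v s) = 0"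
    from coercive_on_kernel[OF \<phi> this]
    have 1: "\<delta> / 4 * (\<Sum>s\<in>I. (cmod (v s))\<^sup>2) \<le> Re (\<Sum>s\<in>I. cnj (v s) * (\<nu> * v s))"
      by (simp add: eig)
    have "Re (cnj (v s) * (\<nu> * v s)) = Re \<nu> * (cmod (v s))\<^sup>2" for s
      unfolding cmod_power2 by (simp add: algebra_simps power2_eq_square)
    then have "\<delta> / 4 * (\<Sum>s\<in>I. (cmod (v s))\<^sup>2) \<le> Re \<nu> * (\<Sum>s\<in>I. (cmod (v s))\<^sup>2)"
      using 1 by (simp add: Re_sum sum_distrib_left)
    moreover obtain s where s: "s \<in> I" "v s \<noteq> 0" using nz by blast
    have "0 < (\<Sum>s\<in>I. (cmod (v s))\<^sup>2)"
      by (rule sum_pos2[OF _ s(1)]) (use s in auto)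
    ultimately show False using \<nu> by (simp add: mult_le_cancel_right)
  qed
  have "(\<Sum>s\<in>I. y s ?z * (d s ?z * v s + (\<Sum>t\<in>I. R s t ?z * v t))) = \<mu> ?z * (\<Sum>s\<in>I. y s ?z * v s)"
    by (rule left_eigenvector_pairing) (use left z in auto)
  moreover have "(\<Sum>s\<in>I. y s ?z * (d s ?z * v s + (\<Sum>t\<in>I. R s t ?z * v t))) = \<nu> * (\<Sum>s\<in>I. y s ?z * v s)"
    unfolding sum_distrib_left by (rule sum.cong) (simp_all add: eig)
  ultimately show "\<nu> = \<mu> ?z" using ne by simp
qed

lemma Re_eigenvalue_lt: "z \<in> ball 0 \<rho> \<Longrightarrow> Re (\<mu> z) < \<delta> / 4"
  using \<mu>_le[of z] small_ball[of z] complex_Re_le_cmod[of "\<mu> z"] norm_triangle_ineq[of "\<mu> z - d 0 z" "d 0 z"]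
    small \<delta> by simp

lemma eigenvalue_cnj:
  assumes \<phi>: "\<bar>\<phi>\<bar> < \<rho>"
  shows "\<mu> (- (\<i> * of_real \<phi>)) = cnj (\<mu> (\<i> * of_real \<phi>))"
proof -
  let ?z = "\<i> * complex_of_real \<phi>"
  have z: "?z \<in> ball 0 \<rho>" by (rule imag_in_ball[OF \<phi>])
  have c: "cnj ?z = \<i> * of_real (- \<phi>)" by simp
  obtain v where v: "\<And>s. s \<in> I \<Longrightarrow> d s (cnj ?z) * v s + (\<Sum>t\<in>I. R s t (cnj ?z) * v t) = cnj (\<mu> ?z) * v s"
    "\<exists>s\<in>I. v s \<noteq> 0"
    by (rule bloch_conjugate_eigenvector[of m b S \<alpha> ?z "\<lambda>s. x s ?z" "\<mu> ?z" 0])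
      (use m per right z one index in auto)
  have "cnj (\<mu> ?z) = \<mu> (\<i> * of_real (- \<phi>))"
    by (rule slow_eigenvalue_unique(2)[of "- \<phi>" v]) (use v \<phi> Re_eigenvalue_lt[OF z] c in auto)
  then show ?thesis by simp
qed

text \<open>
  Pairing the residual of the approximate eigenvector \<open>w z\<close> with the left eigenvector
  gives \<open>(\<mu> z - z) g z\<close>, where \<open>g z\<close> is the pairing of the two vectors. At \<open>z = 0\<close> the residual
  vanishes, so \<open>w 0\<close> is a null vector, hence \<open>g 0 \<noteq> 0\<close> by \<open>slow_eigenvalue_unique\<close>, and \<open>g\<close> can be
  divided out near \<open>0\<close>. The constant in the conclusion depends on the mesh.
\<close>

lemma eigenvalue_consistent:
  assumes con: "consistent_to_order m S b \<kappa>" and \<kappa>: "\<kappa> > 0"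
  shows "(\<lambda>z. \<mu> z - z) \<in> O[at 0](\<lambda>z. z ^ \<kappa>)"
proof -
  from con obtain w C where w: "\<And>z j. w z (j + int m) = w z j" "\<And>j. isCont (\<lambda>z. w z j) 0" "\<exists>j. w 0 j \<noteq> 0"
    and C: "\<And>j z. cmod z \<le> 1 \<Longrightarrow> cmod (bloch_op S b z (w z) j - z * w z j) \<le> C j * cmod z ^ \<kappa>"
    unfolding consistent_to_order_def vanishes_to_order_def by metis
  define v where "v = (\<lambda>z s. dft m (w z) s)"
  define e where "e = (\<lambda>z s. dft m (\<lambda>j. bloch_op S b z (w z) j - z * w z j) s)"
  define g where "g = (\<lambda>z. \<Sum>s\<in>I. y s z * v z s)"
  have e: "d s z * v z s + (\<Sum>t\<in>I. R s t z * v z t) - z * v z s = e z s" if "s \<in> I" for s z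
    using dft_bloch_op[of m "w z" s S b z \<alpha>, OF m w(1) that] by (simp add: e_def v_def dft_diff dft_cmult)
  have e_le: "cmod (e z s) \<le> (\<Sum>j\<in>I. C j) * cmod z ^ \<kappa>" if z: "cmod z \<le> 1" for z s
  proof -
    have "cmod (e z s) \<le> (\<Sum>j\<in>I. C j * cmod z ^ \<kappa>)"
      unfolding e_def by (rule order_trans[OF norm_dft_le_sum[OF m] sum_mono[OF C[OF z]]])
    then show ?thesis by (simp add: sum_distrib_right)
  qed
  have v0: "d s 0 * v 0 s + (\<Sum>t\<in>I. R s t 0 * v 0 t) = 0 * v 0 s" if "s \<in> I" for s
    using e[OF that, of 0] e_le[of 0 s] \<kappa> by (simp add: zero_power)
  have v_nz: "\<exists>s\<in>I. v 0 s \<noteq> 0"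
  proof (rule ccontr)
    assume "\<not> (\<exists>s\<in>I. v 0 s \<noteq> 0)"
    then have "w 0 j = 0" for j using dft_inversion[of m "w 0" j, OF m w(1)] by (simp add: v_def)
    then show False using w(3) by simp
  qed
  have g0: "g 0 \<noteq> 0"
    using slow_eigenvalue_unique(1)[of 0 "v 0" 0] v0 v_nz \<rho>(1) \<delta> by (simp add: g_def)
  have "isCont (y s) 0" if "s \<in> I" for s
    using hol(1)[OF that] \<rho>(1) holomorphic_on_imp_continuous_on continuous_on_eq_continuous_at[of "ball 0 \<rho>" "y s"] by auto
  moreover have "isCont (\<lambda>z. v z s) 0" for s
    unfolding v_def dft_def divide_inverse by (intro continuous_intros w(2))
  ultimately have "isCont g 0" unfolding g_def by (intro continuous_intros) auto
  then have "((\<lambda>z. cmod (g z)) \<longlongrightarrow> cmod (g 0)) (at 0)" by (intro tendsto_norm) (simp add: isCont_def)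
  then have ev: "\<forall>\<^sub>F z in at 0. cmod (g 0) / 2 < cmod (g z)"
    by (rule order_tendstoD) (use g0 in simp)
  have \<eta>1': "\<eta> \<le> 1"
  proof (rule ccontr)
    assume "\<not> \<eta> \<le> 1"
    then have "1 * 1 \<le> \<eta>\<^sup>2 * real m" using m by (intro mult_mono) (auto simp: one_le_power)
    then show False using \<eta>1 by simp
  qed
  define B where "B = real m * (\<Sum>j\<in>I. C j)"
  have key: "cmod (\<mu> z - z) * cmod (g z) \<le> B * cmod z ^ \<kappa>" if z: "z \<in> ball 0 \<rho>" for z
  proof -
    have z1: "cmod z \<le> 1" using z \<rho>(2) by simp
    have "(\<Sum>s\<in>I. y s z * e z s) = (\<Sum>s\<in>I. y s z * (d s z * v z s + (\<Sum>t\<in>I. R s t z * v z t))) - z * g z"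
      by (simp add: e[symmetric] g_def algebra_simps sum_subtractf sum_distrib_left)
    also have "(\<Sum>s\<in>I. y s z * (d s z * v z s + (\<Sum>t\<in>I. R s t z * v z t))) = \<mu> z * g z"
      unfolding g_def by (rule left_eigenvector_pairing) (use left z in auto)
    finally have "(\<mu> z - z) * g z = (\<Sum>s\<in>I. y s z * e z s)" by (simp add: algebra_simps)
    also have "cmod \<dots> \<le> (\<Sum>s\<in>I. 1 * ((\<Sum>j\<in>I. C j) * cmod z ^ \<kappa>))"
    proof (rule sum_norm_le)
      fix s assume s: "s \<in> I"
      have "cmod (y s z) \<le> 1"
        using one(2)[OF z] le(2)[of s z] s z \<eta>1' by (cases "s = 0") auto
      then show "cmod (y s z * e z s) \<le> 1 * ((\<Sum>j\<in>I. C j) * cmod z ^ \<kappa>)"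
        unfolding norm_mult by (intro mult_mono e_le z1) auto
    qed
    also have "\<dots> = B * cmod z ^ \<kappa>" by (simp add: B_def)
    finally show ?thesis by (simp add: norm_mult)
  qed
  show ?thesis
  proof (rule bigoI)
    have "\<forall>\<^sub>F z in at 0. z \<in> ball 0 \<rho>"
      by (rule eventually_at_in_open') (use \<rho>(1) in auto)
    with ev show "\<forall>\<^sub>F z in at 0. cmod (\<mu> z - z) \<le> (2 * B / cmod (g 0)) * cmod (z ^ \<kappa>)"
    proof eventually_elim
      case (elim z)
      have "cmod (\<mu> z - z) * (cmod (g 0) / 2) \<le> cmod (\<mu> z - z) * cmod (g z)"
        using elim by (intro mult_left_mono) auto
      also have "\<dots> \<le> B * cmod z ^ \<kappa>" using key[of z] elim by simp
      finally show ?case using g0 by (simp add: field_simps norm_power)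
    qed
  qed
qed

text \<open>
  The even part \<open>\<Delta>\<close> of \<open>\<mu> - d 0\<close> is, on the imaginary axis, the deviation of
  \<open>Re \<mu>\<close> from its uniform value. Consistency makes it of order \<open>\<kappa>\<close> there, with an unknown
  constant; \<open>even_holomorphic_bound\<close> improves this to order \<open>\<kappa> + 1\<close> with a constant
  proportional to \<open>\<epsilon>\<close>, which the dissipation of the uniform scheme absorbs.
\<close>

lemma Re_eigenvalue_nonneg:
  assumes con: "consistent_to_order m S b \<kappa>" and \<kappa>: "odd \<kappa>"
    and O: "(\<lambda>\<phi>. Re (exp_symbol S \<alpha> (\<i> * of_real \<phi>))) \<in> O[at 0](\<lambda>\<phi>. \<phi> ^ \<kappa>)"
    and low: "c * \<bar>\<phi>\<bar> ^ Suc \<kappa> \<le> Re (exp_symbol S \<alpha> (\<i> * of_real \<phi>))"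
    and c: "real m * \<epsilon> * (2 / \<rho>) ^ Suc \<kappa> \<le> c" and \<phi>: "\<bar>\<phi>\<bar> \<le> \<rho> / 2"
  shows "0 \<le> Re (\<mu> (\<i> * of_real \<phi>))"
proof -
  define \<Delta> where "\<Delta> = (\<lambda>z. ((\<mu> z - d 0 z) + (\<mu> (- z) - d 0 (- z))) / 2)"
  have minus: "(\<lambda>z. f (- z)) holomorphic_on ball 0 \<rho>" if "f holomorphic_on ball 0 \<rho>" for f
  proof -
    have "(f \<circ> (\<lambda>z. - z)) holomorphic_on ball 0 \<rho>"
      by (rule holomorphic_on_compose_gen[OF _ that]) (auto intro!: holomorphic_intros)
    then show ?thesis by (simp add: o_def)
  qed
  have h: "\<Delta> holomorphic_on ball 0 \<rho>" unfolding \<Delta>_def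
    by (intro holomorphic_intros minus hol) auto
  have even: "\<Delta> (- z) = \<Delta> z" for z by (simp add: \<Delta>_def add.commute)
  have bound: "cmod (\<Delta> z) \<le> real m * \<epsilon>" if "z \<in> ball 0 \<rho>" for z
    using \<mu>_le[of z] \<mu>_le[of "- z"] that norm_triangle_ineq[of "\<mu> z - d 0 z" "\<mu> (- z) - d 0 (- z)"]
    by (simp add: \<Delta>_def norm_divide)
  have imag: "\<Delta> (\<i> * of_real \<phi>) = of_real (Re (\<mu> (\<i> * of_real \<phi>) - \<i> * of_real \<phi>) - Re (exp_symbol S \<alpha> (\<i> * of_real \<phi>)))"
    if "\<bar>\<phi>\<bar> < \<rho>" for \<phi>
  proof -
    have "d 0 (- (\<i> * of_real \<phi>)) = cnj (d 0 (\<i> * of_real \<phi>))"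
      using exp_symbol_cnj[of S \<alpha> "\<i> * of_real \<phi>"] by (simp add: branch_symbol_0)
    then show ?thesis unfolding \<Delta>_def eigenvalue_cnj[OF that]
      by (simp add: complex_eq_iff branch_symbol_0)
  qed
  have lim: "filterlim (\<lambda>\<phi>::real. \<i> * complex_of_real \<phi>) (at 0) (at 0)"
  proof (rule filterlim_atI)
    have "((\<lambda>\<phi>::real. \<i> * complex_of_real \<phi>) \<longlongrightarrow> \<i> * complex_of_real 0) (at 0)" by (intro tendsto_intros)
    then show "((\<lambda>\<phi>::real. \<i> * complex_of_real \<phi>) \<longlongrightarrow> 0) (at 0)" by simp
    show "\<forall>\<^sub>F \<phi> in at (0::real). \<i> * complex_of_real \<phi> \<noteq> 0"
      using eventually_neq_at_within[of 0 0 UNIV] by eventually_elim simp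
  qed
  have "(\<lambda>\<phi>. \<mu> (\<i> * of_real \<phi>) - \<i> * of_real \<phi>) \<in> O[at 0](\<lambda>\<phi>. (\<i> * of_real \<phi>) ^ \<kappa>)"
    using landau_o.big.compose[OF eigenvalue_consistent[OF con odd_pos[OF \<kappa>]] lim] .
  then obtain c1 where c1: "\<forall>\<^sub>F \<phi> in at 0. cmod (\<mu> (\<i> * of_real \<phi>) - \<i> * of_real \<phi>) \<le> c1 * cmod ((\<i> * of_real \<phi>) ^ \<kappa>)"
    by (auto elim!: landau_o.bigE)
  from O obtain c2 where c2: "\<forall>\<^sub>F \<phi> in at 0. norm (Re (exp_symbol S \<alpha> (\<i> * of_real \<phi>))) \<le> c2 * norm (\<phi> ^ \<kappa>)"
    by (auto elim!: landau_o.bigE)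
  have "\<forall>\<^sub>F \<phi> in at (0::real). \<bar>\<phi>\<bar> < \<rho>"
    using eventually_at_in_open'[of "ball (0::real) \<rho>" 0] \<rho>(1) by simp
  with c1 c2 have "\<forall>\<^sub>F \<phi> in at (0::real). cmod (\<Delta> (\<i> * of_real \<phi>)) \<le> (c1 + c2) * cmod (of_real \<phi> ^ \<kappa>)"
  proof eventually_elim
    case (elim \<phi>)
    have "cmod (\<Delta> (\<i> * of_real \<phi>)) \<le> \<bar>Re (\<mu> (\<i> * of_real \<phi>) - \<i> * of_real \<phi>)\<bar> + \<bar>Re (exp_symbol S \<alpha> (\<i> * of_real \<phi>))\<bar>"
      unfolding imag[OF elim(3)] norm_of_real by (rule abs_triangle_ineq4)
    also have "\<dots> \<le> (c1 + c2) * cmod (of_real \<phi> ^ \<kappa>)"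
      using elim(1,2) abs_Re_le_cmod[of "\<mu> (\<i> * of_real \<phi>) - \<i> * of_real \<phi>"]
      by (simp add: norm_power norm_mult distrib_right power_abs)
    finally show ?case .
  qed
  then have "(\<lambda>\<phi>::real. \<Delta> (\<i> * of_real \<phi>)) \<in> O[at 0](\<lambda>\<phi>. of_real \<phi> ^ \<kappa>)" by (rule bigoI)
  from even_holomorphic_bound[OF h \<rho>(1) this \<kappa> even bound, of "\<i> * of_real \<phi>"] \<phi>
  have "cmod (\<Delta> (\<i> * of_real \<phi>)) \<le> real m * \<epsilon> * (2 / \<rho>) ^ Suc \<kappa> * \<bar>\<phi>\<bar> ^ Suc \<kappa>"
    by (simp add: norm_mult)
  also have "\<dots> \<le> c * \<bar>\<phi>\<bar> ^ Suc \<kappa>" by (intro mult_right_mono c) simp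
  finally have "\<bar>Re (\<mu> (\<i> * of_real \<phi>) - \<i> * of_real \<phi>) - Re (exp_symbol S \<alpha> (\<i> * of_real \<phi>))\<bar>
      \<le> Re (exp_symbol S \<alpha> (\<i> * of_real \<phi>))"
    using imag[of \<phi>] \<phi> \<rho>(1) low by (simp only: norm_of_real)
  then show ?thesis by simp
qed

end

section \<open>Stability of the blocks under small perturbations\<close>

text \<open>
  For \<open>\<bar>\<phi>\<bar> \<le> \<phi>\<^sub>0\<close> the branch \<open>0\<close> is treated through its eigenvector. For larger \<open>\<phi>\<close> all
  branches are uniformly damped, and the block is a contraction.
\<close>

lemma (in bloch_perturbation) block_flow_bound:
  assumes con: "consistent_to_order m S b \<kappa>" and \<kappa>: "odd \<kappa>"
    and O: "(\<lambda>\<phi>. Re (exp_symbol S \<alpha> (\<i> * of_real \<phi>))) \<in> O[at 0](\<lambda>\<phi>. \<phi> ^ \<kappa>)"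
    and low: "\<And>\<phi>. \<bar>\<phi>\<bar> \<le> \<phi>\<^sub>0 \<Longrightarrow> c * \<bar>\<phi>\<bar> ^ Suc \<kappa> \<le> Re (exp_symbol S \<alpha> (\<i> * of_real \<phi>))"
    and \<phi>\<^sub>0: "\<phi>\<^sub>0 \<le> \<rho> / 2" and c: "real m * \<epsilon> * (2 / \<rho>) ^ Suc \<kappa> \<le> c"
    and far: "\<And>\<phi>. \<phi>\<^sub>0 \<le> \<bar>\<phi>\<bar> \<Longrightarrow> \<bar>\<phi>\<bar> \<le> pi / real m \<Longrightarrow> real m * \<epsilon> \<le> Re (exp_symbol S \<alpha> (\<i> * of_real \<phi>))"
    and K: "1 \<le> K" "1 + 2 * \<eta> * sqrt (real m) \<le> K\<^sup>2 * (1 - 2 * \<eta> * sqrt (real m))"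
    and \<phi>: "\<bar>\<phi>\<bar> \<le> pi / real m" and \<tau>: "0 \<le> \<tau>"
    and v: "\<And>t j. 0 \<le> t \<Longrightarrow> v t (j + int m) = v t j"
    and ode: "\<And>t j. 0 \<le> t \<Longrightarrow> ((\<lambda>t. v t j) has_vector_derivative
        - (of_real \<tau> * bloch_op S b (\<i> * of_real \<phi>) (v t) j)) (at t within {0..})"
    and t: "0 \<le> t"
  shows "(\<Sum>j\<in>I. (cmod (v t j))\<^sup>2) \<le> K\<^sup>2 * (\<Sum>j\<in>I. (cmod (v 0 j))\<^sup>2)"
proof -
  let ?z = "\<i> * complex_of_real \<phi>"
  define V where "V = (\<lambda>t s. dft m (v t) s)"
  have pars: "(\<Sum>s\<in>I. (cmod (V t s))\<^sup>2) = (\<Sum>j\<in>I. (cmod (v t j))\<^sup>2) / real m" if "0 \<le> t" for t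
    using dft_parseval[of m "v t" 0, OF m v[OF that]] by (simp add: V_def)
  have V_ode: "((\<lambda>t. V t s) has_vector_derivative
      - (of_real \<tau> * (d s ?z * V t s + (\<Sum>r\<in>I. R s r ?z * V t r)))) (at t within {0..})"
    if s: "s \<in> I" and t: "0 \<le> t" for s t
  proof -
    have "((\<lambda>t. V t s) has_vector_derivative
        (\<Sum>j\<in>I. - (of_real \<tau> * bloch_op S b ?z (v t) j) * root_unity m (- (s * j))) / of_nat m) (at t within {0..})"
      unfolding V_def dft_def
      by (intro has_vector_derivative_divide has_vector_derivative_sum has_vector_derivative_mult_left ode t)
    also have "(\<Sum>j\<in>I. - (of_real \<tau> * bloch_op S b ?z (v t) j) * root_unity m (- (s * j))) / of_nat m
      = - (of_real \<tau> * dft m (bloch_op S b ?z (v t)) s)"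
      by (simp add: dft_def sum_negf sum_distrib_left mult.assoc)
    also have "dft m (bloch_op S b ?z (v t)) s = d s ?z * V t s + (\<Sum>r\<in>I. R s r ?z * V t r)"
      unfolding V_def by (rule dft_bloch_op[of m "v t" s, OF m v[OF t] s])
    finally show ?thesis .
  qed
  have "(\<Sum>s\<in>I. (cmod (V t s))\<^sup>2) \<le> K\<^sup>2 * (\<Sum>s\<in>I. (cmod (V 0 s))\<^sup>2)"
  proof (cases "\<bar>\<phi>\<bar> \<le> \<phi>\<^sub>0")
    case True
    then have \<phi>\<rho>: "\<bar>\<phi>\<bar> < \<rho>" using \<phi>\<^sub>0 \<rho>(1) by simp
    obtain x y \<mu> where "bloch_eigenpair m S \<alpha> b \<rho> \<delta> \<epsilon> \<eta> x y \<mu>" using eigenpair_exists by blast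
    \<comment> \<open>the eigenpair depends on the mesh, but its domain and its bounds do not\<close>
    then interpret E: bloch_eigenpair m S \<alpha> b \<rho> \<delta> \<epsilon> \<eta> x y \<mu> .
    have z: "?z \<in> ball 0 \<rho>" by (rule E.imag_in_ball[OF \<phi>\<rho>])
    have \<mu>0: "0 \<le> Re (\<mu> ?z)"
      by (rule E.Re_eigenvalue_nonneg[OF con \<kappa> O low[OF True] c]) (use True \<phi>\<^sub>0 in simp)
    have co: "0 \<le> Re (\<Sum>s\<in>I. cnj (w s) * (d s ?z * w s + (\<Sum>t\<in>I. R s t ?z * w t)))"
      if "(\<Sum>s\<in>I. y s ?z * w s) = 0" for w
    proof -
      have "0 \<le> \<delta> / 4 * (\<Sum>s\<in>I. (cmod (w s))\<^sup>2)" using \<delta> by (simp add: sum_nonneg)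
      then show ?thesis using E.coercive_on_kernel[OF \<phi>\<rho> that] by linarith
    qed
    show ?thesis
      by (rule perturbed_diagonal_flow_bound[where ?i0.0 = 0 and x = "\<lambda>s. x s ?z" and y = "\<lambda>s. y s ?z"
            and \<mu> = "\<mu> ?z" and \<eta> = \<eta> and d = "\<lambda>s. d s ?z" and R = "\<lambda>s t. R s t ?z" and \<tau> = \<tau>])
        (use index E.one[OF z] E.le z \<eta> \<eta>1 E.right[OF _ z] E.left[OF _ z] \<mu>0 co V_ode \<tau> t K m in auto)
  next
    case False
    have "0 \<le> Re (\<Sum>s\<in>I. cnj (w s) * (d s ?z * w s + (\<Sum>t\<in>I. R s t ?z * w t)))" for w
    proof -
      have dge: "real m * \<epsilon> \<le> Re (d s ?z)" if "s \<in> I" for s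
      proof (cases "s = 0")
        case True then show ?thesis using far[of \<phi>] False \<phi> by (simp add: branch_symbol_0)
      next
        case s: False
        have "real m * \<epsilon> \<le> \<delta>" using small mult_nonneg_nonneg[OF of_nat_0_le_iff \<epsilon>, of m] by linarith
        also have "\<dots> \<le> Re (d s ?z)" using gap_imag[OF _ \<phi>, of s] s that by simp
        finally show ?thesis .
      qed
      have "real m * \<epsilon> * (\<Sum>s\<in>I. (cmod (w s))\<^sup>2) \<le> (\<Sum>s\<in>I. Re (d s ?z) * (cmod (w s))\<^sup>2)"
        unfolding sum_distrib_left by (intro sum_mono mult_right_mono dge) auto
      moreover have "(\<Sum>s\<in>I. Re (d s ?z) * (cmod (w s))\<^sup>2) - real (card I) * \<epsilon> * (\<Sum>s\<in>I. (cmod (w s))\<^sup>2)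
        \<le> Re (\<Sum>s\<in>I. cnj (w s) * (d s ?z * w s + (\<Sum>t\<in>I. R s t ?z * w t)))"
        by (rule Re_quadratic_form_perturbed_diagonal) (auto intro: R_le)
      ultimately show ?thesis by simp
    qed
    then have "(\<Sum>s\<in>I. (cmod (V t s))\<^sup>2) \<le> (\<Sum>s\<in>I. (cmod (V 0 s))\<^sup>2)"
      by (intro energy_nonincreasing[OF V_ode _ \<tau> t]) auto
    also have "\<dots> \<le> K\<^sup>2 * (\<Sum>s\<in>I. (cmod (V 0 s))\<^sup>2)"
      using mult_right_mono[of 1 "K\<^sup>2" "\<Sum>s\<in>I. (cmod (V 0 s))\<^sup>2"] one_le_power[OF K(1), of 2]
      by (simp add: sum_nonneg)
    finally show ?thesis .
  qed
  then show ?thesis using m by (simp add: pars t divide_le_cancel)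
qed

text \<open>
  Near \<open>0\<close> the sign of \<open>f\<close> is that of \<open>c \<phi>\<^bsup>\<kappa> + 1\<^esup>\<close>. Positivity on both sides of \<open>0\<close> therefore
  forces \<open>\<kappa> + 1\<close> to be even and \<open>c > 0\<close>.
\<close>

lemma positive_symbol_order:
  fixes f :: "real \<Rightarrow> real"
  assumes c: "c \<noteq> 0" and O: "(\<lambda>\<phi>. f \<phi> - c * \<phi> ^ (\<kappa> + 1)) \<in> O[at 0](\<lambda>\<phi>. \<bar>\<phi>\<bar> ^ (\<kappa> + 2))"
    and f0: "f 0 = 0" and pos: "\<And>\<phi>. 0 < \<bar>\<phi>\<bar> \<Longrightarrow> \<bar>\<phi>\<bar> < 2 * pi \<Longrightarrow> 0 < f \<phi>"
  shows "odd \<kappa>" "0 < c" "f \<in> O[at 0](\<lambda>\<phi>. \<phi> ^ \<kappa>)"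
    and "\<exists>r>0. \<forall>\<phi>. \<bar>\<phi>\<bar> \<le> r \<longrightarrow> c / 2 * \<bar>\<phi>\<bar> ^ Suc \<kappa> \<le> f \<phi>"
proof -
  from O obtain C where C: "C > 0" "\<forall>\<^sub>F \<phi> in at 0. norm (f \<phi> - c * \<phi> ^ (\<kappa> + 1)) \<le> C * norm (\<bar>\<phi>\<bar> ^ (\<kappa> + 2))"
    by (rule landau_o.bigE)
  then obtain r0 where r0: "r0 > 0" "\<And>\<phi>. \<phi> \<noteq> 0 \<Longrightarrow> \<bar>\<phi>\<bar> < r0 \<Longrightarrow> \<bar>f \<phi> - c * \<phi> ^ Suc \<kappa>\<bar> \<le> C * \<bar>\<phi>\<bar> ^ Suc (Suc \<kappa>)"
    by (auto simp: eventually_at dist_real_def)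
  define r where "r = min (r0 / 2) (min (\<bar>c\<bar> / (2 * C)) 1)"
  have r: "0 < r" "r < r0" "r \<le> \<bar>c\<bar> / (2 * C)" "r \<le> 1" using r0(1) c C(1) by (auto simp: r_def)
  have r2: "C * r \<le> \<bar>c\<bar> / 2" using r(3) C(1) by (simp add: field_simps)
  have near: "\<bar>f \<phi> - c * \<phi> ^ Suc \<kappa>\<bar> \<le> \<bar>c\<bar> / 2 * \<bar>\<phi>\<bar> ^ Suc \<kappa>" if \<phi>: "\<bar>\<phi>\<bar> \<le> r" for \<phi>
  proof (cases "\<phi> = 0")
    case False
    have "\<bar>f \<phi> - c * \<phi> ^ Suc \<kappa>\<bar> \<le> C * \<bar>\<phi>\<bar> * \<bar>\<phi>\<bar> ^ Suc \<kappa>" using r0(2)[OF False] \<phi> r(2) by simp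
    also have "\<dots> \<le> \<bar>c\<bar> / 2 * \<bar>\<phi>\<bar> ^ Suc \<kappa>"
    proof (rule mult_right_mono)
      have "C * \<bar>\<phi>\<bar> \<le> C * r" using C(1) \<phi> by simp
      then show "C * \<bar>\<phi>\<bar> \<le> \<bar>c\<bar> / 2" using r2 by simp
    qed simp
    finally show ?thesis .
  qed (simp add: f0)
  have rpi: "r < 2 * pi" using r(4) pi_gt3 by simp
  have ar: "\<bar>r\<bar> = r" "\<bar>- r\<bar> = r" using r(1) by auto
  have P: "0 < r ^ Suc \<kappa>" using r(1) by simp
  have "0 < c * r ^ Suc \<kappa> + \<bar>c\<bar> / 2 * r ^ Suc \<kappa>" 
    using near[of r, unfolded ar] pos[of r] r(1) rpi by linarith
  then have "0 < (c + \<bar>c\<bar> / 2) * r ^ Suc \<kappa>" by (simp add: algebra_simps)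
  then have "0 < c + \<bar>c\<bar> / 2" using P by (simp only: zero_less_mult_pos2)
  then show c0: "0 < c" using c by (cases "c < 0") auto
  show odd: "odd \<kappa>"
  proof
    assume "even \<kappa>"
    then have mr: "(- r) ^ Suc \<kappa> = - (r ^ Suc \<kappa>)" by (simp add: power_minus_even)
    then have "0 < - (c * r ^ Suc \<kappa>) + c / 2 * r ^ Suc \<kappa>"
      using near[of "- r", unfolded ar mr] pos[of "- r"] r(1) rpi c0 by (simp only: abs_of_pos) linarith
    then have "0 < (- c / 2) * r ^ Suc \<kappa>" by (simp add: algebra_simps)
    then have "0 < - c / 2" using P by (simp only: zero_less_mult_pos2)
    then show False using c0 by simp
  qed
  show "\<exists>r>0. \<forall>\<phi>. \<bar>\<phi>\<bar> \<le> r \<longrightarrow> c / 2 * \<bar>\<phi>\<bar> ^ Suc \<kappa> \<le> f \<phi>"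
  proof (intro exI[of _ r] conjI allI impI r(1))
    fix \<phi> assume \<phi>: "\<bar>\<phi>\<bar> \<le> r"
    have eq: "\<phi> ^ Suc \<kappa> = \<bar>\<phi>\<bar> ^ Suc \<kappa>" using odd by (intro power_even_abs[symmetric]) simp
    show "c / 2 * \<bar>\<phi>\<bar> ^ Suc \<kappa> \<le> f \<phi>" using near[OF \<phi>] unfolding eq abs_of_pos[OF c0] by linarith
  qed
  show "f \<in> O[at 0](\<lambda>\<phi>. \<phi> ^ \<kappa>)"
  proof (rule bigoI[where c = "2 * \<bar>c\<bar>"])
    have "\<forall>\<^sub>F \<phi> in at (0::real). \<bar>\<phi>\<bar> < r" using eventually_at_in_open'[of "ball (0::real) r" 0] r(1) by simp
    then show "\<forall>\<^sub>F \<phi> in at 0. norm (f \<phi>) \<le> 2 * \<bar>c\<bar> * norm (\<phi> ^ \<kappa>)"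
    proof eventually_elim
      case (elim \<phi>)
      have "\<bar>f \<phi>\<bar> \<le> \<bar>c\<bar> / 2 * \<bar>\<phi>\<bar> ^ Suc \<kappa> + \<bar>c * \<phi> ^ Suc \<kappa>\<bar>" using near[of \<phi>] elim by linarith
      also have "\<dots> = (3 / 2 * \<bar>c\<bar> * \<bar>\<phi>\<bar> ^ \<kappa>) * \<bar>\<phi>\<bar>" by (simp add: abs_mult power_abs)
      also have "\<dots> \<le> (3 / 2 * \<bar>c\<bar> * \<bar>\<phi>\<bar> ^ \<kappa>) * 1" using elim r(4) by (intro mult_left_mono) auto
      also have "\<dots> \<le> 2 * \<bar>c\<bar> * norm (\<phi> ^ \<kappa>)" by (simp add: power_abs mult_right_mono)
      finally show ?case by simp
    qed
  qed
qed

lemma not_multiple_2pi: "0 < \<bar>\<theta>\<bar> \<Longrightarrow> \<bar>\<theta>\<bar> < 2 * pi \<Longrightarrow> \<theta> / (2 * pi) \<notin> \<int>"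
proof
  assume \<theta>: "0 < \<bar>\<theta>\<bar>" "\<bar>\<theta>\<bar> < 2 * pi" and "\<theta> / (2 * pi) \<in> \<int>"
  then obtain k :: int where "\<theta> / (2 * pi) = of_int k" by (auto elim: Ints_cases)
  then have k: "\<theta> = of_int k * (2 * pi)" by (simp add: field_simps)
  have "real_of_int \<bar>k\<bar> * (2 * pi) < 1 * (2 * pi)" using \<theta>(2) unfolding k by (simp add: abs_mult)
  then have "real_of_int \<bar>k\<bar> < 1" by (rule mult_right_less_imp_less) simp
  then have "k = 0" by linarith
  then show False using \<theta>(1) k by simp
qed

text \<open>
  This fixes the constants, in an order in which none depends on the coefficients \<open>b\<close>: the
  gap \<open>\<delta>\<close> by compactness, the radius \<open>\<rho>\<close> by continuity, the frequency \<open>\<phi>0\<close> below which the leading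
  term of the symbol dominates, the damping at the frequencies above \<open>\<phi>0\<close>, and
  finally \<open>\<epsilon>\<close>, which is limited by finitely many conditions that hold for all small values.
\<close>

lemma stability_threshold:
  fixes S \<kappa> m :: nat and \<alpha> :: "int \<Rightarrow> real" and K c :: real
  assumes m: "m > 0" and K: "K > 1" and zero: "exp_symbol S \<alpha> 0 = 0"
    and pos: "\<And>\<theta>. \<theta> / (2 * pi) \<notin> \<int> \<Longrightarrow> 0 < Re (exp_symbol S \<alpha> (\<i> * of_real \<theta>))"
    and c: "c \<noteq> 0" and O: "(\<lambda>\<phi>. Re (exp_symbol S \<alpha> (\<i> * of_real \<phi>)) - c * \<phi> ^ (\<kappa> + 1)) \<in> O[at 0](\<lambda>\<phi>. \<bar>\<phi>\<bar> ^ (\<kappa> + 2))"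
  shows "\<exists>e>0. \<forall>b. (\<forall>j k. b (j + int m) k = b j k) \<longrightarrow> (\<forall>j. \<forall>k\<in>{-int S..int S}. \<bar>b j k - \<alpha> k\<bar> \<le> e) \<longrightarrow>
    consistent_to_order m S b \<kappa> \<longrightarrow> bloch_stable m S b K"
proof -
  define f where "f = (\<lambda>\<theta>::real. Re (exp_symbol S \<alpha> (\<i> * of_real \<theta>)))"
  have f0: "f 0 = 0" by (simp add: f_def zero)
  have fpos: "0 < f \<theta>" if "0 < \<bar>\<theta>\<bar>" "\<bar>\<theta>\<bar> < 2 * pi" for \<theta>
    using pos[OF not_multiple_2pi[OF that]] by (simp add: f_def)
  have fcont: "continuous_on A f" for A
    unfolding f_def exp_symbol_def by (intro continuous_intros)
  have feven: "f \<bar>\<theta>\<bar> = f \<theta>" for \<theta>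
    using exp_symbol_cnj[of S \<alpha> "\<i> * of_real \<theta>"] by (simp add: f_def abs_if)
  have O': "(\<lambda>\<phi>. f \<phi> - c * \<phi> ^ (\<kappa> + 1)) \<in> O[at 0](\<lambda>\<phi>. \<bar>\<phi>\<bar> ^ (\<kappa> + 2))"
    using O by (simp only: f_def)
  note ord = positive_symbol_order[of c f \<kappa>, OF c O' f0 fpos]
  from ord(4) obtain r where r: "r > 0" "\<And>\<phi>. \<bar>\<phi>\<bar> \<le> r \<Longrightarrow> c / 2 * \<bar>\<phi>\<bar> ^ Suc \<kappa> \<le> f \<phi>" by blast
  have m1: "pi / real m \<le> 2 * pi - pi / real m" "0 < pi / real m" using m by (auto simp: field_simps)
  \<comment> \<open>for \<open>\<bar>\<phi>\<bar> \<le> \<pi> / m\<close> and \<open>0 < s < m\<close> the number \<open>\<phi> + 2 \<pi> s / m\<close> lies in this interval, which contains no multiple of \<open>2 \<pi>\<close>\<close>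
  obtain \<theta>0 where \<theta>0: "\<theta>0 \<in> {pi / real m..2 * pi - pi / real m}"
      "\<And>\<theta>. \<theta> \<in> {pi / real m..2 * pi - pi / real m} \<Longrightarrow> f \<theta>0 \<le> f \<theta>"
    using continuous_attains_inf[OF compact_Icc _ fcont, of "pi / real m" "2 * pi - pi / real m"] m1 by auto
  define \<delta> where "\<delta> = f \<theta>0"
  have \<delta>: "0 < \<delta>" unfolding \<delta>_def using \<theta>0(1) m1 by (intro fpos) auto
  have branch: "Re (branch_symbol m S \<alpha> s (\<i> * of_real \<phi>)) = f (\<phi> + 2 * pi * of_int s / real m)" for s \<phi>
    by (simp add: branch_symbol_def f_def distrib_left)
  have gap: "\<delta> \<le> Re (branch_symbol m S \<alpha> s (\<i> * of_real \<phi>))"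
    if s: "s \<in> {1..<int m}" and \<phi>: "\<bar>\<phi>\<bar> \<le> pi / real m" for s \<phi>
  proof -
    have "2 * pi / real m * 1 \<le> 2 * pi / real m * of_int s" using s m by (intro mult_left_mono) auto
    moreover have "2 * pi / real m * of_int s \<le> 2 * pi / real m * (real m - 1)"
      using s m by (intro mult_left_mono) auto
    moreover have "2 * pi / real m * (real m - 1) = 2 * pi - 2 * (pi / real m)" using m by (simp add: field_simps)
    ultimately have "\<phi> + 2 * pi * of_int s / real m \<in> {pi / real m..2 * pi - pi / real m}"
      using \<phi> by (simp add: abs_le_iff)
    then show ?thesis unfolding branch \<delta>_def by (rule \<theta>0(2))
  qed
  have bcont: "isCont (branch_symbol m S \<alpha> s) 0" for s
    using holomorphic_branch_symbol[of m S \<alpha> s UNIV] holomorphic_on_imp_continuous_on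
      continuous_on_eq_continuous_at[of UNIV] by blast
  have "\<forall>\<^sub>F z in nhds 0. \<delta> / 2 < Re (branch_symbol m S \<alpha> s z)" if "s \<in> {1..<int m}" for s
  proof (rule order_tendstoD(1)[of _ "Re (branch_symbol m S \<alpha> s 0)"])
    show "((\<lambda>z. Re (branch_symbol m S \<alpha> s z)) \<longlongrightarrow> Re (branch_symbol m S \<alpha> s 0)) (nhds 0)"
      using bcont[of s] by (intro tendsto_Re) (simp add: continuous_at_imp_continuous_at_within isCont_def tendsto_at_iff_tendsto_nhds)
    show "\<delta> / 2 < Re (branch_symbol m S \<alpha> s 0)" using gap[OF that, of 0] \<delta> m1 by simp
  qed
  then have "\<forall>\<^sub>F z in nhds 0. \<forall>s\<in>{1..<int m}. \<delta> / 2 < Re (branch_symbol m S \<alpha> s z)"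
    by (intro eventually_ball_finite) auto
  moreover have "\<forall>\<^sub>F z in nhds 0. cmod (branch_symbol m S \<alpha> 0 z) < \<delta> / 16"
  proof (rule order_tendstoD(2)[of _ "cmod (branch_symbol m S \<alpha> 0 0)"])
    show "((\<lambda>z. cmod (branch_symbol m S \<alpha> 0 z)) \<longlongrightarrow> cmod (branch_symbol m S \<alpha> 0 0)) (nhds 0)"
      using bcont[of 0] by (intro tendsto_norm) (simp add: isCont_def tendsto_at_iff_tendsto_nhds)
    show "cmod (branch_symbol m S \<alpha> 0 0) < \<delta> / 16" using \<delta> by (simp add: branch_symbol_0 zero)
  qed
  ultimately have "\<forall>\<^sub>F z in nhds 0. (\<forall>s\<in>{1..<int m}. \<delta> / 2 < Re (branch_symbol m S \<alpha> s z)) \<and> cmod (branch_symbol m S \<alpha> 0 z) < \<delta> / 16"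
    by (rule eventually_conj)
  then obtain \<rho>0 where \<rho>0: "\<rho>0 > 0" "\<And>z. cmod z < \<rho>0 \<Longrightarrow>
      (\<forall>s\<in>{1..<int m}. \<delta> / 2 < Re (branch_symbol m S \<alpha> s z)) \<and> cmod (branch_symbol m S \<alpha> 0 z) < \<delta> / 16"
    unfolding eventually_nhds_metric by (auto simp: dist_norm)
  define \<rho> where "\<rho> = min \<rho>0 (min 1 (pi / real m))"
  have \<rho>: "0 < \<rho>" "\<rho> \<le> \<rho>0" "\<rho> \<le> 1" "\<rho> \<le> pi / real m" using \<rho>0(1) m1 by (auto simp: \<rho>_def)
  define \<phi>0 where "\<phi>0 = min r (\<rho> / 2)"
  have \<phi>0: "0 < \<phi>0" "\<phi>0 \<le> r" "\<phi>0 \<le> \<rho> / 2" "\<phi>0 \<le> pi / real m" using r(1) \<rho> by (auto simp: \<phi>0_def)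
  obtain \<theta>1 where \<theta>1: "\<theta>1 \<in> {\<phi>0..pi / real m}" "\<And>\<theta>. \<theta> \<in> {\<phi>0..pi / real m} \<Longrightarrow> f \<theta>1 \<le> f \<theta>"
    using continuous_attains_inf[OF compact_Icc _ fcont, of \<phi>0 "pi / real m"] \<phi>0(4) by auto
  have f\<theta>1: "0 < f \<theta>1"
    using \<theta>1(1) \<phi>0(1) m1 by (intro fpos) auto
  define \<eta> where "\<eta> = (\<lambda>\<epsilon>. 8 * real m * \<epsilon> / \<delta>)"
  have t\<eta>: "(\<eta> \<longlongrightarrow> 8 * real m * 0 / \<delta>) (at_right 0)"
    unfolding \<eta>_def by (intro tendsto_intros) (use \<delta> in auto)
  have e1: "\<forall>\<^sub>F \<epsilon> in at_right 0. 24 * real m * \<epsilon> < \<delta>"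
    by (rule order_tendstoD(2)[where y = "24 * real m * 0"], intro tendsto_intros) (use \<delta> in auto)
  have e2: "\<forall>\<^sub>F \<epsilon> in at_right 0. (\<eta> \<epsilon>)\<^sup>2 * real m < 1"
    by (rule order_tendstoD(2)[where y = "(8 * real m * 0 / \<delta>)\<^sup>2 * real m"], intro tendsto_intros t\<eta>) auto
  have e3: "\<forall>\<^sub>F \<epsilon> in at_right 0. (1 + 2 * \<eta> \<epsilon> * sqrt (real m)) - K\<^sup>2 * (1 - 2 * \<eta> \<epsilon> * sqrt (real m)) < 0"
    by (rule order_tendstoD(2)[where y = "(1 + 2 * (8 * real m * 0 / \<delta>) * sqrt (real m)) - K\<^sup>2 * (1 - 2 * (8 * real m * 0 / \<delta>) * sqrt (real m))"],
        intro tendsto_intros t\<eta>) (use K one_less_power[of K 2] in auto)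
  have e4: "\<forall>\<^sub>F \<epsilon> in at_right 0. real m * \<epsilon> * (2 / \<rho>) ^ Suc \<kappa> < c / 2"
    by (rule order_tendstoD(2)[where y = "real m * 0 * (2 / \<rho>) ^ Suc \<kappa>"], intro tendsto_intros) (use ord(2) in auto)
  have e5: "\<forall>\<^sub>F \<epsilon> in at_right 0. real m * \<epsilon> < f \<theta>1"
    by (rule order_tendstoD(2)[where y = "real m * 0"], intro tendsto_intros) (use f\<theta>1 in auto)
  have e6: "\<forall>\<^sub>F \<epsilon> in at_right (0::real). 0 < \<epsilon>" by (rule eventually_at_right_less)
  obtain \<epsilon> where E: "24 * real m * \<epsilon> < \<delta>" "(\<eta> \<epsilon>)\<^sup>2 * real m < 1"
      "(1 + 2 * \<eta> \<epsilon> * sqrt (real m)) - K\<^sup>2 * (1 - 2 * \<eta> \<epsilon> * sqrt (real m)) < 0"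
      "real m * \<epsilon> * (2 / \<rho>) ^ Suc \<kappa> < c / 2" "real m * \<epsilon> < f \<theta>1" "0 < \<epsilon>"
    using eventually_happens[OF eventually_conj[OF e1 eventually_conj[OF e2 eventually_conj[OF e3
          eventually_conj[OF e4 eventually_conj[OF e5 e6]]]]]] by auto
  \<comment> \<open>\<open>L\<close> converts a bound on the coefficients into one on the matrix entries on the strip \<open>\<bar>Re z\<bar> \<le> 1\<close>\<close>
  define L where "L = (2 * real S + 1) * exp (real S)"
  have L: "0 < L" by (simp add: L_def add_nonneg_pos)
  show ?thesis
    unfolding bloch_stable_def
  proof (intro exI[of _ "\<epsilon> / L"] conjI allI impI)
    show "0 < \<epsilon> / L" using E(6) L by simp
    fix b \<phi> \<tau> t :: real and v
    fix b :: "int \<Rightarrow> int \<Rightarrow> real"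
    assume per: "\<forall>j k. b (j + int m) k = b j k" and close: "\<forall>j. \<forall>k\<in>{-int S..int S}. \<bar>b j k - \<alpha> k\<bar> \<le> \<epsilon> / L"
      and con: "consistent_to_order m S b \<kappa>" and \<phi>: "\<bar>\<phi>\<bar> \<le> pi / real m" and \<tau>: "0 \<le> \<tau>"
      and v: "\<forall>t\<ge>0. \<forall>j. v t (j + int m) = v t j"
      and ode: "\<forall>t\<ge>0. \<forall>j. ((\<lambda>t. v t j) has_vector_derivative
        - (of_real \<tau> * bloch_op S b (\<i> * of_real \<phi>) (v t) j)) (at t within {0..})" and t: "0 \<le> t"
    interpret bloch_perturbation m S \<alpha> b \<rho> \<delta> \<epsilon> "\<eta> \<epsilon>"
    proof (unfold_locales; (fact m \<rho> \<delta> gap E(2) per[rule_format])?)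
      show "\<bar>b j k - \<alpha> k\<bar> * ((2 * real S + 1) * exp (real S)) \<le> \<epsilon>" if "k \<in> {-int S..int S}" for j k
        using close that L by (simp add: L_def[symmetric] pos_le_divide_eq)
      show "0 \<le> Re (branch_symbol m S \<alpha> 0 (\<i> * of_real \<phi>))" for \<phi>
      proof (cases "\<phi> / (2 * pi) \<in> \<int>")
        case False then show ?thesis using pos[of \<phi>] by (simp add: branch_symbol_0)
      next
        case True
        then obtain n :: int where "\<phi> / (2 * pi) = of_int n" by (auto elim: Ints_cases)
        then have "\<phi> = 2 * pi * of_int n" by (simp add: field_simps)
        then have "exp (\<i> * of_real \<phi> * of_int k) = 1" for k
          using cis_multiple_2pi[of "of_int (n * k)"] by (simp add: cis_conv_exp mult_ac)
        then have "exp_symbol S \<alpha> (\<i> * of_real \<phi>) = exp_symbol S \<alpha> 0" by (simp add: exp_symbol_def)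
        then show ?thesis by (simp add: branch_symbol_0 zero)
      qed
      show "\<delta> / 2 \<le> Re (branch_symbol m S \<alpha> s z)" if "s \<in> {1..<int m}" "cmod z < \<rho>" for s z
        using \<rho>0(2)[of z] \<rho>(2) that by (simp add: less_imp_le)
      show "cmod (branch_symbol m S \<alpha> 0 z) \<le> \<delta> / 16" if "cmod z < \<rho>" for z
        using \<rho>0(2)[of z] \<rho>(2) that by simp
      show "24 * real m * \<epsilon> \<le> \<delta>" using E(1) by simp
      show "\<eta> \<epsilon> = 8 * real m * \<epsilon> / \<delta>" by (simp add: \<eta>_def)
    qed
    have O1: "(\<lambda>\<phi>. Re (exp_symbol S \<alpha> (\<i> * of_real \<phi>))) \<in> O[at 0](\<lambda>\<phi>. \<phi> ^ \<kappa>)"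
      using ord(3) by (simp only: f_def)
    have low: "c / 2 * \<bar>\<phi>\<bar> ^ Suc \<kappa> \<le> Re (exp_symbol S \<alpha> (\<i> * of_real \<phi>))" if "\<bar>\<phi>\<bar> \<le> \<phi>0" for \<phi>
      using r(2)[of \<phi>] that \<phi>0(2) by (simp only: f_def)
    have far: "real m * \<epsilon> \<le> Re (exp_symbol S \<alpha> (\<i> * of_real \<phi>))" if "\<phi>0 \<le> \<bar>\<phi>\<bar>" "\<bar>\<phi>\<bar> \<le> pi / real m" for \<phi>
    proof -
      have "f \<theta>1 \<le> f \<phi>" using \<theta>1(2)[of "\<bar>\<phi>\<bar>"] that feven[of \<phi>] by simp
      then show ?thesis using E(5) unfolding f_def by linarith
    qed
    have K1: "1 \<le> K" "1 + 2 * \<eta> \<epsilon> * sqrt (real m) \<le> K\<^sup>2 * (1 - 2 * \<eta> \<epsilon> * sqrt (real m))"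
      using K E(3) by simp_all
    show "(\<Sum>j=0..<int m. (cmod (v t j))\<^sup>2) \<le> K\<^sup>2 * (\<Sum>j=0..<int m. (cmod (v 0 j))\<^sup>2)"
      by (rule block_flow_bound[OF con ord(1) O1 low \<phi>0(3) less_imp_le[OF E(4)] far K1 \<phi> \<tau> v[rule_format] ode[rule_format] t])
  qed
qed

section \<open>Decomposition of the mesh system into blocks\<close>

text \<open>
  For each \<open>l\<close> the sequence \<open>v l t\<close> collects the part of \<open>u t\<close> with frequencies congruent to
  \<open>l\<close> modulo \<open>M\<close>, divided by \<open>e\<^bsup>\<i> \<phi> j\<^esup>\<close>. It is \<open>m\<close>-periodic, it solves the block equation since \<open>b\<close> is
  \<open>m\<close>-periodic, and by Parseval on each residue class modulo \<open>m\<close> the squared norms add up.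
\<close>

lemma bloch_decomposition_bound:
  fixes u :: "real \<Rightarrow> int \<Rightarrow> complex"
  assumes m: "m > 0" and M: "M > 0" and per: "\<And>j k. b (j + int m) k = b j k" and \<tau>: "0 \<le> \<tau>"
    and stable: "bloch_stable m S b K"
    and u: "\<And>t j. 0 \<le> t \<Longrightarrow> u t (j + int (m * M)) = u t j"
    and ode: "\<And>t j. 0 \<le> t \<Longrightarrow> ((\<lambda>t. u t j) has_vector_derivative
        - (of_real \<tau> * (\<Sum>k=-int S..int S. of_real (b j k) * u t (j + k)))) (at t within {0..})"
    and t: "0 \<le> t"
  shows "(\<Sum>j=0..<int (m * M). (cmod (u t j))\<^sup>2) \<le> K\<^sup>2 * (\<Sum>j=0..<int (m * M). (cmod (u 0 j))\<^sup>2)"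
proof -
  define N where "N = m * M"
  have N: "N > 0" using m M by (simp add: N_def)
  define g where "g = (\<lambda>l t j q. u t (j + int m * q) * root_unity N (- (l * (j + int m * q))))"
  define v where "v = (\<lambda>l t j. (\<Sum>q=0..<int M. g l t j q) / of_nat M)"
  have g_per: "g l t j (q + int M) = g l t j q" if "0 \<le> t" for l t j q
  proof -
    have "j + int m * (q + int M) = j + int m * q + int (m * M)" by (simp add: algebra_simps)
    moreover have "root_unity N (- (l * (j + int m * q + int (m * M)))) = root_unity N (- (l * (j + int m * q)))"
      using root_unity_periodic[OF N, of "- (l * (j + int m * q))" "- l"] by (simp add: N_def algebra_simps)
    ultimately show ?thesis unfolding g_def by (simp only: u[OF that])
  qed
  have v_per: "v l t (j + int m) = v l t j" if t: "0 \<le> t" for l t j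
  proof -
    have "(\<Sum>q=0..<int M. g l t (j + int m) q) = (\<Sum>q=0..<int M. g l t j (q + 1))"
      by (simp add: g_def algebra_simps)
    also have "\<dots> = (\<Sum>q=1..<1 + int M. g l t j q)"
      by (rule sum.reindex_bij_witness[of _ "\<lambda>j. j - 1" "\<lambda>j. j + 1"]) auto
    also have "\<dots> = (\<Sum>q=0..<int M. g l t j q)" by (rule sum_periodic_shift) (rule g_per[OF t])
    finally show ?thesis by (simp add: v_def)
  qed
  have exp_root: "exp (\<i> * of_real (2 * pi * of_int l / real N) * of_int k) = root_unity N (l * k)" for l k
    by (simp add: root_unity_def cis_conv_exp mult_ac)
  have v_ode: "((\<lambda>t. v l t j) has_vector_derivative
        - (of_real \<tau> * bloch_op S b (\<i> * of_real (2 * pi * of_int l / real N)) (v l t) j)) (at t within {0..})"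
    if t: "0 \<le> t" for l t j
  proof -
    have bq: "b (j + int m * q) k = b j k" for q k
      using periodic_add_multiple[of "\<lambda>j. b j k" m j q] per by simp
    have "((\<lambda>t. v l t j) has_vector_derivative (\<Sum>q=0..<int M.
        - (of_real \<tau> * (\<Sum>k=-int S..int S. of_real (b (j + int m * q) k) * u t (j + int m * q + k)))
          * root_unity N (- (l * (j + int m * q)))) / of_nat M) (at t within {0..})"
      unfolding v_def g_def
      by (intro has_vector_derivative_divide has_vector_derivative_sum has_vector_derivative_mult_left ode t)
    also have "(\<Sum>q=0..<int M.
        - (of_real \<tau> * (\<Sum>k=-int S..int S. of_real (b (j + int m * q) k) * u t (j + int m * q + k)))
          * root_unity N (- (l * (j + int m * q)))) / of_nat M
      = - (of_real \<tau> * (\<Sum>q=0..<int M. \<Sum>k=-int S..int S.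
            of_real (b j k) * (u t (j + int m * q + k) * root_unity N (- (l * (j + int m * q)))) / of_nat M))"
      unfolding bq by (simp add: sum_distrib_left sum_distrib_right sum_negf sum_divide_distrib mult_ac)
    also have "(\<Sum>q=0..<int M. \<Sum>k=-int S..int S.
            of_real (b j k) * (u t (j + int m * q + k) * root_unity N (- (l * (j + int m * q)))) / of_nat M)
      = (\<Sum>k=-int S..int S. of_real (b j k) * root_unity N (l * k) * v l t (j + k))"
    proof (subst sum.swap, rule sum.cong[OF refl])
      fix k
      have "u t (j + int m * q + k) * root_unity N (- (l * (j + int m * q))) = root_unity N (l * k) * g l t (j + k) q" for q
      proof -
        have "root_unity N (l * k) * root_unity N (- (l * (j + k + int m * q))) = root_unity N (- (l * (j + int m * q)))"
          by (simp add: root_unity_add[symmetric] algebra_simps)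
        then show ?thesis by (simp add: g_def ac_simps)
      qed
      then show "(\<Sum>q=0..<int M. of_real (b j k) * (u t (j + int m * q + k) * root_unity N (- (l * (j + int m * q)))) / of_nat M)
        = of_real (b j k) * root_unity N (l * k) * v l t (j + k)"
        by (simp add: v_def sum_distrib_left sum_divide_distrib mult.assoc)
    qed
    finally show ?thesis unfolding bloch_op_def exp_root .
  qed
  have v_dft: "cmod (v l t j) = cmod (dft M (\<lambda>q. u t (j + int m * q)) l)" for l t j
  proof -
    have "root_unity N (- (l * (j + int m * q))) = root_unity N (- (l * j)) * root_unity M (- (l * q))" for q
    proof -
      have "root_unity N (- (l * (int m * q))) = root_unity M (- (l * q))"
        using m by (simp add: root_unity_def N_def divide_simps mult_ac)
      moreover have "- (l * (j + int m * q)) = - (l * j) + - (l * (int m * q))" by (simp add: distrib_left)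
      ultimately show ?thesis by (simp only: root_unity_add)
    qed
    then have "v l t j = root_unity N (- (l * j)) * dft M (\<lambda>q. u t (j + int m * q)) l"
      by (simp add: v_def g_def dft_def sum_distrib_left mult_ac)
    then show ?thesis by (simp add: norm_mult)
  qed
  \<comment> \<open>the block frequencies \<open>2 \<pi> l / N\<close> are needed in \<open>[-\<pi> / m, \<pi> / m]\<close>, so \<open>l\<close> runs over a period of length \<open>M\<close> centred at \<open>0\<close>\<close>
  define a where "a = - int (M div 2)"
  have total: "(\<Sum>l=a..<a + int M. \<Sum>j=0..<int m. (cmod (v l t j))\<^sup>2) = (\<Sum>j=0..<int N. (cmod (u t j))\<^sup>2) / real M"
    if t: "0 \<le> t" for t
  proof -
    have "(\<Sum>l=a..<a + int M. \<Sum>j=0..<int m. (cmod (v l t j))\<^sup>2)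
      = (\<Sum>j=0..<int m. \<Sum>l=a..<a + int M. (cmod (dft M (\<lambda>q. u t (j + int m * q)) l))\<^sup>2)"
      unfolding v_dft by (rule sum.swap)
    also have "\<dots> = (\<Sum>j=0..<int m. (\<Sum>q=0..<int M. (cmod (u t (j + int m * q)))\<^sup>2) / real M)"
    proof (rule sum.cong[OF refl])
      fix j
      have "u t (j + int m * (q + int M)) = u t (j + int m * q)" for q
        using u[OF t, of "j + int m * q"] by (simp add: algebra_simps)
      then show "(\<Sum>l=a..<a + int M. (cmod (dft M (\<lambda>q. u t (j + int m * q)) l))\<^sup>2)
        = (\<Sum>q=0..<int M. (cmod (u t (j + int m * q)))\<^sup>2) / real M"
        by (rule dft_parseval[OF M])
    qed
    also have "\<dots> = (\<Sum>j=0..<int N. (cmod (u t j))\<^sup>2) / real M"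
      unfolding N_def sum_split_residues[OF m] by (simp add: sum_divide_distrib)
    finally show ?thesis .
  qed
  have le: "(\<Sum>j=0..<int m. (cmod (v l t j))\<^sup>2) \<le> K\<^sup>2 * (\<Sum>j=0..<int m. (cmod (v l 0 j))\<^sup>2)"
    if l: "l \<in> {a..<a + int M}" for l
  proof -
    have "\<bar>2 * l\<bar> \<le> int M" using l by (auto simp: a_def zdiv_int)
    then have "\<bar>2 * real_of_int l\<bar> \<le> real M" by linarith
    then have "\<bar>2 * real_of_int l\<bar> * (pi / real N) \<le> real M * (pi / real N)" by (intro mult_right_mono) auto
    then have "\<bar>2 * pi * of_int l / real N\<bar> \<le> pi / real m"
      using m M by (simp add: N_def abs_mult field_simps)
    from stable[unfolded bloch_stable_def, rule_format, OF this \<tau> v_per v_ode t] show ?thesis .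
  qed
  have "(\<Sum>l=a..<a + int M. \<Sum>j=0..<int m. (cmod (v l t j))\<^sup>2)
      \<le> K\<^sup>2 * (\<Sum>l=a..<a + int M. \<Sum>j=0..<int m. (cmod (v l 0 j))\<^sup>2)"
    unfolding sum_distrib_left[of _ _ "{a..<a + int M}"] by (rule sum_mono) (rule le)
  then show ?thesis using total[OF t] total[of 0] M by (simp add: N_def divide_le_cancel)
qed

section \<open>Meshes and their coefficients\<close>

lemma mesh_N_props:
  assumes "is_mesh X"
  shows "X (j + int (mesh_N X)) = X j + 2 * pi" "mesh_N X > 0"
proof -
  from assms obtain N where N: "\<forall>j. X (j + int N) = X j + 2 * pi" and mono: "strict_mono X"
    unfolding is_mesh_def by blast
  have "\<forall>j. X (j + int (mesh_N X)) = X j + 2 * pi"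
    unfolding mesh_N_def
  proof (rule theI[of _ N])
    fix N' assume "\<forall>j. X (j + int N') = X j + 2 * pi"
    then have "X (int N') = X (int N)" using N by (metis add_0)
    then show "N' = N" using strict_mono_eq[OF mono] by simp
  qed (fact N)
  then show 1: "X (j + int (mesh_N X)) = X j + 2 * pi" for j by simp
  show "mesh_N X > 0" using 1[of 0] by (cases "mesh_N X = 0") auto
qed

lemma h_step_mesh_N: "is_mesh X \<Longrightarrow> h_step X (j + int (mesh_N X)) = h_step X j"
  using mesh_N_props(1)[of X j] mesh_N_props(1)[of X "j + 1"] by (simp add: h_step_def ac_simps)

text \<open>
  The remainder of \<open>mesh_N X\<close> modulo the period would be a smaller period.
\<close>

lemma mesh_period_props:
  assumes "is_mesh X"
  shows "mesh_period X > 0" "h_step X (j + int (mesh_period X)) = h_step X j" "mesh_period X dvd mesh_N X"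
proof -
  define P where "P = (\<lambda>m. 1 \<le> m \<and> (\<forall>j. h_step X (j + int m) = h_step X j))"
  have PN: "P (mesh_N X)" using mesh_N_props(2)[OF assms] h_step_mesh_N[OF assms] by (simp add: P_def)
  have mp: "mesh_period X = (LEAST m. P m)" by (simp add: mesh_period_def P_def)
  have Pm: "P (mesh_period X)" unfolding mp by (rule LeastI[of P, OF PN])
  then show m: "mesh_period X > 0" and per: "h_step X (j + int (mesh_period X)) = h_step X j" for j
    by (auto simp: P_def)
  define r where "r = mesh_N X mod mesh_period X"
  have N: "int (mesh_N X) = int r + int (mesh_period X) * int (mesh_N X div mesh_period X)"
    unfolding r_def by (metis add.commute mult_div_mod_eq of_nat_add of_nat_mult)
  have rper: "h_step X (j + int r) = h_step X j" for j
    using periodic_add_multiple[of "h_step X" "mesh_period X" "j + int r" "int (mesh_N X div mesh_period X)", OF per]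
      h_step_mesh_N[OF assms, of j] N by (simp add: add.assoc)
  have "r = 0"
  proof (rule ccontr)
    assume "r \<noteq> 0"
    then have "P r" using rper by (simp add: P_def)
    then have "mesh_period X \<le> r" unfolding mp by (rule Least_le)
    then show False using m by (simp add: r_def not_less[symmetric])
  qed
  then show "mesh_period X dvd mesh_N X" by (simp add: r_def dvd_eq_mod_eq_0)
qed

lemma h_step_bounds:
  assumes "is_mesh X" shows "h_min X \<le> h_step X j" "h_step X j \<le> h_max X"
proof -
  have "range (h_step X) \<subseteq> h_step X ` {0..<int (mesh_period X)}"
  proof
    fix y assume "y \<in> range (h_step X)"
    then obtain j where "y = h_step X j" by blast
    then have "y = h_step X (j mod int (mesh_period X))"
      using periodic_mod[of "h_step X" "mesh_period X" j] mesh_period_props(2)[OF assms] by simp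
    then show "y \<in> h_step X ` {0..<int (mesh_period X)}" using mesh_period_props(1)[OF assms] by simp
  qed
  then have "finite (range (h_step X))" using finite_subset by blast
  then show "h_min X \<le> h_step X j" "h_step X j \<le> h_max X" by (auto simp: h_min_def h_max_def)
qed

lemma h_av_pos: "is_mesh X \<Longrightarrow> h_av X > 0"
  using mesh_N_props(2)[of X] by (simp add: h_av_def)

lemma sum_h_step: "(\<Sum>j=0..<int n. h_step X j) = X (int n) - X 0"
proof (induction n)
  case (Suc n)
  have "{0..<int (Suc n)} = insert (int n) {0..<int n}" by auto
  then show ?case using Suc by (simp add: h_step_def add.commute)
qed simp

lemma h_av_bounds:
  assumes "is_mesh X" shows "h_min X \<le> h_av X" "h_av X \<le> h_max X"
proof -
  have "(\<Sum>j=0..<int (mesh_N X). h_step X j) = 2 * pi"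
    using mesh_N_props(1)[OF assms, of 0] by (simp add: sum_h_step)
  then have e: "(\<Sum>j=0..<int (mesh_N X). h_step X j) = real (mesh_N X) * h_av X"
    using mesh_N_props(2)[OF assms] by (simp add: h_av_def)
  have "real (card {0..<int (mesh_N X)}) * h_min X \<le> (\<Sum>j=0..<int (mesh_N X). h_step X j)"
    by (rule sum_bounded_below) (rule h_step_bounds[OF assms])
  then show "h_min X \<le> h_av X" using e mesh_N_props(2)[OF assms] by simp
  have "(\<Sum>j=0..<int (mesh_N X). h_step X j) \<le> real (card {0..<int (mesh_N X)}) * h_max X"
    by (rule sum_bounded_above) (rule h_step_bounds[OF assms])
  then show "h_av X \<le> h_max X" using e mesh_N_props(2)[OF assms] by simp
qed

lemma scaled_step_near_one:
  assumes X: "is_mesh X" and \<mu>: "h_max X - h_min X \<le> \<mu> * h_av X"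
  shows "\<bar>h_step X j / h_av X - 1\<bar> \<le> \<mu>"
proof -
  have "\<bar>h_step X j - h_av X\<bar> \<le> \<mu> * h_av X"
    using h_step_bounds[OF X, of j] h_av_bounds[OF X] \<mu> by linarith
  moreover have "\<bar>h_step X j / h_av X - 1\<bar> = \<bar>h_step X j - h_av X\<bar> / h_av X"
    using h_av_pos[OF X] by (simp add: diff_divide_distrib[symmetric] abs_divide field_simps)
  ultimately show ?thesis using h_av_pos[OF X] by (simp add: pos_divide_le_eq)
qed

text \<open>
  The power series converges absolutely at a corner of a cube. If the cube is shrunk by a
  factor \<open>\<theta> \<le> 1\<close>, every nonconstant term is at most \<open>\<theta>\<close> times its modulus at the corner.
\<close>

lemma analytic_at_pt_continuous:
  assumes I: "finite I" and an: "analytic_at_pt I f p" and p: "p \<in> I \<rightarrow>\<^sub>E UNIV" and e: "e > 0"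
  shows "\<exists>d>0. \<forall>r\<in>cube I p d. \<bar>f r - f p\<bar> \<le> e"
proof -
  from an obtain e0 c where e0: "e0 > 0" and sum: "\<And>r. r \<in> cube I p e0 \<Longrightarrow>
      ((\<lambda>\<nu>. c \<nu> * (\<Prod>i\<in>I. (r i - p i) ^ \<nu> i)) has_sum f r) (I \<rightarrow>\<^sub>E UNIV)"
    unfolding analytic_at_pt_def by blast
  define T where "T = (\<lambda>r \<nu>. c \<nu> * (\<Prod>i\<in>I. (r i - p i) ^ \<nu> i))"
  define q where "q = e0 / 2"
  have q: "0 < q" "q < e0" using e0 by (auto simp: q_def)
  define r0 where "r0 = (\<lambda>i\<in>I. p i + q)"
  have "r0 \<in> cube I p e0" using q by (auto simp: cube_def r0_def)
  from sum[OF this] have "(T r0 has_sum f r0) (I \<rightarrow>\<^sub>E UNIV)" by (simp add: T_def)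
  then have "T r0 summable_on (I \<rightarrow>\<^sub>E UNIV)" by (rule has_sum_imp_summable)
  then have "(\<lambda>\<nu>. norm (T r0 \<nu>)) summable_on (I \<rightarrow>\<^sub>E UNIV)"
    by (rule summable_on_iff_abs_summable_on_real[THEN iffD1])
  then obtain B where B: "((\<lambda>\<nu>. \<bar>T r0 \<nu>\<bar>) has_sum B) (I \<rightarrow>\<^sub>E UNIV)"
    by (auto simp: summable_on_def)
  have B0: "0 \<le> B" by (rule has_sum_nonneg[OF B]) simp
  have Tr0: "\<bar>T r0 \<nu>\<bar> = \<bar>c \<nu>\<bar> * (\<Prod>i\<in>I. q ^ \<nu> i)" for \<nu>
    using q by (simp add: T_def r0_def abs_mult abs_prod)
  have pc: "p \<in> cube I p e0" using e0 p by (simp add: cube_def)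
  have main: "\<bar>f r - f p\<bar> \<le> \<theta> * B" if \<theta>: "0 < \<theta>" "\<theta> \<le> 1" and r: "r \<in> cube I p (\<theta> * q)" for r \<theta>
  proof -
    have \<theta>q: "\<theta> * q \<le> q" using \<theta> q by simp
    have rq: "\<bar>r i - p i\<bar> < \<theta> * q" if "i \<in> I" for i using r that by (simp add: cube_def)
    have "\<bar>r i - p i\<bar> < e0" if "i \<in> I" for i using rq[OF that] \<theta>q q(2) by linarith
    then have re: "r \<in> cube I p e0" using r by (simp add: cube_def)
    have 1: "((\<lambda>\<nu>. T r \<nu> - T p \<nu>) has_sum f r - f p) (I \<rightarrow>\<^sub>E UNIV)"
      using has_sum_add[OF sum[OF re] has_sum_uminusI[OF sum[OF pc]]] by (simp add: T_def)
    have 2: "((\<lambda>\<nu>. \<theta> * \<bar>T r0 \<nu>\<bar>) has_sum \<theta> * B) (I \<rightarrow>\<^sub>E UNIV)"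
      by (rule has_sum_cmult_right[OF B])
    have 3: "\<bar>T r \<nu> - T p \<nu>\<bar> \<le> \<theta> * \<bar>T r0 \<nu>\<bar>" for \<nu>
    proof (cases "\<forall>i\<in>I. \<nu> i = 0")
      case True
      then have "T r \<nu> = T p \<nu>" by (simp add: T_def)
      then show ?thesis using \<theta> by simp
    next
      case False
      then obtain i0 where i0: "i0 \<in> I" "\<nu> i0 \<noteq> 0" by blast
      have "T p \<nu> = 0" using I i0 by (auto simp: T_def prod_zero_iff)
      moreover have "\<bar>\<Prod>i\<in>I. (r i - p i) ^ \<nu> i\<bar> \<le> \<theta> * (\<Prod>i\<in>I. q ^ \<nu> i)"
      proof -
        have "\<bar>\<Prod>i\<in>I. (r i - p i) ^ \<nu> i\<bar> \<le> (\<Prod>i\<in>I. (\<theta> * q) ^ \<nu> i)"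
          unfolding abs_prod power_abs
          by (intro prod_mono conjI power_mono) (simp_all add: rq less_imp_le)
        also have "\<dots> = \<theta> ^ (\<Sum>i\<in>I. \<nu> i) * (\<Prod>i\<in>I. q ^ \<nu> i)"
          by (simp add: power_mult_distrib prod.distrib power_sum)
        also have "\<dots> \<le> \<theta> ^ 1 * (\<Prod>i\<in>I. q ^ \<nu> i)"
        proof (intro mult_right_mono power_decreasing)
          have "\<nu> i0 \<le> (\<Sum>i\<in>I. \<nu> i)" using I i0(1) by (intro member_le_sum) auto
          then show "1 \<le> (\<Sum>i\<in>I. \<nu> i)" using i0(2) by simp
          show "0 \<le> (\<Prod>i\<in>I. q ^ \<nu> i)" using q(1) by (simp add: prod_nonneg)
        qed (use \<theta> in simp_all)
        finally show ?thesis by simp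
      qed
      then have "\<bar>c \<nu>\<bar> * \<bar>\<Prod>i\<in>I. (r i - p i) ^ \<nu> i\<bar> \<le> \<bar>c \<nu>\<bar> * (\<theta> * (\<Prod>i\<in>I. q ^ \<nu> i))"
        by (rule mult_left_mono) simp
      then have "\<bar>T r \<nu>\<bar> \<le> \<theta> * \<bar>T r0 \<nu>\<bar>"
        unfolding Tr0 by (simp add: T_def abs_mult mult_ac)
      ultimately show ?thesis by simp
    qed
    have "f r - f p \<le> \<theta> * B"
      by (rule has_sum_mono[OF 1 2]) (use 3 in \<open>simp add: abs_le_iff\<close>)
    moreover have "- (f r - f p) \<le> \<theta> * B"
      by (rule has_sum_mono[OF has_sum_uminusI[OF 1] 2]) (use 3 in \<open>simp add: abs_le_iff\<close>)
    ultimately show ?thesis by (simp add: abs_le_iff)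
  qed
  define \<theta> where "\<theta> = min 1 (e / (B + 1))"
  have \<theta>: "0 < \<theta>" "\<theta> \<le> 1" "\<theta> \<le> e / (B + 1)" using e B0 by (auto simp: \<theta>_def)
  have "\<theta> * B \<le> \<theta> * (B + 1)" using \<theta> by simp
  also have "\<dots> \<le> e" using \<theta>(3) B0 by (simp add: field_simps)
  finally have "\<theta> * B \<le> e" .
  then have "\<forall>r\<in>cube I p (\<theta> * q). \<bar>f r - f p\<bar> \<le> e" using main[OF \<theta>(1,2)] order_trans by blast
  then show ?thesis using \<theta>(1) q(1) by (intro exI[of _ "\<theta> * q"]) simp
qed

text \<open>
  The average step lies between the extreme ones, so each scaled step differs from \<open>1\<close> by
  at most \<open>d\<close>, and continuity at the point \<open>ones (stencil S)\<close> applies.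
\<close>

lemma mesh_coefficients_near_uniform:
  assumes adm: "\<And>k. k \<in> {- int S..int S} \<Longrightarrow> admissible_coeff (stencil S) (D k) (a k)" and e: "e > 0"
  shows "\<exists>d>0. \<forall>X. is_mesh X \<longrightarrow> h_max X - h_min X \<le> d * h_av X \<longrightarrow>
    (\<forall>j. \<forall>k\<in>{- int S..int S}. \<bar>a k (scaled_steps S X j) - coeff0 S a k\<bar> \<le> e)"
proof -
  have "\<exists>d>0. \<forall>r\<in>cube (stencil S) (ones (stencil S)) d. \<bar>a k r - coeff0 S a k\<bar> \<le> e"
    if "k \<in> {- int S..int S}" for k
    unfolding coeff0_def
    by (rule analytic_at_pt_continuous[OF _ _ _ e])
      (use adm[OF that] in \<open>auto simp: admissible_coeff_def stencil_def ones_def\<close>)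
  then obtain d where d: "\<And>k. k \<in> {- int S..int S} \<Longrightarrow> d k > 0"
    "\<And>k r. k \<in> {- int S..int S} \<Longrightarrow> r \<in> cube (stencil S) (ones (stencil S)) (d k) \<Longrightarrow> \<bar>a k r - coeff0 S a k\<bar> \<le> e"
    by metis
  define d0 where "d0 = Min (d ` {- int S..int S})"
  have d0: "d0 > 0" "\<And>k. k \<in> {- int S..int S} \<Longrightarrow> d0 \<le> d k"
    unfolding d0_def using d(1) by (auto simp: Min_gr_iff)
  show ?thesis
  proof (intro exI[of _ "d0 / 2"] conjI allI impI ballI)
    show "d0 / 2 > 0" using d0(1) by simp
    fix X j k assume X: "is_mesh X" "h_max X - h_min X \<le> d0 / 2 * h_av X" and k: "k \<in> {- int S..int S}"
    have "\<bar>h_step X (j + i) / h_av X - 1\<bar> < d k" for i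
      using scaled_step_near_one[OF X, of "j + i"] d0(1) d0(2)[OF k] by linarith
    then have "scaled_steps S X j \<in> cube (stencil S) (ones (stencil S)) (d k)"
      by (simp add: cube_def scaled_steps_def ones_def)
    then show "\<bar>a k (scaled_steps S X j) - coeff0 S a k\<bar> \<le> e" by (rule d(2)[OF k])
  qed
qed

section \<open>From exactness to consistency of the blocks\<close>

lemma vanishes_to_order_add:
  assumes "vanishes_to_order n F" "vanishes_to_order n G"
  shows "vanishes_to_order n (\<lambda>z. F z + G z)"
proof -
  from assms obtain C D where "\<And>z. cmod z \<le> 1 \<Longrightarrow> cmod (F z) \<le> C * cmod z ^ n"
      "\<And>z. cmod z \<le> 1 \<Longrightarrow> cmod (G z) \<le> D * cmod z ^ n"
    unfolding vanishes_to_order_def by metis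
  then show ?thesis unfolding vanishes_to_order_def
    by (intro exI[of _ "C + D"] allI impI) (auto simp: distrib_right intro!: norm_triangle_mono)
qed

lemma vanishes_to_order_sum:
  assumes "\<And>i. i \<in> A \<Longrightarrow> vanishes_to_order n (F i)" "finite A"
  shows "vanishes_to_order n (\<lambda>z. \<Sum>i\<in>A. F i z)"
proof -
  obtain C where C: "\<And>i z. i \<in> A \<Longrightarrow> cmod z \<le> 1 \<Longrightarrow> cmod (F i z) \<le> C i * cmod z ^ n"
    using assms(1) unfolding vanishes_to_order_def by metis
  show ?thesis unfolding vanishes_to_order_def
  proof (intro exI[of _ "\<Sum>i\<in>A. C i"] allI impI)
    fix z :: complex assume "cmod z \<le> 1"
    then show "cmod (\<Sum>i\<in>A. F i z) \<le> (\<Sum>i\<in>A. C i) * cmod z ^ n"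
      unfolding sum_distrib_right by (intro sum_norm_le C)
  qed
qed

lemma vanishes_to_order_cmult:
  assumes "vanishes_to_order n F" shows "vanishes_to_order n (\<lambda>z. c * F z)"
proof -
  obtain C where C: "\<And>z. cmod z \<le> 1 \<Longrightarrow> cmod (F z) \<le> C * cmod z ^ n"
    using assms unfolding vanishes_to_order_def by metis
  show ?thesis unfolding vanishes_to_order_def
    by (intro exI[of _ "cmod c * C"] allI impI) (auto simp: norm_mult mult.assoc intro!: mult_left_mono C)
qed

lemma vanishes_to_order_exp_remainder:
  assumes "i < n"
  shows "vanishes_to_order n (\<lambda>z. z ^ i * (exp (z * c) - (\<Sum>l<n - i. (z * c) ^ l / fact l)))"
  unfolding vanishes_to_order_def
proof (intro exI allI impI)
  fix z :: complex assume z: "cmod z \<le> 1"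
  have ni: "n - i = Suc (n - i - 1)" using assms by simp
  have "cmod (exp (z * c) - (\<Sum>l<n - i. (z * c) ^ l / fact l))
      \<le> exp (cmod (z * c)) * cmod (z * c) ^ (n - i) / fact (n - i - 1)"
    using Taylor_exp_field[of "z * c" "n - i - 1"] ni by (simp add: lessThan_Suc_atMost)
  also have "\<dots> \<le> exp (cmod c) * cmod (z * c) ^ (n - i) / fact (n - i - 1)"
  proof -
    have "cmod (z * c) \<le> cmod c" using z mult_right_mono[of "cmod z" 1 "cmod c"] by (simp add: norm_mult)
    then show ?thesis by (intro divide_right_mono mult_right_mono) auto
  qed
  also have "\<dots> = (exp (cmod c) * cmod c ^ (n - i) / fact (n - i - 1)) * cmod z ^ (n - i)"
    by (simp add: norm_mult power_mult_distrib)
  finally have "cmod (z ^ i) * cmod (exp (z * c) - (\<Sum>l<n - i. (z * c) ^ l / fact l))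
      \<le> cmod (z ^ i) * ((exp (cmod c) * cmod c ^ (n - i) / fact (n - i - 1)) * cmod z ^ (n - i))"
    by (rule mult_left_mono) simp
  also have "\<dots> = (exp (cmod c) * cmod c ^ (n - i) / fact (n - i - 1)) * cmod z ^ n"
    using assms by (simp add: norm_power power_add[symmetric])
  finally show "cmod (z ^ i * (exp (z * c) - (\<Sum>l<n - i. (z * c) ^ l / fact l)))
      \<le> (exp (cmod c) * cmod c ^ (n - i) / fact (n - i - 1)) * cmod z ^ n"
    by (simp add: norm_mult)
qed

text \<open>
  The number \<open>\<mu> j n\<close> plays the role of the moment \<open>\<langle>\<mu>\<^sub>j, \<xi>\<^bsup>n\<^esup>\<rangle>\<close>, and the inner sum in the hypothesis
  is the moment of \<open>(\<xi> + k)\<^bsup>n\<^esup>\<close> at \<open>j + k\<close>. The witness is the truncated generating function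
  \<open>(\<Sum>n<\<kappa>. z\<^bsup>n\<^esup> / n! \<mu> j n)\<close>, a substitute for \<open>\<langle>\<mu>\<^sub>j, e\<^bsup>z \<xi>\<^esup>\<rangle>\<close>. Multiplication by \<open>e\<^bsup>z k\<^esup>\<close> shifts \<open>\<xi>\<close> by \<open>k\<close> up
  to truncation errors, and the hypothesis cancels all powers of \<open>z\<close> below \<open>\<kappa>\<close>.
\<close>

lemma moments_imp_consistent:
  fixes \<mu> :: "int \<Rightarrow> nat \<Rightarrow> complex" and b :: "int \<Rightarrow> int \<Rightarrow> real"
  assumes \<kappa>: "\<kappa> > 0"
    and per: "\<And>j n. \<mu> (j + int m) n = \<mu> j n" and nz: "\<mu> j0 0 \<noteq> 0"
    and mom: "\<And>j n. n < \<kappa> \<Longrightarrow> (\<Sum>k=-int S..int S. of_real (b j k) *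
       (\<Sum>i\<le>n. of_nat (n choose i) * of_int k ^ (n - i) * \<mu> (j + k) i)) = of_nat n * \<mu> j (n - 1)"
  shows "consistent_to_order m S b \<kappa>"
proof -
  define w where "w = (\<lambda>z j. \<Sum>n<\<kappa>. z ^ n / fact n * \<mu> j n)"
  have res: "bloch_op S b z (w z) j - z * w z j =
     (\<Sum>k=-int S..int S. of_real (b j k) * (\<Sum>i<\<kappa>. \<mu> (j + k) i / fact i *
        (z ^ i * (exp (z * of_int k) - (\<Sum>l<\<kappa> - i. (z * of_int k) ^ l / fact l)))))
     + (- (\<mu> j (\<kappa> - 1) / fact (\<kappa> - 1)) * z ^ \<kappa>)" for z j
  proof -
    obtain \<kappa>' where \<kappa>': "\<kappa> = Suc \<kappa>'" using \<kappa> gr0_implies_Suc by blast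
    have T: "(\<Sum>n<\<kappa>. z ^ n / fact n * (\<Sum>i\<le>n. of_nat (n choose i) * of_int k ^ (n - i) * \<mu> (j + k) i))
       = (\<Sum>i<\<kappa>. \<mu> (j + k) i / fact i * (z ^ i * (\<Sum>l<\<kappa> - i. (z * of_int k) ^ l / fact l)))" for k
    proof -
      have "(\<Sum>n<\<kappa>. z ^ n / fact n * (\<Sum>i\<le>n. of_nat (n choose i) * of_int k ^ (n - i) * \<mu> (j + k) i))
        = (\<Sum>(n, i)\<in>Sigma {..<\<kappa>} (\<lambda>n. {..n}). z ^ n / fact n * (of_nat (n choose i) * of_int k ^ (n - i) * \<mu> (j + k) i))"
        by (simp add: sum_distrib_left sum.Sigma)
      also have "\<dots> = (\<Sum>(i, l)\<in>Sigma {..<\<kappa>} (\<lambda>i. {..<\<kappa> - i}). \<mu> (j + k) i / fact i * (z ^ i * ((z * of_int k) ^ l / fact l)))"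
      proof (rule sum.reindex_bij_witness[of _ "\<lambda>(i, l). (i + l, i)" "\<lambda>(n, i). (i, n - i)"], goal_cases)
        case (5 p)
        then obtain n i where p: "p = (n, i)" and i: "i \<le> n" by auto
        have z: "z ^ n = z ^ i * z ^ (n - i)" using i by (simp add: power_add[symmetric])
        have "of_nat (n choose i) = (fact n / (fact i * fact (n - i)) :: complex)" by (rule binomial_fact[OF i])
        then show ?case by (simp add: p z power_mult_distrib)
      qed auto
      also have "\<dots> = (\<Sum>i<\<kappa>. \<mu> (j + k) i / fact i * (z ^ i * (\<Sum>l<\<kappa> - i. (z * of_int k) ^ l / fact l)))"
        by (simp add: sum_distrib_left sum.Sigma)
      finally show ?thesis .
    qed
    have zw: "z * w z j = (\<Sum>n<\<kappa>. z ^ n / fact n * (of_nat n * \<mu> j (n - 1))) + \<mu> j (\<kappa> - 1) / fact (\<kappa> - 1) * z ^ \<kappa>"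
    proof -
      have "(\<Sum>n<\<kappa>. z ^ n / fact n * (of_nat n * \<mu> j (n - 1))) = (\<Sum>n<\<kappa>'. z ^ Suc n / fact (Suc n) * (of_nat (Suc n) * \<mu> j n))"
        unfolding \<kappa>' by (subst sum.lessThan_Suc_shift) simp
      also have "\<dots> = (\<Sum>n<\<kappa>'. z * (z ^ n / fact n * \<mu> j n))"
      proof (rule sum.cong[OF refl])
        fix n
        have A: "z ^ Suc n / (A * F) * (A * y) = z * (z ^ n / F * y)" if "A \<noteq> 0" for A F y :: complex
          using that by simp
        have "(of_nat (Suc n) :: complex) \<noteq> 0" by (simp only: of_nat_eq_0_iff)
        then show "z ^ Suc n / fact (Suc n) * (of_nat (Suc n) * \<mu> j n) = z * (z ^ n / fact n * \<mu> j n)"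
          unfolding fact_Suc by (rule A)
      qed
      finally show ?thesis by (simp add: w_def \<kappa>' sum_distrib_left distrib_left)
    qed
    have "(\<Sum>n<\<kappa>. z ^ n / fact n * (of_nat n * \<mu> j (n - 1))) =
      (\<Sum>n<\<kappa>. z ^ n / fact n * (\<Sum>k=-int S..int S. of_real (b j k) *
       (\<Sum>i\<le>n. of_nat (n choose i) * of_int k ^ (n - i) * \<mu> (j + k) i)))"
      by (intro sum.cong refl) (simp add: mom)
    also have "\<dots> = (\<Sum>k=-int S..int S. of_real (b j k) * (\<Sum>n<\<kappa>. z ^ n / fact n *
       (\<Sum>i\<le>n. of_nat (n choose i) * of_int k ^ (n - i) * \<mu> (j + k) i)))"
      unfolding sum_distrib_left[of _ _ "{-int S..int S}"] sum_distrib_left[of _ _ "{..<\<kappa>}"]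
      by (subst sum.swap) (simp add: mult_ac)
    also have "\<dots> = (\<Sum>k=-int S..int S. of_real (b j k) * (\<Sum>i<\<kappa>. \<mu> (j + k) i / fact i * (z ^ i * (\<Sum>l<\<kappa> - i. (z * of_int k) ^ l / fact l))))"
      unfolding T ..
    finally have M: "(\<Sum>n<\<kappa>. z ^ n / fact n * (of_nat n * \<mu> j (n - 1))) = \<dots>" .
    have "bloch_op S b z (w z) j = (\<Sum>k=-int S..int S. of_real (b j k) * (\<Sum>i<\<kappa>. \<mu> (j + k) i / fact i * (z ^ i * exp (z * of_int k))))"
      by (simp add: bloch_op_def w_def sum_distrib_left mult_ac)
    then show ?thesis unfolding zw M
      by (simp add: right_diff_distrib sum_subtractf)
  qed
  have "vanishes_to_order \<kappa> (\<lambda>z. bloch_op S b z (w z) j - z * w z j)" for j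
  proof -
    define F where "F = (\<lambda>z. \<Sum>k=-int S..int S. of_real (b j k) * (\<Sum>i<\<kappa>. \<mu> (j + k) i / fact i *
        (z ^ i * (exp (z * of_int k) - (\<Sum>l<\<kappa> - i. (z * of_int k) ^ l / fact l)))))"
    have F: "vanishes_to_order \<kappa> F" unfolding F_def
      by (intro vanishes_to_order_sum vanishes_to_order_cmult vanishes_to_order_exp_remainder) auto
    have "vanishes_to_order \<kappa> (\<lambda>z. z ^ \<kappa>)"
      unfolding vanishes_to_order_def by (intro exI[of _ 1]) (simp add: norm_power)
    then have G: "vanishes_to_order \<kappa> (\<lambda>z. - (\<mu> j (\<kappa> - 1) / fact (\<kappa> - 1)) * z ^ \<kappa>)"
      by (rule vanishes_to_order_cmult)
    show ?thesis unfolding res using vanishes_to_order_add[OF F G] unfolding F_def .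
  qed
  moreover have "w 0 j0 \<noteq> 0"
  proof -
    have "w 0 j0 = (\<Sum>n<\<kappa>. if n = 0 then \<mu> j0 0 else 0)"
      unfolding w_def by (intro sum.cong) auto
    then show ?thesis using \<kappa> nz by simp
  qed
  moreover have "isCont (\<lambda>z. w z j) 0" for j unfolding w_def by (intro continuous_intros) auto
  moreover have "w z (j + int m) = w z j" for z j by (simp add: w_def per)
  ultimately show ?thesis unfolding consistent_to_order_def by blast
qed

definition poly_fun :: "complex poly \<Rightarrow> real \<Rightarrow> complex" where
  "poly_fun p = (\<lambda>x. poly p (of_real x))"

lemma poly_fun_has_vector_derivative: "(poly_fun p has_vector_derivative poly_fun (pderiv p) x) (at x)"
  unfolding poly_fun_def by (rule has_vector_derivative_real_field) (rule poly_DERIV)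

lemma vector_derivative_poly_fun: "vector_derivative (poly_fun p) (at x) = poly_fun (pderiv p) x"
  by (rule vector_derivative_at[OF poly_fun_has_vector_derivative])

lemma nderiv_poly_fun: "nderiv n (poly_fun p) = poly_fun ((pderiv ^^ n) p)"
  by (induction n) (simp_all add: nderiv_def vector_derivative_poly_fun)

lemma continuous_on_poly_fun: "continuous_on A (poly_fun p)"
  unfolding poly_fun_def by (intro continuous_intros)

lemma poly_fun_C_diff: "poly_fun p \<in> C_diff q A"
  using continuous_on_poly_fun differentiableI_vector[OF poly_fun_has_vector_derivative]
  by (simp add: C_diff_def nderiv_poly_fun)

lemma poly_fun_C_space: "bounded G \<Longrightarrow> poly_fun p \<in> C_space q G"
proof -
  assume "bounded G"
  then have "compact (closure G)" by simp
  then have "bounded (poly_fun p ` closure G)" for p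
    by (intro compact_imp_bounded compact_continuous_image continuous_on_poly_fun)
  then have "bounded (poly_fun p ` G)" for p
    using bounded_subset[OF _ image_mono[OF closure_subset]] by blast
  then show ?thesis by (simp add: C_space_def poly_fun_C_diff nderiv_poly_fun)
qed

lemma C_dual_poly_sum:
  assumes L: "L \<in> C_dual q G" and G: "bounded G" and A: "finite A"
  shows "L (poly_fun (\<Sum>i\<in>A. smult (c i) (p i))) = (\<Sum>i\<in>A. c i * L (poly_fun (p i)))"
proof -
  have add: "L (poly_fun (p + q)) = L (poly_fun p) + L (poly_fun q)" for p q
    using L poly_fun_C_space[OF G] unfolding C_dual_def by (simp add: poly_fun_def)
  have smult: "L (poly_fun (smult c p)) = c * L (poly_fun p)" for c p
    using L poly_fun_C_space[OF G] unfolding C_dual_def by (simp add: poly_fun_def)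
  show ?thesis using A
  proof (induction A rule: finite_induct)
    case empty then show ?case using smult[of 0 0] by simp
  qed (simp add: add smult)
qed

text \<open>
  For the equation with index \<open>j\<close>, exactness is tested on \<open>f(x) = (x / h - j)\<^bsup>n\<^esup>\<close>. Shifting
  the origin to \<open>j\<close> makes the local mapping at \<open>j + k\<close> see \<open>(\<xi> + k)\<^bsup>n\<^esup>\<close>, and no growing powers of \<open>j\<close>
  appear.
\<close>

lemma exact_imp_consistent:
  assumes X: "is_mesh X" and P: "local_mapping P" and ex: "exact_on S a (\<kappa> - 1) P X" and \<kappa>: "\<kappa> > 0"
  shows "consistent_to_order (mesh_period X) S (\<lambda>j k. a k (scaled_steps S X j)) \<kappa>"
proof -
  from P X obtain q G \<nu> where G: "bounded G" and
    \<nu>: "\<And>j. \<nu> j \<in> C_dual q G" "\<And>j. \<nu> j (\<lambda>_. 1) \<noteq> 0"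
      "\<And>j g. g \<in> C_space q G \<Longrightarrow> \<nu> (j + int (mesh_period X)) g = \<nu> j g"
      "\<And>j f. f \<in> C_diff q UNIV \<Longrightarrow> P X f j = \<nu> j (\<lambda>\<xi>. f ((\<xi> + of_int j) * h_av X))"
    unfolding local_mapping_def by metis
  define h where "h = h_av X"
  have h: "h > 0" using h_av_pos[OF X] by (simp add: h_def)
  define M where "M = (\<lambda>j p. \<nu> j (poly_fun p))"
  define \<mu> where "\<mu> = (\<lambda>j n. M j (monom 1 n))"
  have Msum: "M j (\<Sum>i\<in>A. smult (c i) (p i)) = (\<Sum>i\<in>A. c i * M j (p i))" if "finite A" for j c p and A :: "nat set"
    unfolding M_def by (rule C_dual_poly_sum[OF \<nu>(1) G that])
  have Msmult: "M j (smult c p) = c * M j p" for j c p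
    using Msum[of "{0}" j "\<lambda>_. c" "\<lambda>_. p"] by simp
  show ?thesis
  proof (rule moments_imp_consistent[OF \<kappa>, of \<mu> _ 0])
    show "\<mu> (j + int (mesh_period X)) n = \<mu> j n" for j n
      unfolding \<mu>_def M_def by (rule \<nu>(3)) (rule poly_fun_C_space[OF G])
    show "\<mu> 0 0 \<noteq> 0" using \<nu>(2)[of 0] by (simp add: \<mu>_def M_def poly_fun_def one_poly_eq_simps)
    fix j :: int and n :: nat
    assume n: "n < \<kappa>"
    define l where "l = [:- of_int j, 1 / of_real h :: complex:]"
    define p where "p = l ^ n"
    have deg: "degree p \<le> \<kappa> - 1"
    proof -
      have "degree l \<le> 1" by (simp add: l_def)
      then have "degree l * n \<le> 1 * n" by (rule mult_le_mono1)
      then show ?thesis using degree_power_le[of l n] n unfolding p_def by linarith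
    qed
    have l: "poly l (of_real ((\<xi> + of_int i) * h)) = of_real \<xi> + of_int (i - j)" for \<xi> i
      using h by (simp add: l_def field_simps)
    have Pp: "P X (poly_fun p) (j + k) = (\<Sum>i\<le>n. of_nat (n choose i) * of_int k ^ (n - i) * \<mu> (j + k) i)" for k
    proof -
      have "P X (poly_fun p) (j + k) = \<nu> (j + k) (\<lambda>\<xi>. poly_fun p ((\<xi> + of_int (j + k)) * h))"
        unfolding h_def by (rule \<nu>(4)[OF poly_fun_C_diff])
      also have "(\<lambda>\<xi>. poly_fun p ((\<xi> + of_int (j + k)) * h))
         = poly_fun (\<Sum>i\<le>n. smult (of_nat (n choose i) * of_int k ^ (n - i)) (monom 1 i))"
      proof
        fix \<xi>
        have "poly_fun p ((\<xi> + of_int (j + k)) * h) = (of_real \<xi> + of_int k) ^ n"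
          using l[of \<xi> "j + k"] by (simp add: poly_fun_def p_def)
        also have "\<dots> = (\<Sum>i\<le>n. of_nat (n choose i) * of_real \<xi> ^ i * of_int k ^ (n - i))" by (rule binomial_ring)
        finally show "poly_fun p ((\<xi> + of_int (j + k)) * h)
          = poly_fun (\<Sum>i\<le>n. smult (of_nat (n choose i) * of_int k ^ (n - i)) (monom 1 i)) \<xi>"
          by (simp add: poly_fun_def poly_sum poly_monom mult_ac)
      qed
      finally show ?thesis using Msum[of "{..n}" "j + k"] by (simp add: M_def \<mu>_def)
    qed
    have Pp': "P X (poly_fun (pderiv p)) j = of_nat n / of_real h * \<mu> j (n - 1)"
    proof -
      have "P X (poly_fun (pderiv p)) j = \<nu> j (\<lambda>\<xi>. poly_fun (pderiv p) ((\<xi> + of_int j) * h))"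
        unfolding h_def by (rule \<nu>(4)[OF poly_fun_C_diff])
      also have "(\<lambda>\<xi>. poly_fun (pderiv p) ((\<xi> + of_int j) * h)) = poly_fun (smult (of_nat n / of_real h) (monom 1 (n - 1)))"
      proof
        fix \<xi>
        have "pderiv l = [:1 / of_real h:]" by (simp add: l_def pderiv_pCons)
        then show "poly_fun (pderiv p) ((\<xi> + of_int j) * h) = poly_fun (smult (of_nat n / of_real h) (monom 1 (n - 1))) \<xi>"
          using l[of \<xi> j] by (simp add: poly_fun_def p_def pderiv_power poly_monom)
      qed
      finally show ?thesis using Msmult[of j "of_nat n / of_real h" "monom 1 (n - 1)"] by (simp add: M_def \<mu>_def)
    qed
    have "trunc_error S a X (poly_fun p) P j = 0"
      using ex deg unfolding exact_on_def poly_fun_def by blast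
    then have "(\<Sum>k=-int S..int S. of_real (1 / h * a k (scaled_steps S X j)) * P X (poly_fun p) (j + k))
       = P X (poly_fun (pderiv p)) j"
      by (simp add: trunc_error_def mesh_coeff_def vector_derivative_poly_fun h_def)
    then have "(1 / of_real h) * (\<Sum>k=-int S..int S. of_real (a k (scaled_steps S X j)) * P X (poly_fun p) (j + k))
       = (1 / of_real h) * (of_nat n * \<mu> j (n - 1))"
      unfolding Pp' by (simp add: sum_distrib_left)
    then show "(\<Sum>k=-int S..int S. of_real (a k (scaled_steps S X j)) *
       (\<Sum>i\<le>n. of_nat (n choose i) * of_int k ^ (n - i) * \<mu> (j + k) i)) = of_nat n * \<mu> j (n - 1)"
      unfolding Pp using h by simp
  qed
qed

section \<open>Almost contractivity on nearly uniform meshes\<close>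

lemma symbol0_eq: "symbol0 S a \<phi> = exp_symbol S (coeff0 S a) (\<i> * of_real \<phi>)"
  by (simp add: symbol0_def exp_symbol_def)

theorem theorem2p1:
  fixes S \<kappa> :: nat
    and a :: "int \<Rightarrow> (int \<Rightarrow> real) \<Rightarrow> real"
    and D :: "int \<Rightarrow> (int \<Rightarrow> real) set"
  assumes "S \<ge> 1"
    and "\<And>k. k \<in> {- int S..int S} \<Longrightarrow> admissible_coeff (stencil S) (D k) (a k)"
    and "(\<Sum>k = - int S..int S. coeff0 S a k) = 0"
    and "(\<Sum>k = - int S..int S. of_int k * coeff0 S a k) = 1"
    and "\<exists>c::real. c \<noteq> 0 \<and>
           (\<lambda>\<phi>. Re (symbol0 S a \<phi>) - c * \<phi> ^ (\<kappa> + 1)) \<in> O[at 0](\<lambda>\<phi>. \<bar>\<phi>\<bar> ^ (\<kappa> + 2))"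
    and "\<And>\<phi>::real. \<phi> / (2 * pi) \<notin> \<int> \<Longrightarrow> Re (symbol0 S a \<phi>) > 0"
    and "\<exists>\<mu>0 P. (\<forall>n\<ge>1. \<mu>0 n > 0) \<and> local_mapping P \<and>
           (\<forall>X \<in> mesh_family \<mu>0. coeffs_defined S D X \<and> exact_on S a (\<kappa> - 1) P X)"
  shows "\<forall>K>1. \<exists>\<mu>. (\<forall>n\<ge>1. \<mu> n > 0) \<and>
           (\<forall>X \<in> mesh_family \<mu>. coeffs_defined S D X \<and>
              (\<forall>u. is_solution S a X u \<longrightarrow>
                 (\<forall>t\<ge>0. norm_av X (u t) \<le> K * norm_av X (u 0))))"
proof (intro allI impI)
  fix K :: real assume K: "K > 1"
  define \<alpha> where "\<alpha> = coeff0 S a"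
  obtain c where c: "c \<noteq> 0" and
      O: "(\<lambda>\<phi>. Re (exp_symbol S \<alpha> (\<i> * of_real \<phi>)) - c * \<phi> ^ (\<kappa> + 1)) \<in> O[at 0](\<lambda>\<phi>. \<bar>\<phi>\<bar> ^ (\<kappa> + 2))"
    using assms(5) unfolding symbol0_eq \<alpha>_def by blast
  have pos: "0 < Re (exp_symbol S \<alpha> (\<i> * of_real \<theta>))" if "\<theta> / (2 * pi) \<notin> \<int>" for \<theta>
    using assms(6)[OF that] by (simp add: symbol0_eq \<alpha>_def)
  have zero: "exp_symbol S \<alpha> 0 = 0"
    using assms(3) by (simp add: exp_symbol_def \<alpha>_def of_real_sum[symmetric] del: of_real_sum)
  \<comment> \<open>in particular \<open>\<kappa> > 0\<close>, so that exactness to degree \<open>\<kappa> - 1\<close> covers the constants\<close>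
  have "odd \<kappa>"
    by (rule positive_symbol_order(1)[OF c O]) (simp_all add: zero pos not_multiple_2pi)
  then have \<kappa>: "\<kappa> > 0" by (rule odd_pos)
  obtain \<mu>0 P where \<mu>0: "\<And>n. n \<ge> 1 \<Longrightarrow> \<mu>0 n > 0" and P: "local_mapping P"
    and exact: "\<And>X. X \<in> mesh_family \<mu>0 \<Longrightarrow> coeffs_defined S D X \<and> exact_on S a (\<kappa> - 1) P X"
    using assms(7) by blast
  have "\<exists>\<mu>>0. \<mu> \<le> \<mu>0 m \<and> (\<forall>X. is_mesh X \<longrightarrow> mesh_period X = m \<longrightarrow> h_max X - h_min X \<le> \<mu> * h_av X \<longrightarrow>
      exact_on S a (\<kappa> - 1) P X \<longrightarrow> (\<forall>u. is_solution S a X u \<longrightarrow>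
                 (\<forall>t\<ge>0. norm_av X (u t) \<le> K * norm_av X (u 0))))" if m: "m \<ge> 1" for m
  proof -
    have m0: "m > 0" using m by simp
    obtain e where e: "e > 0" and stable: "\<And>b. \<forall>j k. b (j + int m) k = b j k \<Longrightarrow>
        \<forall>j. \<forall>k\<in>{-int S..int S}. \<bar>b j k - \<alpha> k\<bar> \<le> e \<Longrightarrow> consistent_to_order m S b \<kappa> \<Longrightarrow> bloch_stable m S b K"
      using stability_threshold[OF m0 K zero pos c O] by blast
    obtain d where d: "d > 0" and near: "\<And>X j k. is_mesh X \<Longrightarrow> h_max X - h_min X \<le> d * h_av X \<Longrightarrow>
        k \<in> {- int S..int S} \<Longrightarrow> \<bar>a k (scaled_steps S X j) - \<alpha> k\<bar> \<le> e"
      using mesh_coefficients_near_uniform[of S D a e, OF assms(2) e] unfolding \<alpha>_def by blast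
    show ?thesis
    proof (intro exI[of _ "min (\<mu>0 m) d"] conjI allI impI)
      show "min (\<mu>0 m) d > 0" using \<mu>0[OF m] d by simp
      show "min (\<mu>0 m) d \<le> \<mu>0 m" by simp
      \<comment> \<open>the bound \<open>\<mu>0 m\<close> keeps the mesh in the family on which exactness is known\<close>
      fix X u and t :: real
      assume X: "is_mesh X" and period: "mesh_period X = m"
        and small: "h_max X - h_min X \<le> min (\<mu>0 m) d * h_av X"
        and ex: "exact_on S a (\<kappa> - 1) P X" and sol: "is_solution S a X u" and t: "t \<ge> 0"
      define b where "b = (\<lambda>j k. a k (scaled_steps S X j))"
      define \<tau> where "\<tau> = 1 / h_av X"
      have h: "h_av X > 0" by (rule h_av_pos[OF X])
      have "min (\<mu>0 m) d * h_av X \<le> d * h_av X" using h by (intro mult_right_mono) auto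
      then have small_d: "h_max X - h_min X \<le> d * h_av X" using small by linarith
      have "scaled_steps S X (j + int m) = scaled_steps S X j" for j
      proof -
        have "h_step X (j + int m + i) = h_step X (j + i)" for i
          using mesh_period_props(2)[OF X, of "j + i"] by (simp add: period ac_simps)
        then show ?thesis by (simp add: scaled_steps_def)
      qed
      then have per: "b (j + int m) k = b j k" for j k by (simp add: b_def)
      have con: "consistent_to_order m S b \<kappa>"
        using exact_imp_consistent[OF X P ex \<kappa>] by (simp add: period b_def)
      obtain M where N: "mesh_N X = m * M" using mesh_period_props(3)[OF X] period by (auto elim: dvdE)
      have M: "M > 0" using mesh_N_props(2)[OF X] N by (cases "M = 0") auto
      have \<tau>: "0 \<le> \<tau>" using h by (simp add: \<tau>_def)
      have "(\<Sum>j=0..<int (m * M). (cmod (u t j))\<^sup>2) \<le> K\<^sup>2 * (\<Sum>j=0..<int (m * M). (cmod (u 0 j))\<^sup>2)"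
      proof (rule bloch_decomposition_bound[of m M b \<tau> S K u, OF m0 M per \<tau> _ _ _ t])
        show "bloch_stable m S b K"
          by (rule stable[OF _ _ con]) (use per near[OF X small_d] in \<open>simp_all add: b_def\<close>)
        show "u t (j + int (m * M)) = u t j" if "0 \<le> t" for t j
          using sol that N by (simp add: is_solution_def mesh_function_def)
        show "((\<lambda>t. u t j) has_vector_derivative
          - (of_real \<tau> * (\<Sum>k=-int S..int S. of_real (b j k) * u t (j + k)))) (at t within {0..})" if "0 \<le> t" for t j
        proof -
          from sol that have "\<exists>d. ((\<lambda>s. u s j) has_vector_derivative d) (at t within {0..}) \<and>
              d + (\<Sum>k = - int S..int S. of_real (mesh_coeff S a X j k) * u t (j + k)) = 0"
            by (simp only: is_solution_def)
          then obtain d where d: "((\<lambda>s. u s j) has_vector_derivative d) (at t within {0..})"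
            "d + (\<Sum>k = - int S..int S. of_real (mesh_coeff S a X j k) * u t (j + k)) = 0"
            by (elim exE conjE)
          have "(\<Sum>k = - int S..int S. of_real (mesh_coeff S a X j k) * u t (j + k))
            = of_real \<tau> * (\<Sum>k=-int S..int S. of_real (b j k) * u t (j + k))"
            by (simp add: mesh_coeff_def b_def \<tau>_def sum_distrib_left)
          then have "d = - (of_real \<tau> * (\<Sum>k=-int S..int S. of_real (b j k) * u t (j + k)))"
            using d(2) by (simp add: eq_neg_iff_add_eq_0)
          then show ?thesis using d(1) by simp
        qed
      qed
      then have "1 / real (mesh_N X) * (\<Sum>j=0..<int (mesh_N X). (cmod (u t j))\<^sup>2)
         \<le> K\<^sup>2 * (1 / real (mesh_N X) * (\<Sum>j=0..<int (mesh_N X). (cmod (u 0 j))\<^sup>2))"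
        using mesh_N_props(2)[OF X] unfolding N[symmetric] by (simp add: divide_right_mono)
      then have "norm_av X (u t) \<le> sqrt (K\<^sup>2 * (1 / real (mesh_N X) * (\<Sum>j=0..<int (mesh_N X). (cmod (u 0 j))\<^sup>2)))"
        unfolding norm_av_def by (rule real_sqrt_le_mono)
      also have "\<dots> = K * norm_av X (u 0)" unfolding norm_av_def real_sqrt_mult[of "K\<^sup>2"] using K by simp
      finally show "norm_av X (u t) \<le> K * norm_av X (u 0)" .
    qed
  qed
  then obtain \<mu> where \<mu>: "\<And>m. m \<ge> 1 \<Longrightarrow> \<mu> m > 0" "\<And>m. m \<ge> 1 \<Longrightarrow> \<mu> m \<le> \<mu>0 m"
    "\<And>m X u t. m \<ge> 1 \<Longrightarrow> is_mesh X \<Longrightarrow> mesh_period X = m \<Longrightarrow> h_max X - h_min X \<le> \<mu> m * h_av X \<Longrightarrow>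
      exact_on S a (\<kappa> - 1) P X \<Longrightarrow> is_solution S a X u \<Longrightarrow> t \<ge> 0 \<Longrightarrow> norm_av X (u t) \<le> K * norm_av X (u 0)"
    by metis
  show "\<exists>\<mu>. (\<forall>n\<ge>1. \<mu> n > 0) \<and>
           (\<forall>X \<in> mesh_family \<mu>. coeffs_defined S D X \<and>
              (\<forall>u. is_solution S a X u \<longrightarrow>
                 (\<forall>t\<ge>0. norm_av X (u t) \<le> K * norm_av X (u 0))))"
  proof (intro exI[of _ \<mu>] conjI ballI)
    show "\<forall>n\<ge>1. \<mu> n > 0" using \<mu>(1) by blast
    fix X assume "X \<in> mesh_family \<mu>"
    then have X: "is_mesh X" "h_max X - h_min X \<le> \<mu> (mesh_period X) * h_av X" by (auto simp: mesh_family_def)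
    have m1: "mesh_period X \<ge> 1" using mesh_period_props(1)[OF X(1)] by simp
    have "\<mu> (mesh_period X) * h_av X \<le> \<mu>0 (mesh_period X) * h_av X"
      using \<mu>(2)[OF m1] h_av_pos[OF X(1)] by (intro mult_right_mono) auto
    then have X0: "X \<in> mesh_family \<mu>0" using X by (simp add: mesh_family_def)
    show "coeffs_defined S D X" using exact[OF X0] by blast
    show "\<forall>u. is_solution S a X u \<longrightarrow> (\<forall>t\<ge>0. norm_av X (u t) \<le> K * norm_av X (u 0))"
      using \<mu>(3)[OF m1 X(1) refl X(2)] exact[OF X0] by blast
  qed
qed

end
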